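(* Let $(G,V,f)$ be an instance of coset identification and $H=\{g\in G: f(g)=f(e)\}$. An optimal single-query algorithm for $(G,V,f)$ succeeds with probability $$P_{\rm opt}=\max_{Y\in\mathrm{Irr}(H)}\frac{\dim\,(Y^{\uparrow})_V}{\dim Y^{\uparrow}}.$$
   Context: Coset identification: $G$ finite group, $\pi:G\to U(V)$ a finite-dimensional unitary representation, $f:G\to X$ a surjective map of left $G$-sets onto a transitive $G$-set $X$. A single-query algorithm consists of $N\ge1$, unit vector $\psi\in V\otimes\mathbb{C}^N$, a unitary $U_1$ and a POVM $\{E_x\}_{x\in X}$, producing $\psi_a=U_1(\pi(a)\otimes I)\psi$; success probability $\frac1{|G|}\sum_a\langle\psi_a|E_{f(a)}|\psi_a\rangle$. $\mathrm{Irr}(H)$ is the set of irreducible representations of $H$; $Y^{\uparrow}=\mathbb{C}G\otimes_{\mathbb{C}H}Y$ is the induced representation of $G$. For representations $A,B$ of $G$, $A_B$ denotes the maximal subrepresentation of $A$ all of whose irreducible constituents appear in $B$ (the sum of the isotypic components of $A$ for isotypes occurring in $B$). *)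

theory Defs
  imports "HOL-Algebra.Group" "Jordan_Normal_Form.Matrix"
begin

definition cinner :: "nat \<Rightarrow> complex vec \<Rightarrow> complex vec \<Rightarrow> complex" where
  "cinner n u v = (\<Sum>i<n. cnj (u $ i) * v $ i)"

definition adj :: "complex mat \<Rightarrow> complex mat" where
  "adj A = mat (dim_col A) (dim_row A) (\<lambda>(i,j). cnj (A $$ (j,i)))"

definition unitary_mat :: "nat \<Rightarrow> complex mat \<Rightarrow> bool" where
  "unitary_mat n U \<longleftrightarrow> U \<in> carrier_mat n n \<and> U * adj U = 1\<^sub>m n \<and> adj U * U = 1\<^sub>m n"

definition psd_mat :: "nat \<Rightarrow> complex mat \<Rightarrow> bool" where
  "psd_mat n E \<longleftrightarrow> E \<in> carrier_mat n n \<and>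
     (\<forall>v \<in> carrier_vec n. Im (cinner n v (E *\<^sub>v v)) = 0 \<and> Re (cinner n v (E *\<^sub>v v)) \<ge> 0)"

definition povm :: "nat \<Rightarrow> 'x set \<Rightarrow> ('x \<Rightarrow> complex mat) \<Rightarrow> bool" where
  "povm n X E \<longleftrightarrow> (\<forall>x\<in>X. psd_mat n (E x)) \<and>
     (\<forall>i<n. \<forall>j<n. (\<Sum>x\<in>X. E x $$ (i,j)) = (1\<^sub>m n :: complex mat) $$ (i,j))"

text \<open>Kronecker product A \<otimes> I_N for a d x d matrix A, with V \<otimes> C^N = C^(d*N),
  basis vector e_i \<otimes> e_k having index i*N+k.\<close>
definition kron_id :: "nat \<Rightarrow> nat \<Rightarrow> complex mat \<Rightarrow> complex mat" where
  "kron_id d N A = mat (d*N) (d*N)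
     (\<lambda>(r,c). if r mod N = c mod N then A $$ (r div N, c div N) else 0)"

definition is_algorithm :: "nat \<Rightarrow> 'x set \<Rightarrow> nat \<Rightarrow> complex vec \<Rightarrow> complex mat \<Rightarrow> ('x \<Rightarrow> complex mat) \<Rightarrow> bool" where
  "is_algorithm d X N \<psi> U E \<longleftrightarrow> N \<ge> 1 \<and> \<psi> \<in> carrier_vec (d*N) \<and> cinner (d*N) \<psi> \<psi> = 1
     \<and> unitary_mat (d*N) U \<and> povm (d*N) X E"

definition success_prob :: "('g,'b) monoid_scheme \<Rightarrow> nat \<Rightarrow> ('g \<Rightarrow> complex mat) \<Rightarrow> ('g \<Rightarrow> 'x)
     \<Rightarrow> nat \<Rightarrow> complex vec \<Rightarrow> complex mat \<Rightarrow> ('x \<Rightarrow> complex mat) \<Rightarrow> real" where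
  "success_prob G d \<pi> f N \<psi> U E =
     (1 / real (card (carrier G))) * (\<Sum>a\<in>carrier G.
        let \<psi>a = U *\<^sub>v (kron_id d N (\<pi> a) *\<^sub>v \<psi>) in Re (cinner (d*N) \<psi>a (E (f a) *\<^sub>v \<psi>a)))"

text \<open>Vectors are functions 'i => complex; a representation is a finite-dimensional
  subspace S together with linear operators rho g on S.\<close>

definition vzero :: "'i \<Rightarrow> complex" where "vzero = (\<lambda>_. 0)"

definition vsubspace :: "('i \<Rightarrow> complex) set \<Rightarrow> bool" where
  "vsubspace S \<longleftrightarrow> vzero \<in> S \<and> (\<forall>x\<in>S. \<forall>y\<in>S. (\<lambda>i. x i + y i) \<in> S)
     \<and> (\<forall>c. \<forall>x\<in>S. (\<lambda>i. c * x i) \<in> S)"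

definition vspan :: "('i \<Rightarrow> complex) set \<Rightarrow> ('i \<Rightarrow> complex) set" where
  "vspan B = {v. \<exists>c. v = (\<lambda>i. \<Sum>b\<in>B. c b * b i)}"

definition fin_dim :: "('i \<Rightarrow> complex) set \<Rightarrow> bool" where
  "fin_dim S \<longleftrightarrow> (\<exists>B. finite B \<and> B \<subseteq> S \<and> S \<subseteq> vspan B)"

definition vdim :: "('i \<Rightarrow> complex) set \<Rightarrow> nat" where
  "vdim S = (LEAST n. \<exists>B. finite B \<and> card B = n \<and> B \<subseteq> S \<and> S \<subseteq> vspan B)"

definition lin_on :: "('i \<Rightarrow> complex) set \<Rightarrow> (('i \<Rightarrow> complex) \<Rightarrow> ('j \<Rightarrow> complex)) \<Rightarrow> bool" where
  "lin_on S T \<longleftrightarrow> (\<forall>x\<in>S. \<forall>y\<in>S. T (\<lambda>i. x i + y i) = (\<lambda>j. T x j + T y j))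
     \<and> (\<forall>c. \<forall>x\<in>S. T (\<lambda>i. c * x i) = (\<lambda>j. c * T x j))"

definition is_rep :: "('g,'b) monoid_scheme \<Rightarrow> ('i \<Rightarrow> complex) set \<Rightarrow> ('g \<Rightarrow> ('i \<Rightarrow> complex) \<Rightarrow> ('i \<Rightarrow> complex)) \<Rightarrow> bool" where
  "is_rep G S \<rho> \<longleftrightarrow> vsubspace S \<and> fin_dim S
     \<and> (\<forall>g\<in>carrier G. lin_on S (\<rho> g) \<and> \<rho> g ` S \<subseteq> S)
     \<and> (\<forall>x\<in>S. \<rho> \<one>\<^bsub>G\<^esub> x = x)
     \<and> (\<forall>g\<in>carrier G. \<forall>h\<in>carrier G. \<forall>x\<in>S. \<rho> (g \<otimes>\<^bsub>G\<^esub> h) x = \<rho> g (\<rho> h x))"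

definition invariant_sub :: "('g,'b) monoid_scheme \<Rightarrow> ('i \<Rightarrow> complex) set \<Rightarrow> ('g \<Rightarrow> ('i \<Rightarrow> complex) \<Rightarrow> ('i \<Rightarrow> complex))
     \<Rightarrow> ('i \<Rightarrow> complex) set \<Rightarrow> bool" where
  "invariant_sub G S \<rho> W \<longleftrightarrow> vsubspace W \<and> W \<subseteq> S \<and> (\<forall>g\<in>carrier G. \<rho> g ` W \<subseteq> W)"

definition irreducible_rep :: "('g,'b) monoid_scheme \<Rightarrow> ('i \<Rightarrow> complex) set \<Rightarrow> ('g \<Rightarrow> ('i \<Rightarrow> complex) \<Rightarrow> ('i \<Rightarrow> complex)) \<Rightarrow> bool" where
  "irreducible_rep G S \<rho> \<longleftrightarrow> is_rep G S \<rho> \<and> S \<noteq> {vzero}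
     \<and> (\<forall>W. invariant_sub G S \<rho> W \<longrightarrow> W = {vzero} \<or> W = S)"

definition embeds :: "('g,'b) monoid_scheme \<Rightarrow> ('i \<Rightarrow> complex) set \<Rightarrow> ('g \<Rightarrow> ('i \<Rightarrow> complex) \<Rightarrow> ('i \<Rightarrow> complex))
     \<Rightarrow> ('j \<Rightarrow> complex) set \<Rightarrow> ('g \<Rightarrow> ('j \<Rightarrow> complex) \<Rightarrow> ('j \<Rightarrow> complex)) \<Rightarrow> bool" where
  "embeds G W \<rho> S' \<sigma> \<longleftrightarrow> (\<exists>T. lin_on W T \<and> inj_on T W \<and> T ` W \<subseteq> S'
     \<and> (\<forall>g\<in>carrier G. \<forall>w\<in>W. T (\<rho> g w) = \<sigma> g (T w)))"

text \<open>dim A_B: dimension of the maximal subrepresentation of A = (S, rho) all of whose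
  irreducible constituents (irreducible subrepresentations) occur in B = (S', sigma).\<close>
definition part_dim :: "('g,'b) monoid_scheme \<Rightarrow> ('i \<Rightarrow> complex) set \<Rightarrow> ('g \<Rightarrow> ('i \<Rightarrow> complex) \<Rightarrow> ('i \<Rightarrow> complex))
     \<Rightarrow> ('j \<Rightarrow> complex) set \<Rightarrow> ('g \<Rightarrow> ('j \<Rightarrow> complex) \<Rightarrow> ('j \<Rightarrow> complex)) \<Rightarrow> nat" where
  "part_dim G S \<rho> S' \<sigma> = Max {vdim W | W. invariant_sub G S \<rho> W \<and>
       (\<forall>U. invariant_sub G W \<rho> U \<and> irreducible_rep G U \<rho> \<longrightarrow> embeds G U \<rho> S' \<sigma>)}"

text \<open>Induced representation of a representation (S, rho) of the subgroup H, realised as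
  {F : G -> Y | F(g h) = rho(h)^-1 F(g)} with (x.F)(g) = F(x^-1 g); this is isomorphic to
  CG \<otimes>_{CH} Y.  F is stored uncurried as a function on G \<times> 'i, zero outside G.\<close>
definition ind_space :: "('g,'b) monoid_scheme \<Rightarrow> 'g set \<Rightarrow> ('i \<Rightarrow> complex) set
     \<Rightarrow> ('g \<Rightarrow> ('i \<Rightarrow> complex) \<Rightarrow> ('i \<Rightarrow> complex)) \<Rightarrow> ('g \<times> 'i \<Rightarrow> complex) set" where
  "ind_space G H S \<rho> = {F. (\<forall>g i. g \<notin> carrier G \<longrightarrow> F (g,i) = 0)
      \<and> (\<forall>g\<in>carrier G. (\<lambda>i. F (g,i)) \<in> S)
      \<and> (\<forall>g\<in>carrier G. \<forall>h\<in>H. (\<lambda>i. F (g \<otimes>\<^bsub>G\<^esub> h, i)) = \<rho> (inv\<^bsub>G\<^esub> h) (\<lambda>i. F (g,i)))}"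

definition ind_act :: "('g,'b) monoid_scheme \<Rightarrow> 'g \<Rightarrow> ('g \<times> 'i \<Rightarrow> complex) \<Rightarrow> ('g \<times> 'i \<Rightarrow> complex)" where
  "ind_act G x F = (\<lambda>(g,i). if g \<in> carrier G then F (inv\<^bsub>G\<^esub> x \<otimes>\<^bsub>G\<^esub> g, i) else 0)"

definition mat_space :: "nat \<Rightarrow> (nat \<Rightarrow> complex) set" where
  "mat_space d = {v. \<forall>i\<ge>d. v i = 0}"

definition mat_act :: "nat \<Rightarrow> ('g \<Rightarrow> complex mat) \<Rightarrow> 'g \<Rightarrow> (nat \<Rightarrow> complex) \<Rightarrow> (nat \<Rightarrow> complex)" where
  "mat_act d \<pi> g v = (\<lambda>i. if i < d then (\<Sum>j<d. \<pi> g $$ (i,j) * v j) else 0)"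

end

theory Submission
  imports Defs "HOL-Library.Function_Algebras" "HOL-Analysis.Function_Topology"
    "HOL-Analysis.Topology_Euclidean_Space" "Jordan_Normal_Form.Spectral_Radius"
begin

text \<open>
  Let \<open>W\<close> be the space of matrix coefficients of \<open>V\<close>, a two-sided invariant subspace of
  \<open>L\<^sup>2(G)\<close>. Orthogonal projection onto \<open>W\<close> is convolution with a central idempotent \<open>c\<close>, and the
  optimal success probability is the largest eigenvalue \<open>l\<close> of the compression to \<open>L\<^sup>2(H)\<close> of this
  projection; equivalently, \<open>l\<close> is the maximum over \<open>w \<in> W\<close> of the fraction of \<open>\<parallel>w\<parallel>\<^sup>2\<close> carried
  by \<open>H\<close>.

  Upper bound: the coordinates of the final state \<open>\<psi>\<^sub>a\<close> are, up to conjugation, in \<open>W\<close> as functions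
  of \<open>a\<close>. Writing each \<open>E\<^sub>x\<close> as a sum of rank-one operators, the success probability becomes a sum
  of masses of elements of \<open>W\<close> on cosets of \<open>H\<close>, and each of them is at most \<open>l\<close> times the total mass.

  Attainment: \<open>W\<close> embeds isometrically and equivariantly in \<open>V \<otimes> \<complex>\<^sup>d\<close>, where the vectors
  \<open>V y = (\<pi>(y) \<otimes> I) \<Xi>\<close> with Gram matrix \<open>c(z\<^sup>-\<^sup>1y)\<close> play the role of the projected point masses. Measure
  the coset of \<open>y\<close> on the state corresponding to a top eigenvector.

  Representation side: \<open>c\<close> acts on every representation of \<open>G\<close> as the projection onto the
  constituents occurring in \<open>V\<close>, and its restriction to \<open>H\<close> acts on an irreducible \<open>Y\<close> as a scalar
  \<open>\<mu>\<close>. The trace of \<open>c\<close> on \<open>Ind Y\<close> is \<open>\<mu> dim Ind Y\<close>, so the quotient of dimensions is \<open>\<mu>\<close>. The values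
  \<open>\<mu>\<close> are the eigenvalues of the compressed projection on \<open>L\<^sup>2(H)\<close>.
\<close>

section \<open>Hermitian forms\<close>

text \<open>The usual formula for \<open>c\<close>, a sum of irreducible characters weighted by
  dimension, presupposes the decomposition of \<open>V\<close> and the orthogonality relations. Here
  \<open>c\<close> comes from inverting one \<open>d\<close> by \<open>d\<close> matrix, and every
  later property rests on three facts: \<open>c\<close> is a matrix coefficient, it acts on
  \<open>V\<close> as the identity, and it has a Gram form because that matrix is positive.
  Centrality is not built in; it follows because left convolution by \<open>c\<close> fixes all of
  \<open>W\<close>, which is invariant under translation on both sides.

  Complete reducibility is avoided likewise: \<open>c\<close> is idempotent on every representation
  of \<open>G\<close>, and its kernel contains no irreducible occurring in \<open>V\<close>, which
  suffices to determine \<open>part_dim\<close>.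

  Irreducible representations of \<open>H\<close> carry no inner product here, whereas
  \<open>l\<close> is defined by the one on \<open>L\<^sup>2(H)\<close>. The bridge is to pass from
  a vector \<open>s\<close> of \<open>Y\<close> to a scalar function
  \<open>h \<mapsto> (\<rho>(h\<^sup>-\<^sup>1) s) j\<close> on \<open>H\<close>, which turns the
  action of \<open>c\<close> into the compressed kernel.\<close>

lemma cmod_square: "of_real ((cmod z)\<^sup>2) = cnj z * z"
  by (simp only: complex_norm_square mult.commute)

text \<open>The index set is arbitrary because the same forms serve for measurement operators on
  \<open>{..<n}\<close> and for the kernel \<open>K\<close> on the subgroup
  \<open>H\<close>.\<close>

definition sesq :: "'a set \<Rightarrow> ('a \<Rightarrow> 'a \<Rightarrow> complex) \<Rightarrow> ('a \<Rightarrow> complex) \<Rightarrow> ('a \<Rightarrow> complex) \<Rightarrow> complex" where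
  "sesq A E x y = (\<Sum>i\<in>A. \<Sum>j\<in>A. cnj (x i) * E i j * y j)"

definition psd_on :: "'a set \<Rightarrow> ('a \<Rightarrow> 'a \<Rightarrow> complex) \<Rightarrow> bool" where
  "psd_on A E \<longleftrightarrow> (\<forall>x. Im (sesq A E x x) = 0 \<and> Re (sesq A E x x) \<ge> 0)"

lemma sesq_add_scale:
  "sesq A E (\<lambda>i. x i + t * y i) (\<lambda>i. x i + t * y i) =
   sesq A E x x + t * sesq A E x y + cnj t * sesq A E y x + cnj t * t * sesq A E y y"
  unfolding sesq_def sum_distrib_left sum.distrib[symmetric]
  by (intro sum.cong refl) (simp add: algebra_simps)

text \<open>\<open>psd_on\<close> speaks only of the diagonal values of the form. Polarisation
  recovers the rest: the mixed terms at \<open>x + t y\<close> have real sum for every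
  \<open>t\<close>, and \<open>t = 1\<close> and \<open>t = \<i>\<close> compare the imaginary and
  the real parts.\<close>

lemma psd_on_hermitian_form:
  assumes "psd_on A E"
  shows "sesq A E y x = cnj (sesq A E x y)"
proof -
  have *: "Im (t * sesq A E x y + cnj t * sesq A E y x) = 0" for t
  proof -
    have "Im (sesq A E y y) = 0"
      using assms by (simp add: psd_on_def)
    moreover have "Im (sesq A E (\<lambda>i. x i + t * y i) (\<lambda>i. x i + t * y i)) = 0" "Im (sesq A E x x) = 0"
      using assms by (auto simp: psd_on_def)
    ultimately show ?thesis
      unfolding sesq_add_scale by simp
  qed
  show ?thesis
    using *[of 1] *[of \<i>] by (simp add: complex_eq_iff)
qed

text \<open>Along \<open>y + t x\<close> the quadratic term vanishes, so a nonzero mixed term would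
  make the form unbounded below. Both the Cholesky step with a vanishing pivot and the eigenvector
  equation at a maximum of the Rayleigh quotient are instances.\<close>

lemma psd_on_kernel:
  assumes "psd_on A E" "sesq A E x x = 0"
  shows "sesq A E y x = 0"
proof (rule ccontr)
  let ?b = "sesq A E y x" and ?a = "Re (sesq A E y y)"
  assume b: "?b \<noteq> 0"
  have ge: "0 \<le> ?a + 2 * Re (t * ?b)" for t
  proof -
    have "Re (sesq A E (\<lambda>i. y i + t * x i) (\<lambda>i. y i + t * x i)) \<ge> 0"
      using assms by (auto simp: psd_on_def)
    then show ?thesis
      unfolding sesq_add_scale using assms(2) psd_on_hermitian_form[OF assms(1), of x y] by simp
  qed
  have nb: "cmod ?b ^ 2 > 0" using b by simp
  \<comment> \<open>This value of \<open>t\<close> makes \<open>t * ?b\<close> equal to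
    \<open>- (?a + 1)\<close>, which drives the form down to \<open>- ?a - 2\<close>.\<close>
  have "- ((?a + 1) / (cmod ?b)^2) * cnj ?b * ?b = - (?a + 1)"
    using nb b by (simp add: complex_norm_square mult.commute field_simps flip: of_real_power)
  moreover have "?a \<ge> 0" using assms(1) by (simp add: psd_on_def)
  ultimately show False
    using ge[of "- ((?a + 1) / (cmod ?b)^2) * cnj ?b"] by simp
qed

lemma sesq_unit:
  assumes "finite A" "i \<in> A"
  shows "sesq A E (\<lambda>k. of_bool (k = i)) y = (\<Sum>j\<in>A. E i j * y j)"
proof -
  have "sesq A E (\<lambda>k. of_bool (k = i)) y = (\<Sum>k\<in>A. if k = i then \<Sum>j\<in>A. E i j * y j else 0)"
    unfolding sesq_def by (intro sum.cong) auto
  then show ?thesis using assms by simp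
qed

lemma sesq_unit_unit:
  assumes "finite A" "i \<in> A" "j \<in> A"
  shows "sesq A E (\<lambda>k. of_bool (k = i)) (\<lambda>k. of_bool (k = j)) = E i j"
proof -
  have "(\<Sum>k\<in>A. E i k * of_bool (k = j)) = (\<Sum>k\<in>A. if k = j then E i j else 0)"
    by (intro sum.cong) auto
  then show ?thesis using assms by (simp add: sesq_unit)
qed

lemma psd_on_hermitian:
  assumes "psd_on A E" "finite A" "i \<in> A" "j \<in> A"
  shows "E j i = cnj (E i j)"
  using psd_on_hermitian_form[OF assms(1)] sesq_unit_unit[OF assms(2)] assms(3,4) by metis

text \<open>Cholesky factorisation by Schur complements. When the pivot \<open>E n n\<close> vanishes, so does
  its whole row, and division by zero yields the correct (trivial) complement.\<close>

lemma psd_on_factorization: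
  assumes "psd_on {..<n::nat} E"
  shows "\<exists>b. \<forall>i<n. \<forall>j<n. E i j = (\<Sum>k<n. b k i * cnj (b k j))"
  using assms
proof (induction n arbitrary: E)
  case 0
  then show ?case by simp
next
  case (Suc n)
  note psd = Suc.prems
  have herm: "E j i = cnj (E i j)" if "i \<le> n" "j \<le> n" for i j
    using psd_on_hermitian[OF psd, of i j] that by simp
  have "Im (E n n) = 0 \<and> Re (E n n) \<ge> 0"
    using psd sesq_unit_unit[of "{..<Suc n}" n n E] unfolding psd_on_def by (metis finite_lessThan lessThan_iff lessI)
  then obtain a where a: "E n n = of_real a" "a \<ge> 0"
    by (metis complex_is_Real_iff of_real_Re)
  have row0: "E i n = 0" if "i \<le> n" "a = 0" for i
  proof -
    have "sesq {..<Suc n} E (\<lambda>k. of_bool (k = n)) (\<lambda>k. of_bool (k = n)) = 0"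
      using that a sesq_unit_unit[of "{..<Suc n}" n n E] by simp
    then have "sesq {..<Suc n} E (\<lambda>k. of_bool (k = i)) (\<lambda>k. of_bool (k = n)) = 0"
      by (rule psd_on_kernel[OF psd])
    then show ?thesis using that sesq_unit_unit[of "{..<Suc n}" i n E] by simp
  qed
  define F where "F i j = E i j - E i n * E n j / E n n" for i j
  \<comment> \<open>The last coordinate of \<open>y\<close> is the minimising one for the given
    \<open>x\<close>. Every value of the form of \<open>F\<close> is therefore a value of the form
    of \<open>E\<close>, and positivity passes to \<open>F\<close>.\<close>
  have schur: "sesq {..<n} F x x = sesq {..<Suc n} E y y"
    if y: "y = (\<lambda>i. if i = n then - (\<Sum>j<n. E n j * x j) / E n n else x i)" for x y
  proof -
    define s where "s = (\<Sum>j<n. E n j * x j)"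
    have s': "(\<Sum>i<n. cnj (x i) * E i n) = cnj s"
      unfolding s_def cnj_sum by (intro sum.cong refl) (simp add: herm[of n])
    have yn: "y n = - s / E n n" and yi: "\<And>i. i < n \<Longrightarrow> y i = x i"
      using y s_def by auto
    have "sesq {..<Suc n} E y y = (\<Sum>i<n. \<Sum>j<n. cnj (x i) * E i j * x j)
        + (\<Sum>i<n. cnj (x i) * E i n) * y n + cnj (y n) * (\<Sum>j<n. E n j * x j) + cnj (y n) * E n n * y n"
      unfolding sesq_def by (simp add: yi sum.distrib sum_distrib_left sum_distrib_right mult.assoc)
    also have "\<dots> = (\<Sum>i<n. \<Sum>j<n. cnj (x i) * E i j * x j) - cnj s * s / E n n"
      unfolding s' s_def[symmetric] yn using a by (cases "a = 0") (auto simp: field_simps)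
    also have "cnj s * s / E n n = (\<Sum>i<n. \<Sum>j<n. cnj (x i) * (E i n * E n j / E n n) * x j)"
      unfolding s'[symmetric] unfolding s_def sum_product by (simp add: sum_divide_distrib mult_ac)
    finally show ?thesis
      unfolding sesq_def F_def by (simp add: algebra_simps sum_subtractf)
  qed
  have "psd_on {..<n} F"
    using psd unfolding psd_on_def schur[OF refl] by blast
  then obtain b where b: "\<And>i j. i < n \<Longrightarrow> j < n \<Longrightarrow> F i j = (\<Sum>k<n. b k i * cnj (b k j))"
    using Suc.IH[of F] by blast
  define v where "v i = E i n / sqrt a" for i
  have v: "v i * cnj (v j) = E i n * E n j / E n n" if "i \<le> n" "j \<le> n" for i j
    using that a herm[of j n] unfolding v_def by (simp flip: of_real_mult)
  define b' where "b' k i = (if k = n then v i else if i = n then 0 else b k i)" for k i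
  have "E i j = (\<Sum>k<Suc n. b' k i * cnj (b' k j))" if ij: "i \<le> n" "j \<le> n" for i j
  proof -
    have "(\<Sum>k<n. b' k i * cnj (b' k j)) = (if i = n \<or> j = n then 0 else F i j)"
      unfolding b'_def using b[of i j] ij by auto
    moreover have "E i n * E n n / E n n = E i n" "E n n * E n j / E n n = E n j"
      using row0[of i] row0[of j] herm[of j n] a ij by (cases "a = 0"; simp)+
    ultimately show ?thesis
      using v[OF ij] by (auto simp: b'_def F_def)
  qed
  then show ?case by (metis less_Suc_eq_le)
qed

text \<open>The Rayleigh quotient attains its maximum on the unit sphere by compactness. At the
  maximum the nonnegative form of \<open>l - K\<close> vanishes, so \<open>psd_on_kernel\<close>
  turns maximality into the eigenvector equation without any differentiation.\<close>

lemma hermitian_top_eigenvector: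
  fixes K :: "'a \<Rightarrow> 'a \<Rightarrow> complex"
  assumes fin: "finite A" and ne: "A \<noteq> {}" and herm: "\<And>a b. a \<in> A \<Longrightarrow> b \<in> A \<Longrightarrow> K b a = cnj (K a b)"
  obtains l :: real and u :: "'a \<Rightarrow> complex" where "(\<Sum>a\<in>A. (cmod (u a))\<^sup>2) = 1" "\<And>a. a \<notin> A \<Longrightarrow> u a = 0"
    "\<And>a. a \<in> A \<Longrightarrow> (\<Sum>b\<in>A. K a b * u b) = l * u a"
    "\<And>v. Re (sesq A K v v) \<le> l * (\<Sum>a\<in>A. (cmod (v a))\<^sup>2)"
proof -
  define N where "N v = (\<Sum>a\<in>A. (cmod (v a))\<^sup>2)" for v :: "'a \<Rightarrow> complex"
  \<comment> \<open>The ambient type may be infinite. Pinning the coordinates outside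
    \<open>A\<close> to 0 leaves a product of compact sets, and the closed unit disc is large enough
    for the coordinates of a unit vector.\<close>
  define B where "B = PiE UNIV (\<lambda>a::'a. if a \<in> A then cball (0::complex) 1 else {0})"
  define S where "S = B \<inter> {u. N u = 1}"
  have contN: "continuous_on UNIV N"
    unfolding N_def by (intro continuous_intros continuous_on_product_coordinates)
  have contQ: "continuous_on UNIV (\<lambda>u. Re (sesq A K u u))"
    unfolding sesq_def by (intro continuous_intros continuous_on_product_coordinates)
  have "compactin (product_topology (\<lambda>_. euclidean) UNIV) B"
    unfolding B_def compactin_PiE by (auto simp: compactin_euclidean_iff)
  then have "compact B"
    by (simp add: euclidean_product_topology compactin_euclidean_iff)
  moreover have "closed {u. N u = 1}"
    using contN by (intro closed_Collect_eq continuous_on_const)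
  ultimately have comp: "compact S" unfolding S_def by (rule compact_Int_closed)
  obtain a0 where a0: "a0 \<in> A" using ne by blast
  have "N (\<lambda>a. of_bool (a = a0)) = (\<Sum>a\<in>A. if a = a0 then 1 else 0)"
    unfolding N_def by (intro sum.cong) auto
  then have "(\<lambda>a. of_bool (a = a0)) \<in> S"
    using a0 fin unfolding S_def B_def by auto
  then obtain u where u: "u \<in> S" "\<And>v. v \<in> S \<Longrightarrow> Re (sesq A K v v) \<le> Re (sesq A K u u)"
    using continuous_attains_sup[OF comp _ continuous_on_subset[OF contQ]] by blast
  define l where "l = Re (sesq A K u u)"
  have Nu: "N u = 1" using u unfolding S_def by auto
  have ray: "Re (sesq A K v v) \<le> l * N v" for v
  proof (cases "N v = 0")
    case True
    then have "\<And>a. a \<in> A \<Longrightarrow> v a = 0"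
      unfolding N_def using fin by (simp add: sum_nonneg_eq_0_iff)
    then show ?thesis using True unfolding sesq_def by simp
  next
    case False
    then have pos: "N v > 0" unfolding N_def by (simp add: less_le sum_nonneg)
    define w where "w a = (if a \<in> A then v a / sqrt (N v) else 0)" for a
    have Nw: "N w = 1"
      using pos unfolding N_def[of w] w_def
      by (simp add: norm_divide power_divide flip: sum_divide_distrib) (simp add: N_def)
    have "cmod (w a) \<le> 1" if "a \<in> A" for a
    proof -
      have "(cmod (w a))\<^sup>2 \<le> N w" unfolding N_def using fin that by (intro member_le_sum) auto
      then show ?thesis using Nw by (simp add: power_le_one_iff abs_square_le_1)
    qed
    then have "w \<in> S" using Nw unfolding S_def B_def by (auto simp: w_def)
    moreover have "sesq A K v v = N v * sesq A K w w"
    proof -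
      have "cnj (v i) * K i j * v j = N v * (cnj (w i) * K i j * w j)" if "i \<in> A" "j \<in> A" for i j
        using that pos by (simp add: w_def field_simps flip: of_real_mult)
      then show ?thesis unfolding sesq_def sum_distrib_left by (intro sum.cong refl)
    qed
    ultimately show ?thesis using u(2)[of w] pos by (simp add: l_def mult.commute)
  qed
  have real: "Im (sesq A K v v) = 0" for v
  proof -
    have "cnj (sesq A K v v) = (\<Sum>i\<in>A. \<Sum>j\<in>A. cnj (v j) * K j i * v i)"
      unfolding sesq_def cnj_sum
      by (intro sum.cong refl) (simp add: herm[symmetric] mult_ac)
    also have "\<dots> = sesq A K v v" unfolding sesq_def by (rule sum.swap)
    finally show ?thesis by (simp add: complex_eq_iff)
  qed
  define M where "M a b = (if a = b then of_real l else 0) - K a b" for a b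
  have M: "sesq A M x v = l * (\<Sum>a\<in>A. cnj (x a) * v a) - sesq A K x v" for x v
  proof -
    have "sesq A M x v = (\<Sum>i\<in>A. \<Sum>j\<in>A. (if i = j then l * (cnj (x i) * v i) else 0) - cnj (x i) * K i j * v j)"
      unfolding sesq_def M_def by (intro sum.cong refl) (auto simp: algebra_simps)
    then show ?thesis using fin by (simp add: sesq_def sum_subtractf sum_distrib_left)
  qed
  have MN: "sesq A M v v = l * N v - sesq A K v v" for v
    unfolding M N_def by (simp add: complex_norm_square mult.commute flip: of_real_power)
  have "psd_on A M"
    unfolding psd_on_def MN using ray real by simp
  moreover have "sesq A M u u = 0"
    unfolding MN Nu using real[of u] by (simp add: complex_eq_iff l_def)
  ultimately have ker: "sesq A M x u = 0" for x by (rule psd_on_kernel)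
  have eig: "(\<Sum>b\<in>A. K a b * u b) = l * u a" if "a \<in> A" for a
  proof -
    have "(\<Sum>b\<in>A. M a b * u b) = 0" using ker sesq_unit[OF fin that] by metis
    moreover have "(\<Sum>b\<in>A. M a b * u b) = (\<Sum>b\<in>A. (if a = b then l * u a else 0) - K a b * u b)"
      unfolding M_def by (intro sum.cong) (auto simp: algebra_simps)
    ultimately show ?thesis using fin that by (simp add: sum_subtractf)
  qed
  have supp: "u a = 0" if "a \<notin> A" for a
  proof -
    have "u a \<in> (if a \<in> A then cball 0 1 else {0})" using u(1) unfolding S_def B_def by blast
    then show ?thesis using that by simp
  qed
  show thesis by (rule that[OF Nu[unfolded N_def] supp eig ray[unfolded N_def]])
qed

section \<open>Finite-dimensional spaces of functions\<close>

text \<open>Makes spans, independence and the exchange argument available for the pointwise function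
  spaces of the statement.\<close>

interpretation fv: vector_space "\<lambda>(c::complex) (x::'i\<Rightarrow>complex) i. c * x i"
  by unfold_locales (auto simp: fun_eq_iff algebra_simps)

lemma sum_fun_eq: "(\<Sum>j\<in>J. F j) = (\<lambda>i. \<Sum>j\<in>J. F j i :: complex)"
  by (induction J rule: infinite_finite_induct) (auto simp: fun_eq_iff)

lemma vspan_eq: "finite B \<Longrightarrow> vspan B = fv.span B"
  by (auto simp: vspan_def fv.span_finite sum_fun_eq)

lemma vsubspace_iff: "vsubspace S \<longleftrightarrow> fv.subspace S"
  by (simp add: vsubspace_def fv.subspace_def vzero_def zero_fun_def plus_fun_def)

text \<open>Linearity is demanded on \<open>A\<close> only, as in \<open>lin_on\<close>, since the
  operators of a representation may behave arbitrarily outside its space.\<close>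

definition lfun :: "('i \<Rightarrow> complex) set \<Rightarrow> (('i \<Rightarrow> complex) \<Rightarrow> complex) \<Rightarrow> bool" where
  "lfun A \<phi> \<longleftrightarrow> (\<forall>x\<in>A. \<forall>y\<in>A. \<phi> (\<lambda>i. x i + y i) = \<phi> x + \<phi> y) \<and> (\<forall>c. \<forall>x\<in>A. \<phi> (\<lambda>i. c * x i) = c * \<phi> x)"

lemma lfun_add: "lfun A \<phi> \<Longrightarrow> x \<in> A \<Longrightarrow> y \<in> A \<Longrightarrow> \<phi> (\<lambda>i. x i + y i) = \<phi> x + \<phi> y"
  and lfun_scale: "lfun A \<phi> \<Longrightarrow> x \<in> A \<Longrightarrow> \<phi> (\<lambda>i. c * x i) = c * \<phi> x"
  by (auto simp: lfun_def)

lemma lin_on_add: "lin_on A T \<Longrightarrow> x \<in> A \<Longrightarrow> y \<in> A \<Longrightarrow> T (\<lambda>i. x i + y i) = (\<lambda>j. T x j + T y j)"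
  and lin_on_scale: "lin_on A T \<Longrightarrow> x \<in> A \<Longrightarrow> T (\<lambda>i. c * x i) = (\<lambda>j. c * T x j)"
  by (auto simp: lin_on_def)

lemma vsubspace_add: "vsubspace A \<Longrightarrow> x \<in> A \<Longrightarrow> y \<in> A \<Longrightarrow> (\<lambda>i. x i + y i) \<in> A"
  and vsubspace_scale: "vsubspace A \<Longrightarrow> x \<in> A \<Longrightarrow> (\<lambda>i. c * x i) \<in> A"
  and vsubspace_zero: "vsubspace A \<Longrightarrow> vzero \<in> A"
  by (auto simp: vsubspace_def)

lemma vsubspace_sum:
  assumes "vsubspace A" "\<And>j. j \<in> J \<Longrightarrow> x j \<in> A"
  shows "(\<lambda>i. \<Sum>j\<in>J. c j * x j i) \<in> A"
proof -
  have "(\<Sum>j\<in>J. (\<lambda>i. c j * x j i)) \<in> A"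
    using assms unfolding vsubspace_iff by (intro fv.subspace_sum fv.subspace_scale)
  then show ?thesis by (simp add: sum_fun_eq)
qed

lemma lfun_zero:
  assumes "lfun A \<phi>" "vsubspace A"
  shows "\<phi> (\<lambda>i. 0) = 0"
proof -
  have "vzero \<in> A" using assms(2) by (simp add: vsubspace_def)
  from lfun_scale[OF assms(1) this, of 0] show ?thesis by simp
qed

lemma lfun_sum:
  assumes "lfun A \<phi>" "vsubspace A" "\<And>j. j \<in> J \<Longrightarrow> x j \<in> A"
  shows "\<phi> (\<lambda>i. \<Sum>j\<in>J. c j * x j i) = (\<Sum>j\<in>J. c j * \<phi> (x j))"
  using assms(3)
proof (induction J rule: infinite_finite_induct)
  case (insert k J)
  have "(\<lambda>i. c k * x k i) \<in> A" "(\<lambda>i. \<Sum>j\<in>J. c j * x j i) \<in> A"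
    using insert.prems assms(2) by (auto intro!: vsubspace_sum vsubspace_scale)
  from lfun_add[OF assms(1) this] show ?case
    using insert lfun_scale[OF assms(1)] by simp
qed (auto simp: lfun_zero[OF assms(1,2)])

lemma lin_on_lfun: "lin_on A T \<Longrightarrow> lfun A (\<lambda>x. T x i)"
  unfolding lin_on_def lfun_def by metis

lemma lin_on_sum:
  assumes "lin_on A T" "vsubspace A" "\<And>j. j \<in> J \<Longrightarrow> x j \<in> A"
  shows "T (\<lambda>i. \<Sum>j\<in>J. c j * x j i) = (\<lambda>i. \<Sum>j\<in>J. c j * T (x j) i)"
proof
  fix i
  show "T (\<lambda>i. \<Sum>j\<in>J. c j * x j i) i = (\<Sum>j\<in>J. c j * T (x j) i)"
    by (rule lfun_sum[OF lin_on_lfun[OF assms(1)] assms(2,3)])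
qed

lemma lfun_comp:
  assumes "lin_on A T" "T ` A \<subseteq> W" "lfun W \<phi>"
  shows "lfun A (\<lambda>x. \<phi> (T x))"
  unfolding lfun_def
proof (intro conjI allI ballI)
  fix x y assume xy: "x \<in> A" "y \<in> A"
  show "\<phi> (T (\<lambda>i. x i + y i)) = \<phi> (T x) + \<phi> (T y)"
    unfolding lin_on_add[OF assms(1) xy] using assms(2) xy by (intro lfun_add[OF assms(3)]) auto
next
  fix c x assume x: "x \<in> A"
  show "\<phi> (T (\<lambda>i. c * x i)) = c * \<phi> (T x)"
    unfolding lin_on_scale[OF assms(1) x] using assms(2) x by (intro lfun_scale[OF assms(3)]) auto
qed

lemma lin_on_zero:
  assumes "lin_on A T" "vsubspace A"
  shows "T vzero = vzero"
  using lin_on_scale[OF assms(1) vsubspace_zero[OF assms(2)], of 0] by (simp add: vzero_def)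

lemma vsubspace_image:
  assumes A: "vsubspace A" and P: "lin_on A P"
  shows "vsubspace (P ` A)"
  unfolding vsubspace_def
proof (intro conjI allI ballI)
  show "vzero \<in> P ` A"
    using vsubspace_zero[OF A] lin_on_zero[OF P A] by (metis image_eqI)
next
  fix x y assume "x \<in> P ` A" "y \<in> P ` A"
  then obtain a b where ab: "x = P a" "y = P b" "a \<in> A" "b \<in> A" by blast
  have "(\<lambda>i. x i + y i) = P (\<lambda>i. a i + b i)"
    unfolding ab(1,2) by (rule lin_on_add[OF P ab(3,4), symmetric])
  then show "(\<lambda>i. x i + y i) \<in> P ` A"
    using vsubspace_add[OF A ab(3,4)] by (rule image_eqI)
next
  fix c x assume "x \<in> P ` A"
  then obtain a where a: "x = P a" "a \<in> A" by blast
  have "(\<lambda>i. c * x i) = P (\<lambda>i. c * a i)"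
    unfolding a(1) by (rule lin_on_scale[OF P a(2), symmetric])
  then show "(\<lambda>i. c * x i) \<in> P ` A"
    using vsubspace_scale[OF A a(2)] by (rule image_eqI)
qed

text \<open>Ties \<open>vdim\<close>, defined through smallest spanning sets, to the size of a
  basis: by the exchange bound an independent set is at most as large as any spanning set. Finite
  dimension is asked of the ambient \<open>S\<close>, inside which the subspaces of interest are
  given.\<close>

lemma ex_basis:
  assumes "vsubspace W" "W \<subseteq> S" "fin_dim S"
  obtains B where "finite B" "fv.independent B" "fv.span B = W" "vdim W = card B" "B \<subseteq> W"
proof -
  obtain C where C: "finite C" "S \<subseteq> vspan C"
    using assms(3) unfolding fin_dim_def by blast
  obtain B where B: "B \<subseteq> W" "fv.independent B" "W \<subseteq> fv.span B"
    using fv.maximal_independent_subset[of W] by blast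
  have bound: "finite B \<and> card B \<le> card D" if "finite D" "W \<subseteq> vspan D" for D
    using fv.independent_span_bound[OF that(1) B(2)] B(1) that vspan_eq[of D] by blast
  have fB: "finite B" using bound[of C] C assms(2) by blast
  have span: "fv.span B = W"
    using B assms(1) by (metis fv.span_minimal subset_antisym vsubspace_iff)
  have "vdim W = card B"
    unfolding vdim_def
  proof (rule Least_equality)
    show "\<exists>D. finite D \<and> card D = card B \<and> D \<subseteq> W \<and> W \<subseteq> vspan D"
      using fB B vspan_eq[OF fB] by blast
  qed (use bound in blast)
  then show thesis using that fB B span by blast
qed

lemma fin_dim_subset:
  assumes "vsubspace W" "W \<subseteq> S" "fin_dim S"
  shows "fin_dim W"
proof -
  obtain B where "finite B" "fv.span B = W" "B \<subseteq> W"
    using ex_basis[OF assms] by metis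
  then show ?thesis unfolding fin_dim_def using vspan_eq by blast
qed

lemma vdim_mono:
  assumes "vsubspace W" "vsubspace S" "W \<subseteq> S" "fin_dim S"
  shows "vdim W \<le> vdim S" and "vdim W = vdim S \<Longrightarrow> W = S"
proof -
  obtain B where B: "finite B" "fv.independent B" "fv.span B = W" "vdim W = card B" "B \<subseteq> W"
    using ex_basis[OF assms(1,3,4)] by metis
  obtain C where C: "finite C" "fv.span C = S" "vdim S = card C"
    using ex_basis[OF assms(2) order_refl assms(4)] by metis
  show "vdim W \<le> vdim S"
    using fv.independent_span_bound[OF C(1) B(2)] B C assms(3) by auto
  show "W = S" if eq: "vdim W = vdim S"
  proof (rule ccontr)
    assume "W \<noteq> S"
    then obtain x where x: "x \<in> S" "x \<notin> W" using assms(3) by blast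
    then have "fv.independent (insert x B)"
      using B by (simp add: fv.independent_insert)
    then have "card (insert x B) \<le> card C"
      using fv.independent_span_bound[OF C(1), of "insert x B"] B C x assms(3) by auto
    moreover have "x \<notin> B" using x B by blast
    ultimately show False using eq B C by simp
  qed
qed

lemma vdim_pos:
  assumes "vsubspace W" "fin_dim W" "W \<noteq> {vzero}"
  shows "0 < vdim W"
proof -
  obtain B where B: "finite B" "fv.span B = W" "vdim W = card B"
    using ex_basis[OF assms(1) order_refl assms(2)] by metis
  have "B \<noteq> {}" using B(2) assms(3) by (auto simp: vzero_def zero_fun_def)
  then show ?thesis using B by (simp add: card_gt_0_iff)
qed

lemma ex_dual_basis:
  assumes "vsubspace W" "fin_dim W"
  obtains U \<beta> where "finite U" "U \<subseteq> W" "vdim W = card U" "\<And>u. lfun W (\<beta> u)"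
    "\<And>x. x \<in> W \<Longrightarrow> (\<lambda>i. \<Sum>u\<in>U. \<beta> u x * u i) = x"
    "\<And>u v. u \<in> U \<Longrightarrow> v \<in> U \<Longrightarrow> \<beta> u v = of_bool (u = v)"
proof -
  obtain U where U: "finite U" "fv.independent U" "fv.span U = W" "vdim W = card U" "U \<subseteq> W"
    using ex_basis[OF assms(1) order_refl assms(2)] by metis
  define \<beta> where "\<beta> u x = fv.representation U x u" for u x
  have "lfun W (\<beta> u)" for u
    unfolding lfun_def \<beta>_def
  proof (intro conjI allI ballI)
    fix x y assume "x \<in> W" "y \<in> W"
    then show "fv.representation U (\<lambda>i. x i + y i) u = fv.representation U x u + fv.representation U y u"
      using fv.representation_add[OF U(2), of y x] U(3) by (simp add: plus_fun_def add.commute)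
  next
    fix c x assume "x \<in> W"
    then show "fv.representation U (\<lambda>i. c * x i) u = c * fv.representation U x u"
      using fv.representation_scale[OF U(2), of x c] U(3) by simp
  qed
  moreover have "(\<lambda>i. \<Sum>u\<in>U. \<beta> u x * u i) = x" if "x \<in> W" for x
    using fv.sum_representation_eq[OF U(2), of x U] that U
    by (simp add: \<beta>_def sum_fun_eq)
  moreover have "\<beta> u v = of_bool (u = v)" if "u \<in> U" "v \<in> U" for u v
    using that fv.representation_basis[OF U(2)] by (simp add: \<beta>_def)
  ultimately show thesis using that U by blast
qed

text \<open>The right-hand side is the trace of \<open>P\<close>; the family \<open>F\<close> is only required to be a frame
  with coordinates \<open>\<beta>\<close>, not a basis.\<close>

lemma vdim_idempotent_image:
  assumes A: "vsubspace A" "fin_dim A" and P: "lin_on A P" "P ` A \<subseteq> A" "\<And>x. x \<in> A \<Longrightarrow> P (P x) = P x"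
    and F: "\<And>j. j \<in> J \<Longrightarrow> F j \<in> A" and \<beta>: "\<And>j. j \<in> J \<Longrightarrow> lfun A (\<beta> j)"
    and frame: "\<And>x. x \<in> A \<Longrightarrow> (\<lambda>i. \<Sum>j\<in>J. \<beta> j x * F j i) = x"
  shows "of_nat (vdim (P ` A)) = (\<Sum>j\<in>J. \<beta> j (P (F j)))"
proof -
  let ?W = "P ` A"
  have W: "vsubspace ?W" by (rule vsubspace_image[OF A(1) P(1)])
  obtain U \<gamma> where U: "finite U" "U \<subseteq> ?W" "vdim ?W = card U" "\<And>u. lfun ?W (\<gamma> u)"
    "\<And>x. x \<in> ?W \<Longrightarrow> (\<lambda>i. \<Sum>u\<in>U. \<gamma> u x * u i) = x"
    "\<And>u v. u \<in> U \<Longrightarrow> v \<in> U \<Longrightarrow> \<gamma> u v = of_bool (u = v)"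
    using ex_dual_basis[OF W fin_dim_subset[OF W P(2) A(2)]] by blast
  \<comment> \<open>Expand \<open>P (F j)\<close> in a dual basis of the image and exchange the
    sums. The frame identity then reassembles each basis vector \<open>u\<close>, on which
    \<open>P\<close> is the identity, so that \<open>u\<close> contributes 1.\<close>
  have "(\<Sum>j\<in>J. \<beta> j (P (F j))) = (\<Sum>j\<in>J. \<Sum>u\<in>U. \<gamma> u (P (F j)) * \<beta> j u)"
  proof (intro sum.cong refl)
    fix j assume j: "j \<in> J"
    have "\<beta> j (P (F j)) = \<beta> j (\<lambda>i. \<Sum>u\<in>U. \<gamma> u (P (F j)) * u i)"
      using U(5)[of "P (F j)"] F[OF j] by simp
    also have "\<dots> = (\<Sum>u\<in>U. \<gamma> u (P (F j)) * \<beta> j u)"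
      using U(2) P(2) by (intro lfun_sum[OF \<beta>[OF j] A(1)]) auto
    finally show "\<beta> j (P (F j)) = (\<Sum>u\<in>U. \<gamma> u (P (F j)) * \<beta> j u)" .
  qed
  also have "\<dots> = (\<Sum>u\<in>U. \<Sum>j\<in>J. \<beta> j u * \<gamma> u (P (F j)))"
    by (subst sum.swap) (simp add: mult.commute)
  also have "\<dots> = (\<Sum>u\<in>U. 1)"
  proof (intro sum.cong refl)
    fix u assume u: "u \<in> U"
    then have uA: "u \<in> A" using U(2) P(2) by blast
    have "(\<Sum>j\<in>J. \<beta> j u * \<gamma> u (P (F j))) = \<gamma> u (P (\<lambda>i. \<Sum>j\<in>J. \<beta> j u * F j i))"
      using F by (intro lfun_sum[OF lfun_comp[OF P(1) order_refl U(4)] A(1), symmetric]) auto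
    also have "\<dots> = \<gamma> u u"
      using frame[OF uA] u U(2) P(3) by auto
    finally show "(\<Sum>j\<in>J. \<beta> j u * \<gamma> u (P (F j))) = 1" using U(6)[OF u u] by simp
  qed
  finally show ?thesis using U(3) by simp
qed

text \<open>Coordinates in a basis carry the operator to a matrix \<open>M\<close>, whose spectrum
  is nonempty because the field is \<complex>.\<close>

lemma ex_eigenvector:
  assumes S: "vsubspace S" "fin_dim S" "S \<noteq> {vzero}" and T: "lin_on S T" "T ` S \<subseteq> S"
  obtains k x where "x \<in> S" "x \<noteq> vzero" "T x = (\<lambda>i. k * x i)"
proof -
  obtain U \<beta> where U: "finite U" "U \<subseteq> S" "vdim S = card U" "\<And>u. lfun S (\<beta> u)"
    "\<And>x. x \<in> S \<Longrightarrow> (\<lambda>i. \<Sum>u\<in>U. \<beta> u x * u i) = x"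
    "\<And>u v. u \<in> U \<Longrightarrow> v \<in> U \<Longrightarrow> \<beta> u v = of_bool (u = v)"
    using ex_dual_basis[OF S(1,2)] by blast
  define n where "n = card U"
  obtain h where h: "bij_betw h {..<n} U"
    using ex_bij_betw_nat_finite[OF U(1)] unfolding n_def atLeast0LessThan by blast
  have hU: "h i \<in> U" if "i < n" for i using h that by (auto simp: bij_betw_def)
  define M where "M = Matrix.mat n n (\<lambda>(i,j). \<beta> (h i) (T (h j)))"
  have M: "M \<in> carrier_mat n n" unfolding M_def by simp
  have "n > 0" using vdim_pos[OF S] U(3) n_def by simp
  then obtain k v where "eigenvector M v k"
    using spectrum_non_empty[OF M] unfolding spectrum_def eigenvalue_def by blast
  then have v: "v \<in> carrier_vec n" "v \<noteq> 0\<^sub>v n" "M *\<^sub>v v = k \<cdot>\<^sub>v v"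
    using M unfolding eigenvector_def by auto
  define x where "x = (\<lambda>i. \<Sum>j<n. vec_index v j * h j i)"
  have hS: "\<And>j. j \<in> {..<n} \<Longrightarrow> h j \<in> S" using hU U(2) by auto
  have xS: "x \<in> S" unfolding x_def using hS by (intro vsubspace_sum S) auto
  have "x \<noteq> vzero"
  proof
    assume "x = vzero"
    then have "\<beta> (h i) x = 0" for i
      using lfun_zero[OF U(4) S(1)] by (simp add: vzero_def)
    moreover have "\<beta> (h i) x = vec_index v i" if "i < n" for i
    proof -
      have "\<beta> (h i) x = (\<Sum>j<n. vec_index v j * \<beta> (h i) (h j))"
        unfolding x_def by (rule lfun_sum[OF U(4) S(1) hS])
      also have "\<dots> = (\<Sum>j<n. if i = j then vec_index v j else 0)"
        using h that U(6) hU by (intro sum.cong) (auto simp: bij_betw_def inj_on_def)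
      finally show ?thesis using that by simp
    qed
    ultimately have "v = 0\<^sub>v n" using v(1) by (intro eq_vecI) auto
    then show False using v(2) by blast
  qed
  moreover have "T x = (\<lambda>i. k * x i)"
  proof
    fix l
    have "T x l = (\<Sum>j<n. vec_index v j * T (h j) l)"
      unfolding x_def by (subst lin_on_sum[OF T(1) S(1) hS]) auto
    also have "\<dots> = (\<Sum>j<n. \<Sum>i<n. M $$ (i,j) * vec_index v j * h i l)"
    proof (intro sum.cong refl)
      fix j assume j: "j \<in> {..<n}"
      have "T (h j) l = (\<Sum>u\<in>U. \<beta> u (T (h j)) * u l)"
        using fun_cong[OF U(5)[of "T (h j)"], of l] T(2) hS[OF j] by auto
      also have "\<dots> = (\<Sum>i<n. \<beta> (h i) (T (h j)) * h i l)"
        using sum.reindex_bij_betw[OF h, of "\<lambda>u. \<beta> u (T (h j)) * u l"] by simp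
      also have "\<dots> = (\<Sum>i<n. M $$ (i,j) * h i l)"
        using j by (intro sum.cong) (auto simp: M_def)
      finally show "vec_index v j * T (h j) l = (\<Sum>i<n. M $$ (i,j) * vec_index v j * h i l)"
        by (simp add: sum_distrib_left mult_ac)
    qed
    also have "\<dots> = (\<Sum>i<n. (\<Sum>j<n. M $$ (i,j) * vec_index v j) * h i l)"
      by (subst sum.swap) (simp add: sum_distrib_right)
    also have "\<dots> = (\<Sum>i<n. vec_index (M *\<^sub>v v) i * h i l)"
      using M v(1) by (intro sum.cong) (auto simp: scalar_prod_def atLeast0LessThan)
    also have "\<dots> = k * x l"
      unfolding v(3) x_def using v(1) by (simp add: sum_distrib_left mult.assoc)
    finally show "T x l = k * x l" .
  qed
  ultimately show thesis using that xS by blast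
qed

lemma lin_on_subset: "lin_on S T \<Longrightarrow> W \<subseteq> S \<Longrightarrow> lin_on W T"
  unfolding lin_on_def by blast

lemma is_rep_sub:
  assumes "is_rep G S \<rho>" "invariant_sub G S \<rho> W"
  shows "is_rep G W \<rho>"
proof -
  have S: "fin_dim S" "\<And>g. g \<in> carrier G \<Longrightarrow> lin_on S (\<rho> g)" "\<And>x. x \<in> S \<Longrightarrow> \<rho> \<one>\<^bsub>G\<^esub> x = x"
    "\<And>g h x. g \<in> carrier G \<Longrightarrow> h \<in> carrier G \<Longrightarrow> x \<in> S \<Longrightarrow> \<rho> (g \<otimes>\<^bsub>G\<^esub> h) x = \<rho> g (\<rho> h x)"
    using assms(1) unfolding is_rep_def by auto
  have W: "vsubspace W" "W \<subseteq> S" "\<And>g. g \<in> carrier G \<Longrightarrow> \<rho> g ` W \<subseteq> W"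
    using assms(2) unfolding invariant_sub_def by auto
  show ?thesis
    unfolding is_rep_def
  proof (intro conjI ballI)
    show "fin_dim W" by (rule fin_dim_subset[OF W(1,2) S(1)])
    show "lin_on W (\<rho> g)" if "g \<in> carrier G" for g by (rule lin_on_subset[OF S(2)[OF that] W(2)])
    show "\<rho> \<one>\<^bsub>G\<^esub> x = x" if "x \<in> W" for x using S(3)[of x] W(2) that by blast
    show "\<rho> (g \<otimes>\<^bsub>G\<^esub> h) x = \<rho> g (\<rho> h x)" if "g \<in> carrier G" "h \<in> carrier G" "x \<in> W" for g h x
      using S(4)[of g h x] W(2) that by blast
  qed (use W in auto)
qed

text \<open>A nonzero invariant subspace of least dimension is irreducible.\<close>

lemma ex_irreducible_sub:
  assumes rep: "is_rep G S \<rho>" and ne: "S \<noteq> {vzero}"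
  obtains U where "invariant_sub G S \<rho> U" "irreducible_rep G U \<rho>"
proof -
  let ?Q = "\<lambda>U. invariant_sub G S \<rho> U \<and> U \<noteq> {vzero}"
  have "?Q S" using assms unfolding is_rep_def invariant_sub_def by blast
  then obtain U where U: "?Q U" and least: "\<And>W. ?Q W \<Longrightarrow> vdim U \<le> vdim W"
    using ex_has_least_nat[of ?Q S vdim] by blast
  have repU: "is_rep G U \<rho>" using is_rep_sub[OF rep] U by blast
  have "W = {vzero} \<or> W = U" if W: "invariant_sub G U \<rho> W" for W
  proof (rule disjCI)
    assume "\<not> W = U"
    have "vsubspace W" "vsubspace U" "W \<subseteq> U" "fin_dim U"
      using W repU unfolding invariant_sub_def is_rep_def by auto
    then have "\<not> vdim U \<le> vdim W" using vdim_mono[of W U] \<open>\<not> W = U\<close> by force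
    moreover have "invariant_sub G S \<rho> W"
      using W U unfolding invariant_sub_def by blast
    ultimately show "W = {vzero}" using least by blast
  qed
  then show thesis using that[of U] U repU unfolding irreducible_rep_def by blast
qed

section \<open>The kernel of the space of matrix coefficients\<close>

lemma ex_inverse_matrix:
  fixes D :: "nat \<Rightarrow> nat \<Rightarrow> complex"
  assumes inj: "\<And>v i. (\<And>i. i < d \<Longrightarrow> (\<Sum>j<d. D i j * v j) = 0) \<Longrightarrow> i < d \<Longrightarrow> v i = 0"
  obtains \<sigma> where "\<And>i j. i < d \<Longrightarrow> j < d \<Longrightarrow> (\<Sum>k<d. D i k * \<sigma> k j) = of_bool (i = j)"
    "\<And>i j. i < d \<Longrightarrow> j < d \<Longrightarrow> (\<Sum>k<d. \<sigma> i k * D k j) = of_bool (i = j)"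
proof -
  let ?M = "Matrix.mat d d (\<lambda>(i,j). D i j)"
  have M: "?M \<in> carrier_mat d d" by simp
  have "det ?M \<noteq> 0"
  proof
    assume "det ?M = 0"
    then obtain v where v: "v \<in> carrier_vec d" "v \<noteq> 0\<^sub>v d" "?M *\<^sub>v v = 0\<^sub>v d"
      using det_0_iff_vec_prod_zero[OF M] by blast
    have "(\<Sum>j<d. D i j * vec_index v j) = 0" if "i < d" for i
    proof -
      have "vec_index (?M *\<^sub>v v) i = 0" using v(3) that by simp
      then show ?thesis using that v(1) by (simp add: scalar_prod_def atLeast0LessThan)
    qed
    from inj[OF this] have "v = 0\<^sub>v d" using v(1) by (intro eq_vecI) auto
    then show False using v(2) by blast
  qed
  then obtain S where S: "S \<in> carrier_mat d d" "?M * S = 1\<^sub>m d" "S * ?M = 1\<^sub>m d"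
    using det_non_zero_imp_unit[OF M, of "()"] unfolding Units_def ring_mat_def by auto
  have 1: "(\<Sum>k<d. D i k * S $$ (k,j)) = of_bool (i = j)" if "i < d" "j < d" for i j
  proof -
    have "(?M * S) $$ (i,j) = of_bool (i = j)" using that S(2) by simp
    then show ?thesis using that S(1) by (simp add: scalar_prod_def atLeast0LessThan)
  qed
  have 2: "(\<Sum>k<d. S $$ (i,k) * D k j) = of_bool (i = j)" if "i < d" "j < d" for i j
  proof -
    have "(S * ?M) $$ (i,j) = of_bool (i = j)" using that S(3) by simp
    then show ?thesis using that S(1) by (simp add: scalar_prod_def atLeast0LessThan)
  qed
  show thesis by (rule that[OF 1 2])
qed

context group
begin

lemma sum_mult_left:
  assumes "subgroup H G" "x \<in> H"
  shows "(\<Sum>h\<in>H. F (x \<otimes> h)) = (\<Sum>h\<in>H. F h)"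
proof -
  note H = subgroup.mem_carrier[OF assms(1)] subgroup.m_closed[OF assms(1)] subgroup.m_inv_closed[OF assms(1)]
  show ?thesis
    by (rule sum.reindex_bij_witness[of _ "\<lambda>h. inv x \<otimes> h" "\<lambda>h. x \<otimes> h"])
      (use assms(2) H in \<open>auto simp: m_assoc[symmetric]\<close>)
qed

lemma sum_mult_right:
  assumes "subgroup H G" "x \<in> H"
  shows "(\<Sum>h\<in>H. F (h \<otimes> x)) = (\<Sum>h\<in>H. F h)"
proof -
  note H = subgroup.mem_carrier[OF assms(1)] subgroup.m_closed[OF assms(1)] subgroup.m_inv_closed[OF assms(1)]
  show ?thesis
    by (rule sum.reindex_bij_witness[of _ "\<lambda>h. h \<otimes> inv x" "\<lambda>h. h \<otimes> x"])
      (use assms(2) H in \<open>auto simp: m_assoc\<close>)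
qed

lemma sum_inv:
  assumes "subgroup H G"
  shows "(\<Sum>h\<in>H. F (inv h)) = (\<Sum>h\<in>H. F h)"
  by (rule sum.reindex_bij_witness[of _ "\<lambda>h. inv h" "\<lambda>h. inv h"])
    (use subgroup.mem_carrier[OF assms] subgroup.m_inv_closed[OF assms] in auto)

end

section \<open>Construction of the convolution kernel from the matrix entries of the
  representation\<close>

locale unitary_matrix_rep = group G for G (structure) +
  fixes d :: nat and p :: "'a \<Rightarrow> nat \<Rightarrow> nat \<Rightarrow> complex"
  assumes fin: "finite (carrier G)" and d_pos: "d > 0"
    and p_one: "\<And>i j. i < d \<Longrightarrow> j < d \<Longrightarrow> p \<one> i j = of_bool (i = j)"
    and p_mult: "\<And>g h i j. g \<in> carrier G \<Longrightarrow> h \<in> carrier G \<Longrightarrow> i < d \<Longrightarrow> j < d \<Longrightarrow>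
      p (g \<otimes> h) i j = (\<Sum>k<d. p g i k * p h k j)"
    and p_inv: "\<And>g i j. g \<in> carrier G \<Longrightarrow> i < d \<Longrightarrow> j < d \<Longrightarrow> p (inv g) i j = cnj (p g j i)"
begin

lemmas sum_left = sum_mult_left[OF subgroup_self] and sum_right = sum_mult_right[OF subgroup_self]
  and sum_inverse = sum_inv[OF subgroup_self]

definition tr :: "'a \<Rightarrow> complex" where "tr g = (\<Sum>k<d. p g k k)"

text \<open>By Schur orthogonality this matrix acts on the isotypic component of type \<open>\<chi>\<close> as
  \<open>|G| m\<^sub>\<chi> / dim \<chi>\<close>, with \<open>m\<^sub>\<chi>\<close> the multiplicity. Its inverse \<open>\<sigma>\<close> therefore satisfies
  \<open>tr (\<sigma> \<pi>(g\<^sup>-\<^sup>1)) = c g\<close>, and a Cholesky factorisation of \<open>\<sigma>\<close> provides the vector \<open>\<Xi>\<close>.\<close>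

definition char_mat :: "nat \<Rightarrow> nat \<Rightarrow> complex" where
  "char_mat i j = (\<Sum>g\<in>carrier G. tr (inv g) * p g i j)"

definition mv :: "'a \<Rightarrow> (nat \<Rightarrow> complex) \<Rightarrow> nat \<Rightarrow> complex" where
  "mv g v i = (\<Sum>j<d. p g i j * v j)"

definition coef :: "(nat \<Rightarrow> complex) \<Rightarrow> 'a \<Rightarrow> complex" where
  "coef v g = (\<Sum>i<d. cnj (v i) * mv g v i)"

lemma tr_mult:
  assumes "g \<in> carrier G" "h \<in> carrier G"
  shows "tr (g \<otimes> h) = (\<Sum>j<d. \<Sum>i<d. p g j i * p h i j)"
  unfolding tr_def using assms by (intro sum.cong refl) (simp add: p_mult)

lemma tr_commute:
  assumes "g \<in> carrier G" "h \<in> carrier G"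
  shows "tr (g \<otimes> h) = tr (h \<otimes> g)"
  using assms by (simp add: tr_mult) (subst sum.swap, simp add: mult.commute)

lemma mv_one: "i < d \<Longrightarrow> mv \<one> v i = v i"
proof -
  assume i: "i < d"
  have "mv \<one> v i = (\<Sum>j<d. if i = j then v j else 0)"
    unfolding mv_def using i by (intro sum.cong) (auto simp: p_one)
  then show ?thesis using i by simp
qed

lemma mv_mult:
  assumes "x \<in> carrier G" "y \<in> carrier G" "i < d"
  shows "mv (x \<otimes> y) v i = (\<Sum>l<d. p x i l * mv y v l)"
proof -
  have "mv (x \<otimes> y) v i = (\<Sum>j<d. \<Sum>l<d. p x i l * p y l j * v j)"
    unfolding mv_def using assms by (simp add: p_mult sum_distrib_right)
  also have "\<dots> = (\<Sum>l<d. p x i l * mv y v l)"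
    unfolding mv_def by (subst sum.swap) (simp add: sum_distrib_left mult.assoc)
  finally show ?thesis .
qed

text \<open>Unitarity moves \<open>x\<close> to the other side, so inner products of orbit vectors
  depend on \<open>inv x \<otimes> y\<close> only.\<close>

lemma mv_inner:
  assumes x: "x \<in> carrier G" and y: "y \<in> carrier G"
  shows "(\<Sum>l<d. cnj (mv x v l) * mv y v l) = coef v (inv x \<otimes> y)"
proof -
  have "(\<Sum>l<d. cnj (mv x v l) * mv y v l) = (\<Sum>l<d. \<Sum>i<d. cnj (v i) * p (inv x) i l * mv y v l)"
    unfolding mv_def[of x] cnj_sum sum_distrib_right
    by (intro sum.cong refl) (simp add: p_inv[OF x])
  also have "\<dots> = (\<Sum>i<d. cnj (v i) * (\<Sum>l<d. p (inv x) i l * mv y v l))"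
    by (subst sum.swap) (simp add: sum_distrib_left mult.assoc)
  also have "\<dots> = coef v (inv x \<otimes> y)"
    unfolding coef_def
    using x y by (intro sum.cong refl) (simp add: mv_mult)
  finally show ?thesis .
qed

lemma sesq_char_mat: "sesq {..<d} char_mat v v = (\<Sum>g\<in>carrier G. tr (inv g) * coef v g)"
proof -
  have "sesq {..<d} char_mat v v
      = (\<Sum>i<d. \<Sum>j<d. \<Sum>g\<in>carrier G. cnj (v i) * (tr (inv g) * p g i j) * v j)"
    unfolding sesq_def char_mat_def by (simp add: sum_distrib_left sum_distrib_right)
  also have "\<dots> = (\<Sum>i<d. \<Sum>g\<in>carrier G. \<Sum>j<d. cnj (v i) * (tr (inv g) * p g i j) * v j)"
    by (intro sum.cong refl sum.swap)
  also have "\<dots> = (\<Sum>g\<in>carrier G. \<Sum>i<d. \<Sum>j<d. cnj (v i) * (tr (inv g) * p g i j) * v j)"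
    by (rule sum.swap)
  also have "\<dots> = (\<Sum>g\<in>carrier G. tr (inv g) * coef v g)"
    unfolding coef_def mv_def sum_distrib_left
    by (intro sum.cong refl) (simp add: mult_ac)
  finally show ?thesis .
qed

text \<open>Exhibiting the form as a sum of squares replaces diagonalisation. The numbers
  \<open>A i j l\<close> pair the entries of \<open>\<pi>\<close> with the components of the orbit
  \<open>y \<mapsto> \<pi>(y) v\<close>. Their squares produce
  \<open>tr (x \<otimes> inv y) * coef v (inv x \<otimes> y)\<close>, summed over \<open>x\<close>
  and \<open>y\<close>. After \<open>y\<close> is replaced by \<open>x \<otimes> y\<close> the
  summand no longer depends on \<open>x\<close>, whence the factor
  \<open>card (carrier G)\<close>.\<close>

lemma char_mat_sum_squares:
  fixes v defines "A \<equiv> \<lambda>i j l. \<Sum>y\<in>carrier G. cnj (p y j i) * mv y v l"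
  shows "of_nat (card (carrier G)) * sesq {..<d} char_mat v v
    = of_real (\<Sum>i<d. \<Sum>j<d. \<Sum>l<d. (cmod (A i j l))\<^sup>2)"
proof -
  have "of_real (\<Sum>i<d. \<Sum>j<d. \<Sum>l<d. (cmod (A i j l))\<^sup>2) = (\<Sum>i<d. \<Sum>j<d. \<Sum>l<d. cnj (A i j l) * A i j l)"
    by (simp only: of_real_sum cmod_square)
  also have "\<dots> = (\<Sum>i<d. \<Sum>j<d. \<Sum>l<d. \<Sum>x\<in>carrier G. \<Sum>y\<in>carrier G.
      (p x j i * cnj (p y j i)) * (cnj (mv x v l) * mv y v l))"
    unfolding A_def cnj_sum sum_product by (intro sum.cong refl) simp
  also have "\<dots> = (\<Sum>i<d. \<Sum>j<d. \<Sum>x\<in>carrier G. \<Sum>l<d. \<Sum>y\<in>carrier G.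
      (p x j i * cnj (p y j i)) * (cnj (mv x v l) * mv y v l))"
    by (intro sum.cong refl sum.swap)
  also have "\<dots> = (\<Sum>i<d. \<Sum>j<d. \<Sum>x\<in>carrier G. \<Sum>y\<in>carrier G. \<Sum>l<d.
      (p x j i * cnj (p y j i)) * (cnj (mv x v l) * mv y v l))"
    by (intro sum.cong refl sum.swap)
  also have "\<dots> = (\<Sum>i<d. \<Sum>j<d. \<Sum>x\<in>carrier G. \<Sum>y\<in>carrier G.
      (p x j i * p (inv y) i j) * coef v (inv x \<otimes> y))"
    by (intro sum.cong refl) (simp add: p_inv mv_inner[symmetric] sum_distrib_left)
  also have "\<dots> = (\<Sum>i<d. \<Sum>x\<in>carrier G. \<Sum>j<d. \<Sum>y\<in>carrier G.
      (p x j i * p (inv y) i j) * coef v (inv x \<otimes> y))"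
    by (intro sum.cong refl sum.swap)
  also have "\<dots> = (\<Sum>x\<in>carrier G. \<Sum>i<d. \<Sum>j<d. \<Sum>y\<in>carrier G.
      (p x j i * p (inv y) i j) * coef v (inv x \<otimes> y))"
    by (rule sum.swap)
  also have "\<dots> = (\<Sum>x\<in>carrier G. \<Sum>i<d. \<Sum>y\<in>carrier G. \<Sum>j<d.
      (p x j i * p (inv y) i j) * coef v (inv x \<otimes> y))"
    by (intro sum.cong refl sum.swap)
  also have "\<dots> = (\<Sum>x\<in>carrier G. \<Sum>y\<in>carrier G. \<Sum>i<d. \<Sum>j<d.
      (p x j i * p (inv y) i j) * coef v (inv x \<otimes> y))"
    by (intro sum.cong refl sum.swap)
  also have "\<dots> = (\<Sum>x\<in>carrier G. \<Sum>y\<in>carrier G. tr (x \<otimes> inv y) * coef v (inv x \<otimes> y))"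
  proof (intro sum.cong refl)
    fix x y assume xy: "x \<in> carrier G" "y \<in> carrier G"
    have "tr (x \<otimes> inv y) = (\<Sum>i<d. \<Sum>j<d. p x j i * p (inv y) i j)"
      using xy by (subst sum.swap) (simp add: tr_mult)
    then show "(\<Sum>i<d. \<Sum>j<d. (p x j i * p (inv y) i j) * coef v (inv x \<otimes> y))
        = tr (x \<otimes> inv y) * coef v (inv x \<otimes> y)"
      by (simp add: sum_distrib_right)
  qed
  also have "\<dots> = (\<Sum>x\<in>carrier G. \<Sum>y\<in>carrier G. tr (inv y) * coef v y)"
  proof (rule sum.cong[OF refl])
    fix x assume x: "x \<in> carrier G"
    have "(\<Sum>y\<in>carrier G. tr (x \<otimes> inv y) * coef v (inv x \<otimes> y))
       = (\<Sum>y\<in>carrier G. tr (x \<otimes> inv (x \<otimes> y)) * coef v (inv x \<otimes> (x \<otimes> y)))"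
      using sum_left[OF x, of "\<lambda>y. tr (x \<otimes> inv y) * coef v (inv x \<otimes> y)"] by simp
    also have "\<dots> = (\<Sum>y\<in>carrier G. tr (inv y) * coef v y)"
    proof (intro sum.cong refl)
      fix y assume y: "y \<in> carrier G"
      have "tr (x \<otimes> inv (x \<otimes> y)) = tr (inv (x \<otimes> y) \<otimes> x)"
        using x y by (intro tr_commute) auto
      also have "inv (x \<otimes> y) \<otimes> x = inv y"
        using x y by (simp add: inv_mult_group m_assoc)
      finally show "tr (x \<otimes> inv (x \<otimes> y)) * coef v (inv x \<otimes> (x \<otimes> y)) = tr (inv y) * coef v y"
        using x y by (simp add: m_assoc[symmetric])
    qed
    finally show "(\<Sum>y\<in>carrier G. tr (x \<otimes> inv y) * coef v (inv x \<otimes> y))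
       = (\<Sum>y\<in>carrier G. tr (inv y) * coef v y)" .
  qed
  also have "\<dots> = of_nat (card (carrier G)) * sesq {..<d} char_mat v v"
    by (simp add: sesq_char_mat)
  finally show ?thesis by simp
qed

lemma card_pos: "card (carrier G) > 0"
  using fin by (auto simp: card_gt_0_iff)

lemma psd_char_mat: "psd_on {..<d} char_mat"
  unfolding psd_on_def
proof
  fix v
  let ?n = "real (card (carrier G))"
  obtain r where r: "r \<ge> 0" "of_real ?n * sesq {..<d} char_mat v v = of_real r"
  proof
    show "0 \<le> (\<Sum>i<d. \<Sum>j<d. \<Sum>l<d. (cmod (\<Sum>y\<in>carrier G. cnj (p y j i) * mv y v l))\<^sup>2)"
      by (intro sum_nonneg) auto
  qed (use char_mat_sum_squares in simp)
  have n: "?n > 0" using card_pos by simp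
  have "sesq {..<d} char_mat v v = of_real (r / ?n)"
    using r(2) n by (simp add: field_simps)
  then show "Im (sesq {..<d} char_mat v v) = 0 \<and> 0 \<le> Re (sesq {..<d} char_mat v v)"
    using r(1) n by simp
qed

text \<open>For a kernel vector \<open>v\<close> all \<open>A i j l\<close> vanish by the sum of
  squares. The squared norm of \<open>coef v\<close> over \<open>G\<close> is a combination of these
  numbers, so \<open>coef v\<close> vanishes, in particular at \<open>\<one>\<close>, where it is
  the squared norm of \<open>v\<close>.\<close>

lemma char_mat_inj:
  assumes "\<And>i. i < d \<Longrightarrow> (\<Sum>j<d. char_mat i j * v j) = 0" and i: "i < d"
  shows "v i = 0"
proof -
  define A where "A i j l = (\<Sum>y\<in>carrier G. cnj (p y j i) * mv y v l)" for i j l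
  have "sesq {..<d} char_mat v v = (\<Sum>i<d. cnj (v i) * (\<Sum>j<d. char_mat i j * v j))"
    unfolding sesq_def by (simp add: sum_distrib_left mult.assoc)
  then have "sesq {..<d} char_mat v v = 0" using assms(1) by simp
  then have "of_real (\<Sum>i<d. \<Sum>j<d. \<Sum>l<d. (cmod (A i j l))\<^sup>2) = (0::complex)"
    using char_mat_sum_squares[of v] unfolding A_def by simp
  then have "(\<Sum>i<d. \<Sum>j<d. \<Sum>l<d. (cmod (A i j l))\<^sup>2) = 0"
    unfolding of_real_eq_0_iff .
  then have A0: "A i j l = 0" if "i < d" "j < d" "l < d" for i j l
    using that by (simp add: sum_nonneg_eq_0_iff sum_nonneg)
  have "(\<Sum>y\<in>carrier G. cnj (coef v y) * coef v y)
      = (\<Sum>y\<in>carrier G. \<Sum>j<d. \<Sum>i<d. \<Sum>l<d. v j * cnj (v i) * cnj (v l) * (cnj (p y j i) * mv y v l))"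
  proof (intro sum.cong refl)
    fix y
    have "cnj (coef v y) = (\<Sum>j<d. \<Sum>i<d. v j * cnj (v i) * cnj (p y j i))"
      unfolding coef_def mv_def by (simp add: sum_distrib_left mult_ac)
    then show "cnj (coef v y) * coef v y
        = (\<Sum>j<d. \<Sum>i<d. \<Sum>l<d. v j * cnj (v i) * cnj (v l) * (cnj (p y j i) * mv y v l))"
      unfolding coef_def by (simp add: sum_distrib_left sum_distrib_right mult_ac)
  qed
  also have "\<dots> = (\<Sum>j<d. \<Sum>y\<in>carrier G. \<Sum>i<d. \<Sum>l<d. v j * cnj (v i) * cnj (v l) * (cnj (p y j i) * mv y v l))"
    by (rule sum.swap)
  also have "\<dots> = (\<Sum>j<d. \<Sum>i<d. \<Sum>y\<in>carrier G. \<Sum>l<d. v j * cnj (v i) * cnj (v l) * (cnj (p y j i) * mv y v l))"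
    by (intro sum.cong refl sum.swap)
  also have "\<dots> = (\<Sum>j<d. \<Sum>i<d. \<Sum>l<d. \<Sum>y\<in>carrier G. v j * cnj (v i) * cnj (v l) * (cnj (p y j i) * mv y v l))"
    by (intro sum.cong refl sum.swap)
  also have "\<dots> = (\<Sum>j<d. \<Sum>i<d. \<Sum>l<d. v j * cnj (v i) * cnj (v l) * A i j l)"
    unfolding A_def sum_distrib_left by simp
  also have "\<dots> = 0" using A0 by simp
  finally have "of_real (\<Sum>y\<in>carrier G. (cmod (coef v y))\<^sup>2) = (0::complex)"
    by (simp only: of_real_sum cmod_square)
  then have "(\<Sum>y\<in>carrier G. (cmod (coef v y))\<^sup>2) = 0"
    unfolding of_real_eq_0_iff .
  then have "coef v \<one> = 0" using fin by (simp add: sum_nonneg_eq_0_iff)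
  then have "(\<Sum>i<d. cnj (v i) * v i) = 0" unfolding coef_def by (simp add: mv_one)
  then have "of_real (\<Sum>i<d. (cmod (v i))\<^sup>2) = (0::complex)"
    by (simp only: of_real_sum cmod_square)
  then have "(\<Sum>i<d. (cmod (v i))\<^sup>2) = 0"
    unfolding of_real_eq_0_iff .
  then show ?thesis using i by (simp add: sum_nonneg_eq_0_iff)
qed

text \<open>Write \<open>D\<close> for \<open>char_mat\<close>, with inverse
  \<open>\<sigma>\<close>, and put \<open>c g = tr (\<sigma> \<pi>(g\<^sup>-\<^sup>1))\<close>. Then
  \<open>\<sigma> D = 1\<close> says that convolving \<open>c\<close> with
  \<open>h \<mapsto> tr (inv h)\<close> reproduces that function. For
  \<open>e = \<Sum>g c(g) \<pi>(g)\<close> this gives \<open>e D = D\<close>, and \<open>D\<close>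
  cancels. The third conclusion is a factorisation of \<open>\<sigma>\<close>, available once
  \<open>\<sigma>\<close> is known to be positive.\<close>

lemma ex_kernel:
  obtains c B b where
    "\<And>g. g \<in> carrier G \<Longrightarrow> c g = (\<Sum>i<d. \<Sum>k<d. B i k * p (inv g) k i)"
    "\<And>i j. i < d \<Longrightarrow> j < d \<Longrightarrow> (\<Sum>g\<in>carrier G. c g * p g i j) = of_bool (i = j)"
    "\<And>g. g \<in> carrier G \<Longrightarrow> c (inv g) = (\<Sum>k<d. \<Sum>i<d. \<Sum>j<d. cnj (b k i) * p g i j * b k j)"
proof -
  obtain \<sigma> where \<sigma>: "\<And>i j. i < d \<Longrightarrow> j < d \<Longrightarrow> (\<Sum>k<d. char_mat i k * \<sigma> k j) = of_bool (i = j)"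
    "\<And>i j. i < d \<Longrightarrow> j < d \<Longrightarrow> (\<Sum>k<d. \<sigma> i k * char_mat k j) = of_bool (i = j)"
    using ex_inverse_matrix[of d char_mat] char_mat_inj by blast
  have delta: "(\<Sum>j<d. of_bool (i = j) * f j) = f i" if "i < d" for i and f :: "nat \<Rightarrow> complex"
  proof -
    have "(\<Sum>j<d. of_bool (i = j) * f j) = (\<Sum>j<d. if i = j then f j else 0)"
      by (intro sum.cong) auto
    then show ?thesis using that by simp
  qed
  \<comment> \<open>Positivity passes to the inverse: as \<open>v\<close> is the image of
    \<open>y\<close> under \<open>char_mat\<close>, the form of \<open>\<sigma>\<close> at
    \<open>v\<close> is the conjugate of the form of \<open>char_mat\<close> at
    \<open>y\<close>.\<close>
  have "sesq {..<d} \<sigma> v v = cnj (sesq {..<d} char_mat y y)"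
    if y: "y = (\<lambda>i. \<Sum>j<d. \<sigma> i j * v j)" for v y
  proof -
    have v: "v i = (\<Sum>j<d. char_mat i j * y j)" if "i < d" for i
    proof -
      have "(\<Sum>j<d. char_mat i j * y j) = (\<Sum>j<d. \<Sum>k<d. char_mat i j * \<sigma> j k * v k)"
        unfolding y by (simp add: sum_distrib_left mult.assoc)
      also have "\<dots> = (\<Sum>k<d. (\<Sum>j<d. char_mat i j * \<sigma> j k) * v k)"
        by (subst sum.swap) (simp add: sum_distrib_right)
      also have "\<dots> = v i" using \<sigma>(1)[OF that] delta[OF that] by simp
      finally show ?thesis by simp
    qed
    have "sesq {..<d} \<sigma> v v = (\<Sum>i<d. cnj (v i) * y i)"
      unfolding sesq_def y by (simp add: sum_distrib_left mult.assoc)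
    also have "\<dots> = (\<Sum>i<d. (\<Sum>j<d. cnj (char_mat i j * y j)) * y i)"
      by (intro sum.cong refl) (subst v, auto)
    also have "\<dots> = cnj (sesq {..<d} char_mat y y)"
      unfolding sesq_def cnj_sum sum_distrib_right by (intro sum.cong refl) simp
    finally show ?thesis .
  qed
  then have "psd_on {..<d} \<sigma>"
    using psd_char_mat unfolding psd_on_def by simp
  then obtain b where b: "\<And>i j. i < d \<Longrightarrow> j < d \<Longrightarrow> \<sigma> i j = (\<Sum>k<d. b k i * cnj (b k j))"
    using psd_on_factorization[of d \<sigma>] by blast
  define c where "c g = (\<Sum>i<d. \<Sum>k<d. \<sigma> i k * p (inv g) k i)" for g
  \<comment> \<open>Since \<open>c (x \<otimes> inv h)\<close> contains \<open>p h\<close> linearly,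
    the sum over \<open>h\<close> assembles \<open>char_mat\<close> next to \<open>\<sigma>\<close>,
    and the two cancel.\<close>
  have conv: "(\<Sum>h\<in>carrier G. c (x \<otimes> inv h) * tr (inv h)) = tr (inv x)" if x: "x \<in> carrier G" for x
  proof -
    have "(\<Sum>h\<in>carrier G. c (x \<otimes> inv h) * tr (inv h))
      = (\<Sum>h\<in>carrier G. \<Sum>i<d. \<Sum>m<d. \<Sum>k<d. \<sigma> i k * (tr (inv h) * p h k m) * p (inv x) m i)"
    proof (rule sum.cong[OF refl])
      fix h assume h: "h \<in> carrier G"
      have "c (x \<otimes> inv h) = (\<Sum>i<d. \<Sum>k<d. \<Sum>m<d. \<sigma> i k * (p h k m * p (inv x) m i))"
        unfolding c_def using x h by (simp add: inv_mult_group p_mult sum_distrib_left)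
      also have "\<dots> = (\<Sum>i<d. \<Sum>m<d. \<Sum>k<d. \<sigma> i k * (p h k m * p (inv x) m i))"
        by (intro sum.cong refl sum.swap)
      finally show "c (x \<otimes> inv h) * tr (inv h)
        = (\<Sum>i<d. \<Sum>m<d. \<Sum>k<d. \<sigma> i k * (tr (inv h) * p h k m) * p (inv x) m i)"
        by (simp add: sum_distrib_left sum_distrib_right mult_ac)
    qed
    also have "\<dots> = (\<Sum>i<d. \<Sum>h\<in>carrier G. \<Sum>m<d. \<Sum>k<d. \<sigma> i k * (tr (inv h) * p h k m) * p (inv x) m i)"
      by (rule sum.swap)
    also have "\<dots> = (\<Sum>i<d. \<Sum>m<d. \<Sum>h\<in>carrier G. \<Sum>k<d. \<sigma> i k * (tr (inv h) * p h k m) * p (inv x) m i)"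
      by (intro sum.cong refl sum.swap)
    also have "\<dots> = (\<Sum>i<d. \<Sum>m<d. \<Sum>k<d. \<Sum>h\<in>carrier G. \<sigma> i k * (tr (inv h) * p h k m) * p (inv x) m i)"
      by (intro sum.cong refl sum.swap)
    also have "\<dots> = (\<Sum>i<d. \<Sum>m<d. (\<Sum>k<d. \<sigma> i k * char_mat k m) * p (inv x) m i)"
      unfolding char_mat_def sum_distrib_left sum_distrib_right by simp
    also have "\<dots> = (\<Sum>i<d. \<Sum>m<d. of_bool (i = m) * p (inv x) m i)"
      using \<sigma>(2) by (intro sum.cong refl) simp
    also have "\<dots> = tr (inv x)"
      unfolding tr_def by (intro sum.cong refl delta) simp
    finally show ?thesis .
  qed
  have unit: "(\<Sum>g\<in>carrier G. c g * p g i j) = of_bool (i = j)" if ij: "i < d" "j < d" for i j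
  proof -
    define e where "e i j = (\<Sum>g\<in>carrier G. c g * p g i j)" for i j
    have e: "(\<Sum>j<d. e i j * char_mat j l) = char_mat i l" if "l < d" for l
    proof -
      have "(\<Sum>j<d. e i j * char_mat j l)
        = (\<Sum>j<d. \<Sum>g\<in>carrier G. \<Sum>h\<in>carrier G. c g * tr (inv h) * (p g i j * p h j l))"
        unfolding e_def char_mat_def sum_product by (simp add: mult_ac)
      also have "\<dots> = (\<Sum>g\<in>carrier G. \<Sum>j<d. \<Sum>h\<in>carrier G. c g * tr (inv h) * (p g i j * p h j l))"
        by (rule sum.swap)
      also have "\<dots> = (\<Sum>g\<in>carrier G. \<Sum>h\<in>carrier G. \<Sum>j<d. c g * tr (inv h) * (p g i j * p h j l))"
        by (intro sum.cong refl sum.swap)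
      also have "\<dots> = (\<Sum>g\<in>carrier G. \<Sum>h\<in>carrier G. c g * tr (inv h) * p (g \<otimes> h) i l)"
        using ij that by (simp add: p_mult sum_distrib_left)
      also have "\<dots> = (\<Sum>h\<in>carrier G. \<Sum>g\<in>carrier G. c g * tr (inv h) * p (g \<otimes> h) i l)"
        by (rule sum.swap)
      also have "\<dots> = (\<Sum>h\<in>carrier G. \<Sum>x\<in>carrier G. c (x \<otimes> inv h) * tr (inv h) * p x i l)"
      proof (rule sum.cong[OF refl])
        fix h assume h: "h \<in> carrier G"
        have "(\<Sum>g\<in>carrier G. c g * tr (inv h) * p (g \<otimes> h) i l)
          = (\<Sum>x\<in>carrier G. c (x \<otimes> inv h) * tr (inv h) * p ((x \<otimes> inv h) \<otimes> h) i l)"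
          using sum_right[of "inv h" "\<lambda>g. c g * tr (inv h) * p (g \<otimes> h) i l"] h by simp
        then show "(\<Sum>g\<in>carrier G. c g * tr (inv h) * p (g \<otimes> h) i l)
          = (\<Sum>x\<in>carrier G. c (x \<otimes> inv h) * tr (inv h) * p x i l)"
          using h by (simp add: m_assoc)
      qed
      also have "\<dots> = (\<Sum>x\<in>carrier G. \<Sum>h\<in>carrier G. c (x \<otimes> inv h) * tr (inv h) * p x i l)"
        by (rule sum.swap)
      also have "\<dots> = (\<Sum>x\<in>carrier G. (\<Sum>h\<in>carrier G. c (x \<otimes> inv h) * tr (inv h)) * p x i l)"
        by (simp add: sum_distrib_right)
      also have "\<dots> = char_mat i l"
        unfolding char_mat_def by (intro sum.cong refl) (simp add: conv)
      finally show ?thesis .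
    qed
    have "e i j = (\<Sum>k<d. of_bool (j = k) * e i k)"
      by (rule delta[OF ij(2), symmetric])
    also have "\<dots> = (\<Sum>k<d. e i k * (\<Sum>l<d. char_mat k l * \<sigma> l j))"
      using \<sigma>(1) ij by (intro sum.cong refl) (auto simp: of_bool_def)
    also have "\<dots> = (\<Sum>k<d. \<Sum>l<d. e i k * char_mat k l * \<sigma> l j)"
      by (simp add: sum_distrib_left mult.assoc)
    also have "\<dots> = (\<Sum>l<d. (\<Sum>k<d. e i k * char_mat k l) * \<sigma> l j)"
      by (subst sum.swap) (simp add: sum_distrib_right)
    also have "\<dots> = (\<Sum>l<d. char_mat i l * \<sigma> l j)"
      by (intro sum.cong refl) (simp add: e)
    also have "\<dots> = of_bool (i = j)" using \<sigma>(1) ij by simp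
    finally show ?thesis unfolding e_def .
  qed
  have gram: "c (inv g) = (\<Sum>k<d. \<Sum>i<d. \<Sum>j<d. cnj (b k i) * p g i j * b k j)" if "g \<in> carrier G" for g
  proof -
    have "c (inv g) = (\<Sum>j<d. \<Sum>i<d. \<Sum>k<d. cnj (b k i) * p g i j * b k j)"
      unfolding c_def using that b by (simp add: sum_distrib_left sum_distrib_right mult_ac)
    also have "\<dots> = (\<Sum>i<d. \<Sum>j<d. \<Sum>k<d. cnj (b k i) * p g i j * b k j)"
      by (rule sum.swap)
    also have "\<dots> = (\<Sum>i<d. \<Sum>k<d. \<Sum>j<d. cnj (b k i) * p g i j * b k j)"
      by (intro sum.cong refl sum.swap)
    also have "\<dots> = (\<Sum>k<d. \<Sum>i<d. \<Sum>j<d. cnj (b k i) * p g i j * b k j)"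
      by (rule sum.swap)
    finally show ?thesis .
  qed
  show thesis by (rule that[OF c_def unit gram])
qed

text \<open>By \<open>p_inv\<close> these are the combinations of conjugated entries of
  \<open>\<pi>\<close>. The inverse in the definition is what makes left convolution by
  \<open>c\<close> fix them.\<close>

definition matrix_coeff :: "('a \<Rightarrow> complex) \<Rightarrow> bool" where
  "matrix_coeff w \<longleftrightarrow> (\<exists>B. \<forall>g\<in>carrier G. w g = (\<Sum>i<d. \<Sum>k<d. B i k * p (inv g) k i))"

lemma matrix_coeff_mult_left:
  assumes "matrix_coeff w" and x: "x \<in> carrier G"
  shows "matrix_coeff (\<lambda>g. w (x \<otimes> g))"
proof -
  obtain B where B: "\<And>g. g \<in> carrier G \<Longrightarrow> w g = (\<Sum>i<d. \<Sum>k<d. B i k * p (inv g) k i)"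
    using assms(1) unfolding matrix_coeff_def by blast
  have "w (x \<otimes> g) = (\<Sum>m<d. \<Sum>k<d. (\<Sum>i<d. B i k * p (inv x) m i) * p (inv g) k m)"
    if g: "g \<in> carrier G" for g
  proof -
    have "w (x \<otimes> g) = (\<Sum>i<d. \<Sum>k<d. \<Sum>m<d. B i k * (p (inv g) k m * p (inv x) m i))"
      using x g by (simp add: B inv_mult_group p_mult sum_distrib_left)
    also have "\<dots> = (\<Sum>i<d. \<Sum>m<d. \<Sum>k<d. B i k * (p (inv g) k m * p (inv x) m i))"
      by (intro sum.cong refl sum.swap)
    also have "\<dots> = (\<Sum>m<d. \<Sum>i<d. \<Sum>k<d. B i k * (p (inv g) k m * p (inv x) m i))"
      by (rule sum.swap)
    also have "\<dots> = (\<Sum>m<d. \<Sum>k<d. \<Sum>i<d. B i k * (p (inv g) k m * p (inv x) m i))"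
      by (intro sum.cong refl sum.swap)
    finally show ?thesis by (simp add: sum_distrib_left mult_ac)
  qed
  then show ?thesis
    unfolding matrix_coeff_def by (intro exI[of _ "\<lambda>m k. \<Sum>i<d. B i k * p (inv x) m i"]) blast
qed

lemma matrix_coeff_mult_right:
  assumes "matrix_coeff w" and x: "x \<in> carrier G"
  shows "matrix_coeff (\<lambda>g. w (g \<otimes> x))"
proof -
  obtain B where B: "\<And>g. g \<in> carrier G \<Longrightarrow> w g = (\<Sum>i<d. \<Sum>k<d. B i k * p (inv g) k i)"
    using assms(1) unfolding matrix_coeff_def by blast
  have "w (g \<otimes> x) = (\<Sum>i<d. \<Sum>m<d. (\<Sum>k<d. B i k * p (inv x) k m) * p (inv g) m i)"
    if g: "g \<in> carrier G" for g
  proof -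
    have "w (g \<otimes> x) = (\<Sum>i<d. \<Sum>k<d. \<Sum>m<d. B i k * (p (inv x) k m * p (inv g) m i))"
      using x g by (simp add: B inv_mult_group p_mult sum_distrib_left)
    also have "\<dots> = (\<Sum>i<d. \<Sum>m<d. \<Sum>k<d. B i k * (p (inv x) k m * p (inv g) m i))"
      by (intro sum.cong refl sum.swap)
    finally show ?thesis by (simp add: sum_distrib_left mult_ac)
  qed
  then show ?thesis
    unfolding matrix_coeff_def by (intro exI[of _ "\<lambda>i m. \<Sum>k<d. B i k * p (inv x) k m"]) blast
qed

end

section \<open>The central idempotent and its reproducing kernel\<close>

locale reproducing_rep = unitary_matrix_rep G d p for G (structure) and d p +
  fixes c :: "'a \<Rightarrow> complex" and b :: "nat \<Rightarrow> nat \<Rightarrow> complex"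
  assumes c_coeff: "matrix_coeff c"
    and c_unit: "\<And>i j. i < d \<Longrightarrow> j < d \<Longrightarrow> (\<Sum>g\<in>carrier G. c g * p g i j) = of_bool (i = j)"
    and c_gram: "\<And>g. g \<in> carrier G \<Longrightarrow> c (inv g) = (\<Sum>k<d. \<Sum>i<d. \<Sum>j<d. cnj (b k i) * p g i j * b k j)"
begin

text \<open>In \<open>w (inv g \<otimes> y)\<close> the variable \<open>g\<close> occurs only
  through a linear expression in the entries \<open>p g\<close>, so \<open>c_unit\<close> evaluates
  the sum.\<close>

lemma conv_coeff:
  assumes "matrix_coeff w" and y: "y \<in> carrier G"
  shows "(\<Sum>g\<in>carrier G. c g * w (inv g \<otimes> y)) = w y"
proof -
  obtain B where B: "\<And>g. g \<in> carrier G \<Longrightarrow> w g = (\<Sum>i<d. \<Sum>k<d. B i k * p (inv g) k i)"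
    using assms(1) unfolding matrix_coeff_def by blast
  have "(\<Sum>g\<in>carrier G. c g * w (inv g \<otimes> y))
    = (\<Sum>g\<in>carrier G. \<Sum>i<d. \<Sum>k<d. \<Sum>m<d. B i k * p (inv y) k m * (c g * p g m i))"
    using y by (intro sum.cong refl)
      (simp add: B inv_mult_group p_mult sum_distrib_left mult_ac)
  also have "\<dots> = (\<Sum>i<d. \<Sum>g\<in>carrier G. \<Sum>k<d. \<Sum>m<d. B i k * p (inv y) k m * (c g * p g m i))"
    by (rule sum.swap)
  also have "\<dots> = (\<Sum>i<d. \<Sum>k<d. \<Sum>g\<in>carrier G. \<Sum>m<d. B i k * p (inv y) k m * (c g * p g m i))"
    by (intro sum.cong refl sum.swap)
  also have "\<dots> = (\<Sum>i<d. \<Sum>k<d. \<Sum>m<d. \<Sum>g\<in>carrier G. B i k * p (inv y) k m * (c g * p g m i))"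
    by (intro sum.cong refl sum.swap)
  also have "\<dots> = (\<Sum>i<d. \<Sum>k<d. \<Sum>m<d. if m = i then B i k * p (inv y) k m else 0)"
    unfolding sum_distrib_left[symmetric] by (intro sum.cong refl) (simp add: c_unit)
  also have "\<dots> = w y" using y by (simp add: B)
  finally show ?thesis .
qed

lemma c_inv:
  assumes "g \<in> carrier G"
  shows "c (inv g) = cnj (c g)"
proof -
  have "cnj (c g) = cnj (c (inv (inv g)))" using assms by simp
  also have "\<dots> = (\<Sum>k<d. \<Sum>i<d. \<Sum>j<d. b k i * p g j i * cnj (b k j))"
    unfolding c_gram[OF inv_closed[OF assms]] using assms by (simp add: p_inv)
  also have "\<dots> = (\<Sum>k<d. \<Sum>j<d. \<Sum>i<d. b k i * p g j i * cnj (b k j))"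
    by (intro sum.cong refl sum.swap)
  also have "\<dots> = c (inv g)"
    unfolding c_gram[OF assms] by (simp add: mult_ac)
  finally show ?thesis by simp
qed

text \<open>A uniqueness-of-unit argument with only a left unit at hand. Applied to the conjugate of
  \<open>c\<close>, \<open>conv_coeff\<close> expresses the left-hand side as a convolution.
  Substitutions rewrite it as the convolution of \<open>c\<close> with another two-sided translate,
  \<open>z \<mapsto> c (y \<otimes> inv x \<otimes> z \<otimes> x)\<close>, taken at
  \<open>\<one>\<close>; a second use of \<open>conv_coeff\<close> gives \<open>c y\<close>.\<close>

lemma c_conj:
  assumes x: "x \<in> carrier G" and y: "y \<in> carrier G"
  shows "c (x \<otimes> y \<otimes> inv x) = c y"
proof -
  have "matrix_coeff (\<lambda>z. c (x \<otimes> z \<otimes> inv x))"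
    using matrix_coeff_mult_left[OF matrix_coeff_mult_right[OF c_coeff, of "inv x"] x] x by simp
  from conv_coeff[OF this y]
  have "c (x \<otimes> y \<otimes> inv x) = (\<Sum>g\<in>carrier G. c g * c (x \<otimes> (inv g \<otimes> y) \<otimes> inv x))" by simp
  also have "\<dots> = (\<Sum>g\<in>carrier G. c (inv g) * c (x \<otimes> (g \<otimes> y) \<otimes> inv x))"
    by (subst sum_inverse[symmetric]) simp
  also have "\<dots> = (\<Sum>g\<in>carrier G. c (inv (g \<otimes> inv y)) * c (x \<otimes> (g \<otimes> inv y \<otimes> y) \<otimes> inv x))"
    using sum_right[of "inv y" "\<lambda>g. c (inv g) * c (x \<otimes> (g \<otimes> y) \<otimes> inv x)"] y by simp
  also have "\<dots> = (\<Sum>g\<in>carrier G. c (y \<otimes> inv g) * c (x \<otimes> g \<otimes> inv x))"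
    using x y by (intro sum.cong refl) (simp add: inv_mult_group m_assoc)
  also have "\<dots> = (\<Sum>g\<in>carrier G. c (y \<otimes> inv (inv x \<otimes> g)) * c (x \<otimes> (inv x \<otimes> g) \<otimes> inv x))"
    using sum_left[of "inv x" "\<lambda>g. c (y \<otimes> inv g) * c (x \<otimes> g \<otimes> inv x)"] x by simp
  also have "\<dots> = (\<Sum>g\<in>carrier G. c (y \<otimes> inv g \<otimes> x) * c (g \<otimes> inv x))"
    using x y by (intro sum.cong refl) (simp add: inv_mult_group m_assoc[symmetric])
  also have "\<dots> = (\<Sum>g\<in>carrier G. c (y \<otimes> inv (g \<otimes> x) \<otimes> x) * c (g \<otimes> x \<otimes> inv x))"
    using sum_right[of x "\<lambda>g. c (y \<otimes> inv g \<otimes> x) * c (g \<otimes> inv x)"] x by simp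
  also have "\<dots> = (\<Sum>g\<in>carrier G. c g * c (y \<otimes> inv x \<otimes> (inv g \<otimes> \<one>) \<otimes> x))"
    using x y by (intro sum.cong refl) (simp add: inv_mult_group m_assoc)
  also have "\<dots> = c (y \<otimes> inv x \<otimes> \<one> \<otimes> x)"
  proof -
    have "matrix_coeff (\<lambda>z. c (y \<otimes> inv x \<otimes> z \<otimes> x))"
      using matrix_coeff_mult_left[OF matrix_coeff_mult_right[OF c_coeff, of x], of "y \<otimes> inv x"] x y by simp
    from conv_coeff[OF this one_closed] show ?thesis .
  qed
  also have "\<dots> = c y" using x y by (simp add: m_assoc)
  finally show ?thesis .
qed

lemma c_commute:
  assumes x: "x \<in> carrier G" and y: "y \<in> carrier G"
  shows "c (x \<otimes> y) = c (y \<otimes> x)"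
  using c_conj[OF x, of "y \<otimes> x"] x y by (simp add: m_assoc)

text \<open>The kernel of the orthogonal projection onto the matrix coefficients, which is what
  \<open>K_hermitian\<close>, \<open>K_idem\<close> and \<open>K_reproduces\<close> amount
  to.\<close>

definition K :: "'a \<Rightarrow> 'a \<Rightarrow> complex" where "K x y = c (inv y \<otimes> x)"

lemma K_hermitian:
  assumes "x \<in> carrier G" "y \<in> carrier G"
  shows "K y x = cnj (K x y)"
  using assms c_inv[of "inv y \<otimes> x"] by (simp add: K_def inv_mult_group)

lemma K_idem:
  assumes x: "x \<in> carrier G" and z: "z \<in> carrier G"
  shows "(\<Sum>y\<in>carrier G. K x y * K y z) = K x z"
proof -
  have "(\<Sum>y\<in>carrier G. K x y * K y z) = (\<Sum>g\<in>carrier G. K x (z \<otimes> g) * K (z \<otimes> g) z)"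
    using sum_left[OF z, of "\<lambda>y. K x y * K y z"] by simp
  also have "\<dots> = (\<Sum>g\<in>carrier G. c g * c (inv g \<otimes> (inv z \<otimes> x)))"
    unfolding K_def using x z by (intro sum.cong refl) (simp add: inv_mult_group m_assoc[symmetric])
  also have "\<dots> = K x z"
    unfolding K_def using x z by (intro conv_coeff c_coeff) auto
  finally show ?thesis .
qed

lemma K_reproduces:
  assumes w: "matrix_coeff w" and x: "x \<in> carrier G"
  shows "(\<Sum>y\<in>carrier G. K x y * w y) = w x"
proof -
  have "(\<Sum>y\<in>carrier G. K x y * w y) = (\<Sum>y\<in>carrier G. K x (y \<otimes> x) * w (y \<otimes> x))"
    using sum_right[OF x, of "\<lambda>y. K x y * w y"] by simp
  also have "\<dots> = (\<Sum>y\<in>carrier G. K x (inv y \<otimes> x) * w (inv y \<otimes> x))"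
    by (subst sum_inverse[symmetric]) simp
  also have "\<dots> = (\<Sum>g\<in>carrier G. c g * w (inv g \<otimes> x))"
  proof (intro sum.cong refl arg_cong2[of _ _ _ _ "(*)"])
    fix g assume g: "g \<in> carrier G"
    \<comment> \<open>Centrality enters here: integrating against \<open>K\<close> convolves with
      \<open>c\<close> on the right, whereas \<open>conv_coeff\<close> handles the left.\<close>
    have "K x (inv g \<otimes> x) = c (inv x \<otimes> g \<otimes> x)"
      unfolding K_def using x g by (simp add: inv_mult_group)
    also have "\<dots> = c (inv x \<otimes> g \<otimes> inv (inv x))" using x by simp
    also have "\<dots> = c g" using x g by (intro c_conj) auto
    finally show "K x (inv g \<otimes> x) = c g" .
  qed
  also have "\<dots> = w x" by (rule conv_coeff[OF w x])
  finally show ?thesis .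
qed

text \<open>\<open>K \<one> \<one>\<close> is the squared norm of \<open>c\<close>, and
  \<open>c\<close> cannot vanish since it acts as the identity on a nonzero space. This is the
  source of \<open>l > 0\<close>.\<close>

lemma K_one_pos: "Re (K \<one> \<one>) > 0"
proof -
  have "K \<one> \<one> = (\<Sum>y\<in>carrier G. cnj (K y \<one>) * K y \<one>)"
    unfolding K_idem[OF one_closed one_closed, symmetric]
    by (intro sum.cong refl arg_cong2[of _ _ _ _ "(*)"] K_hermitian) auto
  also have "\<dots> = of_real (\<Sum>y\<in>carrier G. (cmod (c y))\<^sup>2)"
    unfolding of_real_sum cmod_square by (simp add: K_def)
  finally have *: "Re (K \<one> \<one>) = (\<Sum>y\<in>carrier G. (cmod (c y))\<^sup>2)" by simp
  have "\<exists>g\<in>carrier G. c g \<noteq> 0"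
  proof (rule ccontr)
    assume "\<not> ?thesis"
    then have "(\<Sum>g\<in>carrier G. c g * p g 0 0) = 0" by simp
    then show False using c_unit[OF d_pos d_pos] by simp
  qed
  then obtain g where "g \<in> carrier G" "c g \<noteq> 0" by blast
  then show ?thesis unfolding * by (intro sum_pos2[OF fin]) auto
qed

end

section \<open>The optimal value as a top eigenvalue\<close>

lemma sum_div_mod:
  fixes F :: "nat \<Rightarrow> nat \<Rightarrow> 'b::comm_monoid_add"
  shows "(\<Sum>r<d*N. F (r div N) (r mod N)) = (\<Sum>i<d. \<Sum>k<N. F i k)"
proof -
  have "(\<Sum>i<d. \<Sum>k<N. F i k) = (\<Sum>(i,k)\<in>{..<d}\<times>{..<N}. F i k)"
    by (rule sum.cartesian_product)
  also have "\<dots> = (\<Sum>r<d*N. F (r div N) (r mod N))"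
  proof (rule sum.reindex_bij_witness[of _ "\<lambda>r. (r div N, r mod N)" "\<lambda>(i,k). i * N + k"])
    fix ik assume "ik \<in> {..<d}\<times>{..<N}"
    then obtain i k where ik: "ik = (i,k)" "i < d" "k < N" by auto
    have "i * N + k < Suc i * N" using ik by simp
    also have "\<dots> \<le> d * N" using ik by (intro mult_le_mono1) simp
    finally show "(case ik of (i,k) \<Rightarrow> i * N + k) \<in> {..<d*N}" using ik by simp
    show "((case ik of (i,k) \<Rightarrow> i * N + k) div N, (case ik of (i,k) \<Rightarrow> i * N + k) mod N) = ik"
      "F ((case ik of (i,k) \<Rightarrow> i * N + k) div N) ((case ik of (i,k) \<Rightarrow> i * N + k) mod N)
        = (case ik of (i,k) \<Rightarrow> F i k)"
      using ik by auto
  next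
    fix r assume "r \<in> {..<d*N}"
    then show "(case (r div N, r mod N) of (i,k) \<Rightarrow> i * N + k) = r" "(r div N, r mod N) \<in> {..<d}\<times>{..<N}"
      by (auto simp: less_mult_imp_div_less intro!: mod_less_divisor gr0I)
  qed
  finally show ?thesis by simp
qed

lemma sesq_rank_one_sum:
  assumes "\<And>i j. i \<in> A \<Longrightarrow> j \<in> A \<Longrightarrow> E i j = (\<Sum>k\<in>S. v k i * cnj (v k j))"
  shows "sesq A E x x = of_real (\<Sum>k\<in>S. (cmod (\<Sum>j\<in>A. cnj (v k j) * x j))\<^sup>2)"
proof -
  have "sesq A E x x = (\<Sum>i\<in>A. \<Sum>j\<in>A. \<Sum>k\<in>S. (cnj (x i) * v k i) * (cnj (v k j) * x j))"
    unfolding sesq_def using assms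
    by (intro sum.cong refl) (simp add: sum_distrib_left sum_distrib_right mult_ac)
  also have "\<dots> = (\<Sum>i\<in>A. \<Sum>k\<in>S. \<Sum>j\<in>A. (cnj (x i) * v k i) * (cnj (v k j) * x j))"
    by (intro sum.cong refl sum.swap)
  also have "\<dots> = (\<Sum>k\<in>S. \<Sum>i\<in>A. \<Sum>j\<in>A. (cnj (x i) * v k i) * (cnj (v k j) * x j))"
    by (rule sum.swap)
  also have "\<dots> = (\<Sum>k\<in>S. cnj (\<Sum>j\<in>A. cnj (v k j) * x j) * (\<Sum>j\<in>A. cnj (v k j) * x j))"
    unfolding cnj_sum sum_product by (intro sum.cong refl) (simp add: mult_ac)
  finally show ?thesis unfolding of_real_sum cmod_square .
qed

context unitary_matrix_rep
begin

lemma matrix_coeff_sum: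
  assumes "\<And>j. j \<in> J \<Longrightarrow> matrix_coeff (w j)"
  shows "matrix_coeff (\<lambda>g. \<Sum>j\<in>J. a j * w j g)"
proof -
  have "\<forall>j\<in>J. \<exists>B. \<forall>g\<in>carrier G. w j g = (\<Sum>i<d. \<Sum>k<d. B i k * p (inv g) k i)"
    using assms unfolding matrix_coeff_def by blast
  from bchoice[OF this] obtain B where B: "\<And>j g. j \<in> J \<Longrightarrow> g \<in> carrier G \<Longrightarrow>
      w j g = (\<Sum>i<d. \<Sum>k<d. B j i k * p (inv g) k i)"
    by blast
  have "(\<Sum>j\<in>J. a j * w j g) = (\<Sum>i<d. \<Sum>k<d. (\<Sum>j\<in>J. a j * B j i k) * p (inv g) k i)"
    if "g \<in> carrier G" for g
  proof -
    have "(\<Sum>j\<in>J. a j * w j g) = (\<Sum>j\<in>J. \<Sum>i<d. \<Sum>k<d. a j * B j i k * p (inv g) k i)"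
      using B that by (intro sum.cong refl) (simp add: sum_distrib_left mult.assoc)
    also have "\<dots> = (\<Sum>i<d. \<Sum>j\<in>J. \<Sum>k<d. a j * B j i k * p (inv g) k i)"
      by (rule sum.swap)
    also have "\<dots> = (\<Sum>i<d. \<Sum>k<d. \<Sum>j\<in>J. a j * B j i k * p (inv g) k i)"
      by (intro sum.cong refl sum.swap)
    finally show ?thesis by (simp add: sum_distrib_right)
  qed
  then show ?thesis
    unfolding matrix_coeff_def by (intro exI[of _ "\<lambda>i k. \<Sum>j\<in>J. a j * B j i k"]) blast
qed

lemma matrix_coeff_cnj_entry:
  assumes "i < d" "j < d"
  shows "matrix_coeff (\<lambda>g. cnj (p g i j))"
proof -
  have "cnj (p g i j) = (\<Sum>i'<d. \<Sum>k<d. (of_bool (i' = i) * of_bool (k = j)) * p (inv g) k i')"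
    if g: "g \<in> carrier G" for g
  proof -
    have "(\<Sum>i'<d. \<Sum>k<d. (of_bool (i' = i) * of_bool (k = j)) * p (inv g) k i')
      = (\<Sum>i'<d. if i' = i then \<Sum>k<d. if k = j then p (inv g) j i else 0 else 0)"
      by (intro sum.cong) (auto intro!: sum.cong)
    then show ?thesis using assms g by (simp add: p_inv)
  qed
  then show ?thesis
    unfolding matrix_coeff_def
    by (intro exI[of _ "\<lambda>i' k. of_bool (i' = i) * of_bool (k = j)"]) blast
qed

end

text \<open>\<open>(l, u)\<close> is a top eigenpair of \<open>K\<close> compressed to the functions
  on \<open>H\<close>. Both bounds are derived from these properties alone; existence is a separate
  compactness argument.\<close>

locale coset_rep = reproducing_rep G d p c b for G (structure) and d p c b +
  fixes H :: "'a set" and l :: real and u :: "'a \<Rightarrow> complex"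
  assumes H: "subgroup H G"
    and u_norm: "(\<Sum>h\<in>H. (cmod (u h))\<^sup>2) = 1"
    and u_eigen: "\<And>h. h \<in> H \<Longrightarrow> (\<Sum>k\<in>H. K h k * u k) = l * u h"
    and rayleigh: "\<And>v. Re (sesq H K v v) \<le> l * (\<Sum>h\<in>H. (cmod (v h))\<^sup>2)"
begin

lemma HG: "h \<in> H \<Longrightarrow> h \<in> carrier G"
  using subgroup.mem_carrier[OF H] .

lemma finH: "finite H"
  using subgroup.subset[OF H] fin by (rule finite_subset)

text \<open>The point mass at \<open>\<one>\<close> already has the positive Rayleigh quotient
  \<open>K \<one> \<one>\<close>.\<close>

lemma l_pos: "l > 0"
proof -
  have "Re (K \<one> \<one>) \<le> l * (\<Sum>h\<in>H. (cmod (of_bool (h = \<one>)))\<^sup>2)"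
    using rayleigh[of "\<lambda>h. of_bool (h = \<one>)"] subgroup.one_closed[OF H]
    by (simp add: sesq_unit_unit[OF finH])
  also have "(\<Sum>h\<in>H. (cmod (of_bool (h = \<one>)))\<^sup>2) = (\<Sum>h\<in>H. if h = \<one> then 1 else 0)"
    by (intro sum.cong) auto
  also have "\<dots> = 1" using finH subgroup.one_closed[OF H] by simp
  finally show ?thesis using K_one_pos by simp
qed

text \<open>With \<open>P\<close> the projection given by \<open>K\<close> and \<open>Q\<close> the
  restriction to \<open>H\<close>, the assumption bounds \<open>Q P Q\<close> while the claim bounds
  \<open>P Q P\<close>. Take \<open>r = P Q w\<close>. Its inner product with \<open>w\<close> is
  the mass \<open>n\<close> of \<open>w\<close> on \<open>H\<close>, because \<open>P w = w\<close>,
  and its squared norm is the form of \<open>K\<close> at \<open>w\<close> on \<open>H\<close>,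
  hence at most \<open>l * n\<close>.\<close>

lemma subgroup_mass_le:
  assumes w: "matrix_coeff w"
  shows "(\<Sum>h\<in>H. (cmod (w h))\<^sup>2) \<le> l * (\<Sum>g\<in>carrier G. (cmod (w g))\<^sup>2)"
proof -
  define r where "r y = (\<Sum>h\<in>H. K y h * w h)" for y
  define n where "n = (\<Sum>h\<in>H. (cmod (w h))\<^sup>2)"
  have "(\<Sum>y\<in>carrier G. cnj (w y) * r y) = (\<Sum>h\<in>H. w h * (\<Sum>y\<in>carrier G. cnj (w y) * K y h))"
    unfolding r_def sum_distrib_left by (subst sum.swap) (simp add: mult_ac)
  also have "\<dots> = (\<Sum>h\<in>H. cnj (w h) * w h)"
  proof (intro sum.cong refl)
    fix h assume h: "h \<in> H"
    have "(\<Sum>y\<in>carrier G. cnj (w y) * K y h) = cnj (\<Sum>y\<in>carrier G. K h y * w y)"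
      unfolding cnj_sum using HG[OF h] by (intro sum.cong refl) (simp add: K_hermitian[of h])
    then show "w h * (\<Sum>y\<in>carrier G. cnj (w y) * K y h) = cnj (w h) * w h"
      using K_reproduces[OF w HG[OF h]] by simp
  qed
  also have "\<dots> = of_real n" unfolding n_def of_real_sum cmod_square ..
  finally have 1: "(\<Sum>y\<in>carrier G. cnj (w y) * r y) = of_real n" .
  have "(\<Sum>y\<in>carrier G. cnj (r y) * r y)
    = (\<Sum>y\<in>carrier G. \<Sum>h\<in>H. \<Sum>k\<in>H. cnj (w h) * (K h y * K y k) * w k)"
  proof (rule sum.cong[OF refl])
    fix y assume y: "y \<in> carrier G"
    have "cnj (r y) = (\<Sum>h\<in>H. cnj (w h) * K h y)"
      unfolding r_def cnj_sum using HG y by (intro sum.cong refl) (simp add: K_hermitian[of y])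
    then show "cnj (r y) * r y = (\<Sum>h\<in>H. \<Sum>k\<in>H. cnj (w h) * (K h y * K y k) * w k)"
      unfolding r_def by (simp add: sum_product mult.assoc)
  qed
  also have "\<dots> = (\<Sum>h\<in>H. \<Sum>y\<in>carrier G. \<Sum>k\<in>H. cnj (w h) * (K h y * K y k) * w k)"
    by (rule sum.swap)
  also have "\<dots> = (\<Sum>h\<in>H. \<Sum>k\<in>H. \<Sum>y\<in>carrier G. cnj (w h) * (K h y * K y k) * w k)"
    by (intro sum.cong refl sum.swap)
  also have "\<dots> = sesq H K w w"
    unfolding sesq_def sum_distrib_left[symmetric] sum_distrib_right[symmetric] using HG
    by (intro sum.cong refl) (simp add: K_idem)
  finally have "complex_of_real (\<Sum>y\<in>carrier G. (cmod (r y))\<^sup>2) = sesq H K w w"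
    unfolding of_real_sum cmod_square .
  then have 2: "(\<Sum>y\<in>carrier G. (cmod (r y))\<^sup>2) \<le> l * n"
    using rayleigh[of w] unfolding n_def by (metis Re_complex_of_real)
  \<comment> \<open>\<open>r\<close> is the projection of the restriction of \<open>w\<close> to \<open>H\<close>; expanding this square gives the bound.\<close>
  have "0 \<le> (\<Sum>y\<in>carrier G. (cmod (of_real l * w y - r y))\<^sup>2)"
    by (intro sum_nonneg) auto
  also have "\<dots> = (\<Sum>y\<in>carrier G. l\<^sup>2 * (cmod (w y))\<^sup>2 - 2 * l * Re (cnj (w y) * r y) + (cmod (r y))\<^sup>2)"
    by (intro sum.cong refl) (simp add: cmod_power2, simp add: power2_eq_square algebra_simps)
  also have "\<dots> = l\<^sup>2 * (\<Sum>y\<in>carrier G. (cmod (w y))\<^sup>2) - 2 * l * Re (\<Sum>y\<in>carrier G. cnj (w y) * r y)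
      + (\<Sum>y\<in>carrier G. (cmod (r y))\<^sup>2)"
    by (simp only: sum.distrib sum_subtractf sum_distrib_left Re_sum)
  also have "\<dots> \<le> l\<^sup>2 * (\<Sum>y\<in>carrier G. (cmod (w y))\<^sup>2) - l * n"
    using 1 2 by simp
  finally have "l * n \<le> l * (l * (\<Sum>y\<in>carrier G. (cmod (w y))\<^sup>2))"
    by (simp add: power2_eq_square)
  then show ?thesis using l_pos unfolding n_def by simp
qed

lemma coset_mass_le:
  assumes w: "matrix_coeff w" and a: "a \<in> carrier G"
  shows "(\<Sum>h\<in>H. (cmod (w (a \<otimes> h)))\<^sup>2) \<le> l * (\<Sum>g\<in>carrier G. (cmod (w g))\<^sup>2)"
  using subgroup_mass_le[OF matrix_coeff_mult_left[OF w a]]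
    sum_left[OF a, of "\<lambda>g. (cmod (w g))\<^sup>2"] by simp

text \<open>A measurement operator need not have rank one, so it is split by Cholesky into squares
  of linear functionals. Each of these, evaluated on the state and conjugated, is a matrix
  coefficient, to which the bound on cosets applies.\<close>

lemma coset_form_le:
  fixes n :: nat
  assumes E: "psd_on {..<n} E" and a: "a \<in> carrier G"
    and \<phi>: "\<And>i. i < n \<Longrightarrow> matrix_coeff (\<lambda>g. cnj (\<phi> g i))"
  shows "(\<Sum>h\<in>H. Re (sesq {..<n} E (\<phi> (a \<otimes> h)) (\<phi> (a \<otimes> h))))
    \<le> l * (\<Sum>g\<in>carrier G. Re (sesq {..<n} E (\<phi> g) (\<phi> g)))"
proof -
  obtain v where v: "\<And>i j. i < n \<Longrightarrow> j < n \<Longrightarrow> E i j = (\<Sum>k<n. v k i * cnj (v k j))"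
    using psd_on_factorization[OF E] by blast
  define w where "w k g = (\<Sum>j<n. v k j * cnj (\<phi> g j))" for k g
  have w: "matrix_coeff (w k)" for k
    using matrix_coeff_sum[of "{..<n}" "\<lambda>j g. cnj (\<phi> g j)" "v k"] \<phi> unfolding w_def by simp
  have form: "Re (sesq {..<n} E (\<phi> g) (\<phi> g)) = (\<Sum>k<n. (cmod (w k g))\<^sup>2)" for g
  proof -
    have "cmod (\<Sum>j<n. cnj (v k j) * \<phi> g j) = cmod (w k g)" for k
    proof -
      have "(\<Sum>j<n. cnj (v k j) * \<phi> g j) = cnj (w k g)" by (simp add: w_def)
      then show ?thesis by (metis complex_mod_cnj)
    qed
    then show ?thesis
      using sesq_rank_one_sum[of "{..<n}" E v "{..<n}" "\<phi> g"] v by simp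
  qed
  have "(\<Sum>h\<in>H. Re (sesq {..<n} E (\<phi> (a \<otimes> h)) (\<phi> (a \<otimes> h))))
    = (\<Sum>k<n. \<Sum>h\<in>H. (cmod (w k (a \<otimes> h)))\<^sup>2)"
    unfolding form by (rule sum.swap)
  also have "\<dots> \<le> (\<Sum>k<n. l * (\<Sum>g\<in>carrier G. (cmod (w k g))\<^sup>2))"
    by (intro sum_mono coset_mass_le w a)
  also have "\<dots> = l * (\<Sum>g\<in>carrier G. Re (sesq {..<n} E (\<phi> g) (\<phi> g)))"
    unfolding form sum_distrib_left[symmetric] by (subst sum.swap) simp
  finally show ?thesis .
qed

section \<open>Frame vectors and the optimal state\<close>

lemma K_mult_left:
  assumes "a \<in> carrier G" "x \<in> carrier G" "y \<in> carrier G"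
  shows "K (a \<otimes> x) (a \<otimes> y) = K x y"
proof -
  have "inv a \<otimes> (a \<otimes> x) = x" using assms by (simp add: m_assoc[symmetric])
  then show ?thesis using assms by (simp add: K_def inv_mult_group m_assoc)
qed

text \<open>Entry \<open>i * d + k\<close> is component \<open>i\<close> of \<open>\<pi>(y)\<close>
  applied to \<open>b k\<close>: the auxiliary register has dimension \<open>d\<close>, one basis
  vector for each vector of the Gram form of \<open>c\<close>.\<close>

definition V :: "'a \<Rightarrow> nat \<Rightarrow> complex" where
  "V y r = mv y (b (r mod d)) (r div d)"

lemma V_inner:
  assumes "y \<in> carrier G" "z \<in> carrier G"
  shows "(\<Sum>r<d*d. cnj (V y r) * V z r) = K y z"
proof -
  have "(\<Sum>r<d*d. cnj (V y r) * V z r) = (\<Sum>i<d. \<Sum>k<d. cnj (mv y (b k) i) * mv z (b k) i)"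
    unfolding V_def by (rule sum_div_mod[where F = "\<lambda>i k. cnj (mv y (b k) i) * mv z (b k) i"])
  also have "\<dots> = (\<Sum>k<d. coef (b k) (inv y \<otimes> z))"
    using assms by (subst sum.swap) (simp add: mv_inner)
  also have "\<dots> = c (inv (inv y \<otimes> z))"
    using assms unfolding coef_def mv_def
    by (subst c_gram) (auto simp: sum_distrib_left mult.assoc)
  also have "\<dots> = K y z" using assms by (simp add: K_def inv_mult_group)
  finally show ?thesis .
qed

lemma V_coeff: "matrix_coeff (\<lambda>y. \<Sum>r<d*d. cnj (V y r) * \<xi> r)"
proof -
  have "matrix_coeff (\<lambda>y. cnj (V y r))" if "r < d * d" for r
  proof -
    have "r div d < d" using that by (simp add: less_mult_imp_div_less)
    then show ?thesis
      unfolding V_def mv_def using matrix_coeff_sum[of "{..<d}" "\<lambda>j g. cnj (p g (r div d) j)"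
        "\<lambda>j. cnj (b (r mod d) j)"] by (simp add: matrix_coeff_cnj_entry mult.commute)
  qed
  then show ?thesis
    using matrix_coeff_sum[of "{..<d*d}" "\<lambda>r y. cnj (V y r)" \<xi>] by (simp add: mult.commute)
qed

text \<open>Bessel's inequality, although the vectors \<open>V y\<close> are not orthonormal. Their
  Gram matrix is the projection \<open>K\<close>, and the coefficients \<open>\<alpha>\<close> lie
  in its range by \<open>V_coeff\<close>. Hence \<open>\<eta>\<close> has the same coefficients as
  \<open>\<xi>\<close> and squared norm \<open>m\<close>, and the squared norm of
  \<open>\<eta> - \<xi>\<close> is that of \<open>\<xi>\<close> minus \<open>m\<close>.\<close>

lemma V_bessel:
  "(\<Sum>y\<in>carrier G. (cmod (\<Sum>r<d*d. cnj (V y r) * \<xi> r))\<^sup>2) \<le> (\<Sum>r<d*d. (cmod (\<xi> r))\<^sup>2)"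
proof -
  define \<alpha> where "\<alpha> y = (\<Sum>r<d*d. cnj (V y r) * \<xi> r)" for y
  define \<eta> where "\<eta> r = (\<Sum>y\<in>carrier G. \<alpha> y * V y r)" for r
  define m where "m = (\<Sum>y\<in>carrier G. (cmod (\<alpha> y))\<^sup>2)"
  have \<alpha>: "(\<Sum>z\<in>carrier G. K y z * \<alpha> z) = \<alpha> y" if "y \<in> carrier G" for y
    using K_reproduces[OF V_coeff that, of \<xi>] unfolding \<alpha>_def .
  have \<eta>: "(\<Sum>r<d*d. cnj (\<eta> r) * \<zeta> r) = (\<Sum>y\<in>carrier G. cnj (\<alpha> y) * (\<Sum>r<d*d. cnj (V y r) * \<zeta> r))" for \<zeta>
    unfolding \<eta>_def cnj_sum sum_distrib_right
    by (subst sum.swap) (simp add: sum_distrib_left mult_ac)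
  have 1: "(\<Sum>r<d*d. cnj (\<eta> r) * \<xi> r) = of_real m"
    unfolding \<eta> m_def of_real_sum cmod_square by (simp add: \<alpha>_def)
  have V\<eta>: "(\<Sum>r<d*d. cnj (V y r) * \<eta> r) = \<alpha> y" if y: "y \<in> carrier G" for y
  proof -
    have "(\<Sum>r<d*d. cnj (V y r) * \<eta> r) = (\<Sum>z\<in>carrier G. (\<Sum>r<d*d. cnj (V y r) * V z r) * \<alpha> z)"
      unfolding \<eta>_def sum_distrib_left by (subst sum.swap) (simp add: sum_distrib_left mult_ac)
    also have "\<dots> = \<alpha> y" using y \<alpha>[OF y] by (simp add: V_inner)
    finally show ?thesis .
  qed
  have "(\<Sum>r<d*d. cnj (\<eta> r) * \<eta> r) = (\<Sum>y\<in>carrier G. cnj (\<alpha> y) * \<alpha> y)"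
    unfolding \<eta> by (simp add: V\<eta>)
  then have "complex_of_real (\<Sum>r<d*d. (cmod (\<eta> r))\<^sup>2) = of_real m"
    unfolding m_def of_real_sum cmod_square .
  then have 2: "(\<Sum>r<d*d. (cmod (\<eta> r))\<^sup>2) = m" by (simp only: of_real_eq_iff)
  have "0 \<le> (\<Sum>r<d*d. (cmod (\<eta> r - \<xi> r))\<^sup>2)"
    by (intro sum_nonneg) auto
  also have "\<dots> = (\<Sum>r<d*d. (cmod (\<eta> r))\<^sup>2 - 2 * Re (cnj (\<eta> r) * \<xi> r) + (cmod (\<xi> r))\<^sup>2)"
    by (intro sum.cong refl) (simp add: cmod_power2, simp add: power2_eq_square algebra_simps)
  also have "\<dots> = (\<Sum>r<d*d. (cmod (\<eta> r))\<^sup>2) - 2 * Re (\<Sum>r<d*d. cnj (\<eta> r) * \<xi> r) + (\<Sum>r<d*d. (cmod (\<xi> r))\<^sup>2)"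
    by (simp only: sum.distrib sum_subtractf sum_distrib_left Re_sum)
  finally show ?thesis using 1 2 unfolding m_def \<alpha>_def by simp
qed

text \<open>Without the scalar, the squared norm of the sum would be the form of \<open>K\<close> at
  \<open>u\<close>, which is \<open>l\<close>; hence the division by \<open>sqrt l\<close>.\<close>

definition psi :: "'a \<Rightarrow> nat \<Rightarrow> complex" where
  "psi a r = (\<Sum>h\<in>H. u h / sqrt l * V (a \<otimes> h) r)"

text \<open>These are the amplitudes that the measurement sees on the coset of \<open>a\<close>.
  Their squared moduli add up to \<open>l\<close>, the success probability to be reached.\<close>

lemma V_psi:
  assumes a: "a \<in> carrier G" and h: "h \<in> H"
  shows "(\<Sum>r<d*d. cnj (V (a \<otimes> h) r) * psi a r) = sqrt l * u h"
proof -
  have "(\<Sum>r<d*d. cnj (V (a \<otimes> h) r) * psi a r)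
    = (\<Sum>k\<in>H. u k / sqrt l * (\<Sum>r<d*d. cnj (V (a \<otimes> h) r) * V (a \<otimes> k) r))"
    unfolding psi_def sum_distrib_left by (subst sum.swap) (simp add: mult_ac)
  also have "\<dots> = (\<Sum>k\<in>H. u k / sqrt l * K h k)"
    using a h HG by (intro sum.cong refl)
      (simp add: V_inner K_mult_left)
  also have "\<dots> = (\<Sum>k\<in>H. K h k * u k) / sqrt l"
    by (simp add: sum_divide_distrib mult.commute)
  also have "\<dots> = sqrt l * u h"
    using l_pos unfolding u_eigen[OF h]
    by (simp add: field_simps flip: of_real_mult)
  finally show ?thesis .
qed

lemma psi_norm: "(\<Sum>r<d*d. cnj (psi \<one> r) * psi \<one> r) = 1"
proof -
  have "(\<Sum>r<d*d. cnj (psi \<one> r) * \<zeta> r)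
    = (\<Sum>h\<in>H. cnj (u h / sqrt l) * (\<Sum>r<d*d. cnj (V (\<one> \<otimes> h) r) * \<zeta> r))" for \<zeta>
    unfolding psi_def cnj_sum sum_distrib_right
    by (subst sum.swap) (simp add: sum_distrib_left mult_ac)
  then have "(\<Sum>r<d*d. cnj (psi \<one> r) * psi \<one> r)
    = (\<Sum>h\<in>H. cnj (u h / sqrt l) * (\<Sum>r<d*d. cnj (V (\<one> \<otimes> h) r) * psi \<one> r))" .
  also have "\<dots> = (\<Sum>h\<in>H. cnj (u h) * u h)"
    using l_pos by (intro sum.cong refl) (simp only: V_psi[OF one_closed], simp)
  also have "\<dots> = of_real (\<Sum>h\<in>H. (cmod (u h))\<^sup>2)" unfolding of_real_sum cmod_square ..
  finally show ?thesis using u_norm by simp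
qed

lemma psi_act:
  assumes a: "a \<in> carrier G" and r: "r < d * d"
  shows "(\<Sum>l<d. p a (r div d) l * psi \<one> (l * d + r mod d)) = psi a r"
proof -
  have rd: "r div d < d" "r mod d < d" using r d_pos by (simp_all add: less_mult_imp_div_less)
  have "(\<Sum>l<d. p a (r div d) l * psi \<one> (l * d + r mod d))
    = (\<Sum>h\<in>H. u h / sqrt l * (\<Sum>l<d. p a (r div d) l * mv (\<one> \<otimes> h) (b (r mod d)) l))"
    unfolding psi_def sum_distrib_left V_def using rd
    by (subst sum.swap) (simp add: mult_ac)
  also have "\<dots> = psi a r"
    unfolding psi_def V_def using a rd HG by (intro sum.cong refl) (simp add: mv_mult)
  finally show ?thesis .
qed

end

section \<open>Translation of matrices and algorithms into forms\<close>

lemma cinner_mult_mat_vec: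
  assumes "M \<in> carrier_mat n n" "v \<in> carrier_vec n"
  shows "cinner n v (M *\<^sub>v v) = sesq {..<n} (\<lambda>i j. M $$ (i,j)) (vec_index v) (vec_index v)"
  unfolding cinner_def sesq_def using assms
  by (intro sum.cong refl) (simp add: scalar_prod_def atLeast0LessThan sum_distrib_left mult.assoc)

lemma psd_mat_imp_psd_on:
  assumes "psd_mat n E"
  shows "psd_on {..<n} (\<lambda>i j. E $$ (i,j))"
  unfolding psd_on_def
proof
  fix x :: "nat \<Rightarrow> complex"
  have E: "E \<in> carrier_mat n n" using assms by (simp add: psd_mat_def)
  let ?v = "Matrix.vec n x"
  have "sesq {..<n} (\<lambda>i j. E $$ (i,j)) x x = sesq {..<n} (\<lambda>i j. E $$ (i,j)) (vec_index ?v) (vec_index ?v)"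
    unfolding sesq_def by (intro sum.cong refl) simp
  also have "\<dots> = cinner n ?v (E *\<^sub>v ?v)"
    by (rule cinner_mult_mat_vec[symmetric]) (use E in auto)
  finally show "Im (sesq {..<n} (\<lambda>i j. E $$ (i,j)) x x) = 0 \<and> 0 \<le> Re (sesq {..<n} (\<lambda>i j. E $$ (i,j)) x x)"
    using assms unfolding psd_mat_def by simp
qed

lemma sesq_identity:
  assumes "finite A"
  shows "sesq A (\<lambda>i j. of_bool (i = j)) x y = (\<Sum>i\<in>A. cnj (x i) * y i)"
proof -
  have "sesq A (\<lambda>i j. of_bool (i = j)) x y = (\<Sum>i\<in>A. \<Sum>j\<in>A. if i = j then cnj (x i) * y i else 0)"
    unfolding sesq_def by (intro sum.cong refl) auto
  then show ?thesis using assms by simp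
qed

lemma sesq_sum_kernel:
  "sesq A (\<lambda>i j. \<Sum>s\<in>S. E s i j) x y = (\<Sum>s\<in>S. sesq A (E s) x y)"
proof -
  have "sesq A (\<lambda>i j. \<Sum>s\<in>S. E s i j) x y = (\<Sum>i\<in>A. \<Sum>j\<in>A. \<Sum>s\<in>S. cnj (x i) * E s i j * y j)"
    unfolding sesq_def by (simp add: sum_distrib_left sum_distrib_right)
  also have "\<dots> = (\<Sum>i\<in>A. \<Sum>s\<in>S. \<Sum>j\<in>A. cnj (x i) * E s i j * y j)"
    by (intro sum.cong refl sum.swap)
  also have "\<dots> = (\<Sum>s\<in>S. sesq A (E s) x y)"
    unfolding sesq_def by (rule sum.swap)
  finally show ?thesis .
qed

lemma sesq_add_kernel: "sesq A (\<lambda>i j. E i j + F i j) x y = sesq A E x y + sesq A F x y"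
  unfolding sesq_def sum.distrib[symmetric] by (intro sum.cong refl) (simp add: algebra_simps)

lemma sesq_diff_kernel: "sesq A (\<lambda>i j. E i j - F i j) x y = sesq A E x y - sesq A F x y"
  unfolding sesq_def sum_subtractf[symmetric] by (intro sum.cong refl) (simp add: algebra_simps)

lemma sesq_cong:
  "(\<And>i j. i \<in> A \<Longrightarrow> j \<in> A \<Longrightarrow> E i j = F i j) \<Longrightarrow> (\<And>i. i \<in> A \<Longrightarrow> x i = x' i) \<Longrightarrow> (\<And>i. i \<in> A \<Longrightarrow> y i = y' i)
    \<Longrightarrow> sesq A E x y = sesq A F x' y'"
  unfolding sesq_def by (intro sum.cong refl) simp

lemma unitary_mat_norm:
  assumes U: "unitary_mat n U" and v: "v \<in> carrier_vec n"
  shows "cinner n (U *\<^sub>v v) (U *\<^sub>v v) = cinner n v v"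
proof -
  have Uc: "U \<in> carrier_mat n n" and UU: "adj U * U = 1\<^sub>m n"
    using U by (auto simp: unitary_mat_def)
  have orth: "(\<Sum>i<n. cnj (U $$ (i,s)) * U $$ (i,t)) = of_bool (s = t)" if "s < n" "t < n" for s t
  proof -
    have "(adj U * U) $$ (s,t) = of_bool (s = t)" unfolding UU using that by simp
    then show ?thesis using Uc that by (simp add: adj_def scalar_prod_def atLeast0LessThan)
  qed
  have "cinner n (U *\<^sub>v v) (U *\<^sub>v v)
    = (\<Sum>i<n. \<Sum>s<n. \<Sum>t<n. cnj (vec_index v s) * (cnj (U $$ (i,s)) * U $$ (i,t)) * vec_index v t)"
  proof (unfold cinner_def, rule sum.cong[OF refl])
    fix i assume "i \<in> {..<n}"
    then have "vec_index (U *\<^sub>v v) i = (\<Sum>s<n. U $$ (i,s) * vec_index v s)"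
      using Uc v by (simp add: scalar_prod_def atLeast0LessThan)
    then show "cnj (vec_index (U *\<^sub>v v) i) * vec_index (U *\<^sub>v v) i
      = (\<Sum>s<n. \<Sum>t<n. cnj (vec_index v s) * (cnj (U $$ (i,s)) * U $$ (i,t)) * vec_index v t)"
      unfolding cnj_sum by (simp only: sum_product cnj_sum) (simp add: mult_ac)
  qed
  also have "\<dots> = (\<Sum>s<n. \<Sum>i<n. \<Sum>t<n. cnj (vec_index v s) * (cnj (U $$ (i,s)) * U $$ (i,t)) * vec_index v t)"
    by (rule sum.swap)
  also have "\<dots> = (\<Sum>s<n. \<Sum>t<n. \<Sum>i<n. cnj (vec_index v s) * (cnj (U $$ (i,s)) * U $$ (i,t)) * vec_index v t)"
    by (intro sum.cong refl sum.swap)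
  also have "\<dots> = sesq {..<n} (\<lambda>s t. of_bool (s = t)) (vec_index v) (vec_index v)"
    unfolding sesq_def sum_distrib_left[symmetric] sum_distrib_right[symmetric]
    by (intro sum.cong refl) (simp add: orth)
  also have "\<dots> = cinner n v v" by (simp add: sesq_identity cinner_def)
  finally show ?thesis .
qed

lemma kron_id_mult_vec:
  assumes v: "v \<in> carrier_vec (d*N)" and r: "r < d * N"
  shows "vec_index (kron_id d N A *\<^sub>v v) r = (\<Sum>l<d. A $$ (r div N, l) * vec_index v (l * N + r mod N))"
proof -
  have N: "N > 0" using r by (cases N) auto
  have "vec_index (kron_id d N A *\<^sub>v v) r
    = (\<Sum>t<d*N. (if r mod N = t mod N then A $$ (r div N, t div N) else 0) * vec_index v (t div N * N + t mod N))"
    using v r by (simp add: kron_id_def scalar_prod_def atLeast0LessThan)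
  also have "\<dots> = (\<Sum>l<d. \<Sum>k<N. (if r mod N = k then A $$ (r div N, l) else 0) * vec_index v (l * N + k))"
    by (rule sum_div_mod)
  also have "\<dots> = (\<Sum>l<d. \<Sum>k<N. if r mod N = k then A $$ (r div N, l) * vec_index v (l * N + k) else 0)"
    by (intro sum.cong refl) auto
  also have "\<dots> = (\<Sum>l<d. A $$ (r div N, l) * vec_index v (l * N + r mod N))"
    using N by simp
  finally show ?thesis .
qed

context unitary_matrix_rep
begin

lemma kron_id_norm:
  assumes p: "\<And>g i j. g \<in> carrier G \<Longrightarrow> p g i j = \<pi> g $$ (i,j)"
    and v: "v \<in> carrier_vec (d*N)" and a: "a \<in> carrier G"
  shows "cinner (d*N) (kron_id d N (\<pi> a) *\<^sub>v v) (kron_id d N (\<pi> a) *\<^sub>v v) = cinner (d*N) v v"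
proof -
  define s where "s k i = vec_index v (i * N + k)" for k i
  have "cinner (d*N) (kron_id d N (\<pi> a) *\<^sub>v v) (kron_id d N (\<pi> a) *\<^sub>v v)
    = (\<Sum>r<d*N. cnj (mv a (s (r mod N)) (r div N)) * mv a (s (r mod N)) (r div N))"
    unfolding cinner_def using a by (intro sum.cong refl) (simp add: kron_id_mult_vec[OF v] mv_def s_def p)
  also have "\<dots> = (\<Sum>i<d. \<Sum>k<N. cnj (mv a (s k) i) * mv a (s k) i)"
    by (rule sum_div_mod)
  also have "\<dots> = (\<Sum>i<d. \<Sum>k<N. cnj (s k i) * s k i)"
  proof (subst (1 2) sum.swap, rule sum.cong[OF refl])
    fix k
    have "(\<Sum>i<d. cnj (mv a (s k) i) * mv a (s k) i) = (\<Sum>i<d. cnj (mv \<one> (s k) i) * mv \<one> (s k) i)"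
      using a by (simp add: mv_inner)
    then show "(\<Sum>i<d. cnj (mv a (s k) i) * mv a (s k) i) = (\<Sum>i<d. cnj (s k i) * s k i)"
      by (simp add: mv_one)
  qed
  also have "\<dots> = (\<Sum>r<d*N. cnj (s (r mod N) (r div N)) * s (r mod N) (r div N))"
    by (rule sum_div_mod[symmetric])
  also have "\<dots> = cinner (d*N) v v"
    unfolding cinner_def s_def by (simp add: mult.commute)
  finally show ?thesis .
qed

text \<open>Whatever the input state and the unitary, \<open>g\<close> enters the final amplitudes
  only linearly, through the entries of \<open>\<pi> g\<close>. Besides its norm, this is all that
  the upper bound uses of the final state.\<close>

lemma algorithm_state_coeff:
  assumes p: "\<And>g i j. g \<in> carrier G \<Longrightarrow> p g i j = \<pi> g $$ (i,j)"
    and v: "v \<in> carrier_vec (d*N)" and U: "U \<in> carrier_mat (d*N) (d*N)" and r: "r < d*N"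
  shows "matrix_coeff (\<lambda>g. cnj (vec_index (U *\<^sub>v (kron_id d N (\<pi> g) *\<^sub>v v)) r))"
proof -
  have row: "matrix_coeff (\<lambda>g. \<Sum>l<d. cnj (vec_index v (l * N + s mod N)) * cnj (p g (s div N) l))" if "s < d*N" for s
    using that by (intro matrix_coeff_sum matrix_coeff_cnj_entry) (auto simp: less_mult_imp_div_less)
  have "matrix_coeff (\<lambda>g. \<Sum>s<d*N. cnj (U $$ (r,s)) *
      (\<Sum>l<d. cnj (vec_index v (l * N + s mod N)) * cnj (p g (s div N) l)))"
    by (rule matrix_coeff_sum[OF row]) simp
  moreover have "(\<Sum>s<d*N. cnj (U $$ (r,s)) * (\<Sum>l<d. cnj (vec_index v (l * N + s mod N)) * cnj (p g (s div N) l)))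
      = cnj (vec_index (U *\<^sub>v (kron_id d N (\<pi> g) *\<^sub>v v)) r)" if g: "g \<in> carrier G" for g
  proof -
    have "vec_index (U *\<^sub>v (kron_id d N (\<pi> g) *\<^sub>v v)) r
      = (\<Sum>s<d*N. U $$ (r,s) * vec_index (kron_id d N (\<pi> g) *\<^sub>v v) s)"
      using U v r by (simp add: scalar_prod_def atLeast0LessThan kron_id_def)
    also have "\<dots> = (\<Sum>s<d*N. U $$ (r,s) * (\<Sum>l<d. p g (s div N) l * vec_index v (l * N + s mod N)))"
      using g by (intro sum.cong refl) (simp add: kron_id_mult_vec[OF v] p)
    finally show ?thesis by (simp add: mult.commute)
  qed
  ultimately show ?thesis unfolding matrix_coeff_def by simp
qed

end

context coset_rep
begin

lemma sum_fibre:
  assumes fibre: "\<And>g h. g \<in> carrier G \<Longrightarrow> h \<in> carrier G \<Longrightarrow> f g = f h \<longleftrightarrow> inv g \<otimes> h \<in> H"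
    and a: "a \<in> carrier G"
  shows "(\<Sum>g\<in>{g\<in>carrier G. f g = f a}. F g) = (\<Sum>h\<in>H. F (a \<otimes> h))"
proof (rule sum.reindex_bij_witness[of _ "\<lambda>h. a \<otimes> h" "\<lambda>g. inv a \<otimes> g"])
  fix g assume "g \<in> {g\<in>carrier G. f g = f a}"
  then have g: "g \<in> carrier G" "f a = f g" by auto
  then show "inv a \<otimes> g \<in> H" using fibre[OF a] by blast
  show "a \<otimes> (inv a \<otimes> g) = g" "F (a \<otimes> (inv a \<otimes> g)) = F g"
    using a g by (simp_all add: m_assoc[symmetric])
next
  fix h assume h: "h \<in> H"
  then show 1: "inv a \<otimes> (a \<otimes> h) = h" using a HG by (simp add: m_assoc[symmetric])
  then have "f a = f (a \<otimes> h)" using fibre[OF a, of "a \<otimes> h"] a h HG by simp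
  then show "a \<otimes> h \<in> {g\<in>carrier G. f g = f a}" using a h HG by simp
qed

lemma success_prob_le:
  assumes p: "\<And>g i j. g \<in> carrier G \<Longrightarrow> p g i j = \<pi> g $$ (i,j)"
    and fibre: "\<And>g h. g \<in> carrier G \<Longrightarrow> h \<in> carrier G \<Longrightarrow> f g = f h \<longleftrightarrow> inv g \<otimes> h \<in> H"
    and X: "f ` carrier G = X" and alg: "is_algorithm d X N \<psi> U E"
  shows "success_prob G d \<pi> f N \<psi> U E \<le> l"
proof -
  let ?n = "d * N"
  define \<phi> where "\<phi> a = vec_index (U *\<^sub>v (kron_id d N (\<pi> a) *\<^sub>v \<psi>))" for a
  define S where "S x a = sesq {..<?n} (\<lambda>i j. E x $$ (i,j)) (\<phi> a) (\<phi> a)" for x a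
  have \<psi>: "\<psi> \<in> carrier_vec ?n" "cinner ?n \<psi> \<psi> = 1" and U: "unitary_mat ?n U" and E: "povm ?n X E"
    using alg unfolding is_algorithm_def by auto
  have Uc: "U \<in> carrier_mat ?n ?n" using U by (simp add: unitary_mat_def)
  have kc: "kron_id d N (\<pi> a) *\<^sub>v \<psi> \<in> carrier_vec ?n" for a by (simp add: kron_id_def mult_mat_vec_def)
  have psd: "psd_mat ?n (E x)" if "x \<in> X" for x using E that by (simp add: povm_def)
  have coeff: "matrix_coeff (\<lambda>g. cnj (\<phi> g i))" if "i < ?n" for i
    unfolding \<phi>_def by (rule algorithm_state_coeff[OF p \<psi>(1) Uc that])
  have norm: "(\<Sum>i<?n. cnj (\<phi> a i) * \<phi> a i) = 1" if "a \<in> carrier G" for a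
    using unitary_mat_norm[OF U kc] kron_id_norm[OF p \<psi>(1) that] \<psi>(2)
    unfolding cinner_def \<phi>_def by simp
  have finX: "finite X" using X fin by blast
  have total: "(\<Sum>x\<in>X. S x a) = 1" if "a \<in> carrier G" for a
  proof -
    have "(\<Sum>x\<in>X. S x a) = sesq {..<?n} (\<lambda>i j. of_bool (i = j)) (\<phi> a) (\<phi> a)"
      unfolding S_def sesq_sum_kernel[symmetric]
      using E by (intro sesq_cong) (auto simp: povm_def)
    then show ?thesis using norm[OF that] by (simp add: sesq_identity)
  qed
  have "success_prob G d \<pi> f N \<psi> U E = 1 / card (carrier G) * (\<Sum>a\<in>carrier G. Re (S (f a) a))"
  proof -
    have "cinner ?n (U *\<^sub>v (kron_id d N (\<pi> a) *\<^sub>v \<psi>)) (E (f a) *\<^sub>v (U *\<^sub>v (kron_id d N (\<pi> a) *\<^sub>v \<psi>))) = S (f a) a"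
      if "a \<in> carrier G" for a
      unfolding S_def \<phi>_def
      by (rule cinner_mult_mat_vec) (use psd[of "f a"] that X Uc kc in \<open>auto simp: psd_mat_def\<close>)
    then show ?thesis unfolding success_prob_def Let_def by simp
  qed
  also have "(\<Sum>a\<in>carrier G. Re (S (f a) a)) = (\<Sum>x\<in>X. \<Sum>a\<in>{a\<in>carrier G. f a = x}. Re (S x a))"
    using sum.image_gen[OF fin, of "\<lambda>a. Re (S (f a) a)" f] X by simp
  also have "\<dots> \<le> (\<Sum>x\<in>X. l * (\<Sum>g\<in>carrier G. Re (S x g)))"
  proof (rule sum_mono)
    fix x assume x: "x \<in> X"
    then obtain a where a: "a \<in> carrier G" "f a = x" using X by blast
    have "(\<Sum>g\<in>{g\<in>carrier G. f g = f a}. Re (S x g)) = (\<Sum>h\<in>H. Re (S x (a \<otimes> h)))"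
      by (rule sum_fibre[OF fibre a(1)])
    also have "\<dots> \<le> l * (\<Sum>g\<in>carrier G. Re (S x g))"
      unfolding S_def by (rule coset_form_le[OF psd_mat_imp_psd_on[OF psd[OF x]] a(1) coeff])
    finally show "(\<Sum>g\<in>{g\<in>carrier G. f g = x}. Re (S x g)) \<le> l * (\<Sum>g\<in>carrier G. Re (S x g))"
      using a(2) by simp
  qed
  \<comment> \<open>Summed over all outcomes the measurement operators give the identity, so each
    group element contributes the norm of its state, namely 1, and the total cancels the average
    over \<open>G\<close>.\<close>
  also have "(\<Sum>x\<in>X. l * (\<Sum>g\<in>carrier G. Re (S x g))) = l * (\<Sum>g\<in>carrier G. Re (\<Sum>x\<in>X. S x g))"
    unfolding sum_distrib_left[symmetric] Re_sum by (subst sum.swap) simp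
  also have "\<dots> = l * card (carrier G)" using total by simp
  finally show ?thesis using card_pos by (simp add: field_simps)
qed

lemma ex_algorithm_ge:
  assumes p: "\<And>g i j. g \<in> carrier G \<Longrightarrow> p g i j = \<pi> g $$ (i,j)"
    and fibre: "\<And>g h. g \<in> carrier G \<Longrightarrow> h \<in> carrier G \<Longrightarrow> f g = f h \<longleftrightarrow> inv g \<otimes> h \<in> H"
    and X: "f ` carrier G = X"
  shows "\<exists>N \<psi> U E. is_algorithm d X N \<psi> U E \<and> l \<le> success_prob G d \<pi> f N \<psi> U E"
proof -
  let ?n = "d * d"
  let ?I = "\<lambda>\<xi> y. (cmod (\<Sum>r<?n. cnj (V y r) * \<xi> r))\<^sup>2"
  let ?F = "\<lambda>x. {y\<in>carrier G. f y = x}"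
  define B where "B S i j = (\<Sum>y\<in>S. V y i * cnj (V y j))" for S i j
  \<comment> \<open>The operators of the fibres add up to \<open>B (carrier G)\<close>, which is at
    most the identity by \<open>V_bessel\<close>. Giving the remainder to the outcome
    \<open>f \<one>\<close> completes them to a POVM and can only raise the success
    probability.\<close>
  define e where "e x i j = B (?F x) i j + (if x = f \<one> then of_bool (i = j) - B (carrier G) i j else 0)" for x i j
  define E where "E x = Matrix.mat ?n ?n (\<lambda>(i,j). e x i j)" for x
  define \<psi> where "\<psi> = Matrix.vec ?n (psi \<one>)"
  define q where "q x \<xi> = (\<Sum>y\<in>?F x. ?I \<xi> y) + (if x = f \<one> then (\<Sum>r<?n. (cmod (\<xi> r))\<^sup>2) - (\<Sum>y\<in>carrier G. ?I \<xi> y) else 0)" for x \<xi>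
  have B: "sesq {..<?n} (B S) \<xi> \<xi> = of_real (\<Sum>y\<in>S. ?I \<xi> y)" for S \<xi>
    by (rule sesq_rank_one_sum) (simp add: B_def)
  have form: "sesq {..<?n} (e x) \<xi> \<xi> = of_real (q x \<xi>)" for x \<xi>
  proof (cases "x = f \<one>")
    case True
    have "(\<Sum>r<?n. cnj (\<xi> r) * \<xi> r) = of_real (\<Sum>r<?n. (cmod (\<xi> r))\<^sup>2)"
      unfolding of_real_sum cmod_square ..
    moreover have "sesq {..<?n} (e x) \<xi> \<xi> = sesq {..<?n} (\<lambda>i j. B (?F x) i j + (of_bool (i = j) - B (carrier G) i j)) \<xi> \<xi>"
      unfolding e_def using True by simp
    ultimately show ?thesis
      unfolding sesq_add_kernel sesq_diff_kernel B q_def using True by (simp add: sesq_identity)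
  next
    case False
    then show ?thesis unfolding e_def q_def using B by simp
  qed
  have q: "q x \<xi> \<ge> (\<Sum>y\<in>?F x. ?I \<xi> y)" for x \<xi>
    unfolding q_def using V_bessel[of \<xi>] by simp
  have q0: "q x \<xi> \<ge> 0" for x \<xi>
    by (rule order_trans[OF _ q]) (intro sum_nonneg, simp)
  have E_inner: "cinner ?n v (E x *\<^sub>v v) = of_real (q x (vec_index v))" if "v \<in> carrier_vec ?n" for v x
  proof -
    have "cinner ?n v (E x *\<^sub>v v) = sesq {..<?n} (\<lambda>i j. E x $$ (i,j)) (vec_index v) (vec_index v)"
      by (rule cinner_mult_mat_vec[OF _ that]) (simp add: E_def)
    also have "\<dots> = sesq {..<?n} (e x) (vec_index v) (vec_index v)"
      by (rule sesq_cong) (auto simp: E_def)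
    finally show ?thesis unfolding form .
  qed
  have psd: "psd_mat ?n (E x)" for x
    unfolding psd_mat_def using E_inner q0 by (simp add: E_def)
  have finX: "finite X" using X fin by blast
  have "(\<Sum>x\<in>X. E x $$ (i,j)) = 1\<^sub>m ?n $$ (i,j)" if "i < ?n" "j < ?n" for i j
  proof -
    have "(\<Sum>x\<in>X. E x $$ (i,j)) = (\<Sum>x\<in>X. B (?F x) i j)
      + (\<Sum>x\<in>X. if x = f \<one> then of_bool (i = j) - B (carrier G) i j else 0)"
      unfolding E_def e_def using that by (simp add: sum.distrib)
    also have "(\<Sum>x\<in>X. B (?F x) i j) = B (carrier G) i j"
      unfolding B_def using sum.image_gen[OF fin, of "\<lambda>y. V y i * cnj (V y j)" f] X by simp
    also have "(\<Sum>x\<in>X. if x = f \<one> then of_bool (i = j) - B (carrier G) i j else 0) = of_bool (i = j) - B (carrier G) i j"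
      using finX X by auto
    finally show ?thesis using that by simp
  qed
  then have povm: "povm ?n X E" unfolding povm_def using psd by blast
  have "cinner ?n \<psi> \<psi> = 1"
    using psi_norm unfolding cinner_def \<psi>_def by simp
  moreover have "unitary_mat ?n (1\<^sub>m ?n)"
  proof -
    have "adj (1\<^sub>m ?n) = 1\<^sub>m ?n" by (rule eq_matI) (auto simp: adj_def)
    then show ?thesis by (simp add: unitary_mat_def)
  qed
  \<comment> \<open>The register has dimension \<open>d\<close>, and the identity serves as the
    unitary because \<open>\<pi>(a)\<close> already carries \<open>psi \<one>\<close> to
    \<open>psi a\<close>.\<close>
  ultimately have alg: "is_algorithm d X d \<psi> (1\<^sub>m ?n) E"
    using povm d_pos unfolding is_algorithm_def by (simp add: \<psi>_def)
  have "l \<le> Re (cinner ?n (1\<^sub>m ?n *\<^sub>v (kron_id d d (\<pi> a) *\<^sub>v \<psi>)) (E (f a) *\<^sub>v (1\<^sub>m ?n *\<^sub>v (kron_id d d (\<pi> a) *\<^sub>v \<psi>))))"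
    if a: "a \<in> carrier G" for a
  proof -
    define v where "v = 1\<^sub>m ?n *\<^sub>v (kron_id d d (\<pi> a) *\<^sub>v \<psi>)"
    have kc: "kron_id d d (\<pi> a) *\<^sub>v \<psi> \<in> carrier_vec ?n" by (simp add: kron_id_def mult_mat_vec_def)
    have vc: "v \<in> carrier_vec ?n" unfolding v_def using kc by simp
    have v: "vec_index v r = psi a r" if r: "r < ?n" for r
    proof -
      have "vec_index v r = (\<Sum>l<d. \<pi> a $$ (r div d, l) * vec_index \<psi> (l * d + r mod d))"
        unfolding v_def one_mult_mat_vec[OF kc] by (rule kron_id_mult_vec[OF _ r]) (simp add: \<psi>_def)
      also have "\<dots> = (\<Sum>l<d. p a (r div d) l * psi \<one> (l * d + r mod d))"
      proof (intro sum.cong refl)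
        fix l assume l: "l \<in> {..<d}"
        have "l * d + r mod d < Suc l * d" using d_pos by simp
        also have "\<dots> \<le> ?n" using l by (intro mult_le_mono1) simp
        finally show "\<pi> a $$ (r div d, l) * vec_index \<psi> (l * d + r mod d)
          = p a (r div d) l * psi \<one> (l * d + r mod d)"
          using p[OF a] by (simp add: \<psi>_def)
      qed
      also have "\<dots> = psi a r" by (rule psi_act[OF a r])
      finally show ?thesis .
    qed
    have "(\<Sum>y\<in>?F (f a). ?I (vec_index v) y) = (\<Sum>h\<in>H. ?I (vec_index v) (a \<otimes> h))"
      by (rule sum_fibre[OF fibre a])
    also have "\<dots> = (\<Sum>h\<in>H. l * (cmod (u h))\<^sup>2)"
    proof (intro sum.cong refl)
      fix h assume h: "h \<in> H"
      have "(\<Sum>r<?n. cnj (V (a \<otimes> h) r) * vec_index v r) = sqrt l * u h"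
        using V_psi[OF a h] by (simp add: v)
      then show "?I (vec_index v) (a \<otimes> h) = l * (cmod (u h))\<^sup>2"
        using l_pos by (simp add: norm_mult power_mult_distrib)
    qed
    also have "\<dots> = l" using u_norm by (simp flip: sum_distrib_left)
    finally have "l \<le> q (f a) (vec_index v)" using q[where x = "f a" and \<xi> = "vec_index v"] by simp
    then show ?thesis using E_inner[where x = "f a", OF vc] unfolding v_def by simp
  qed
  then have "(\<Sum>a\<in>carrier G. l) \<le> (\<Sum>a\<in>carrier G. Re (cinner ?n (1\<^sub>m ?n *\<^sub>v (kron_id d d (\<pi> a) *\<^sub>v \<psi>))
      (E (f a) *\<^sub>v (1\<^sub>m ?n *\<^sub>v (kron_id d d (\<pi> a) *\<^sub>v \<psi>)))))"
    by (rule sum_mono)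
  then have "l \<le> success_prob G d \<pi> f d \<psi> (1\<^sub>m ?n) E"
    using card_pos unfolding success_prob_def Let_def by (simp add: field_simps)
  then show ?thesis using alg by blast
qed

end

section \<open>Isotypic projections and induced representations\<close>

lemma is_repD:
  assumes "is_rep G S \<rho>"
  shows "vsubspace S" "fin_dim S" "\<And>g. g \<in> carrier G \<Longrightarrow> lin_on S (\<rho> g)"
    "\<And>g x. g \<in> carrier G \<Longrightarrow> x \<in> S \<Longrightarrow> \<rho> g x \<in> S" "\<And>x. x \<in> S \<Longrightarrow> \<rho> \<one>\<^bsub>G\<^esub> x = x"
    "\<And>g h x. g \<in> carrier G \<Longrightarrow> h \<in> carrier G \<Longrightarrow> x \<in> S \<Longrightarrow> \<rho> (g \<otimes>\<^bsub>G\<^esub> h) x = \<rho> g (\<rho> h x)"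
  using assms unfolding is_rep_def by auto

lemma invariant_subD:
  assumes "invariant_sub G S \<rho> W"
  shows "vsubspace W" "W \<subseteq> S" "\<And>g x. g \<in> carrier G \<Longrightarrow> x \<in> W \<Longrightarrow> \<rho> g x \<in> W"
  using assms unfolding invariant_sub_def by auto

lemma vsubspace_kernel:
  assumes "vsubspace A" "lin_on A T"
  shows "vsubspace {x \<in> A. T x = vzero}"
  unfolding vsubspace_def
proof (intro conjI allI ballI)
  show "vzero \<in> {x \<in> A. T x = vzero}"
    using vsubspace_zero[OF assms(1)] lin_on_zero[OF assms(2,1)] by simp
next
  fix x y assume "x \<in> {x \<in> A. T x = vzero}" "y \<in> {x \<in> A. T x = vzero}"
  then show "(\<lambda>i. x i + y i) \<in> {x \<in> A. T x = vzero}"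
    using vsubspace_add[OF assms(1)] lin_on_add[OF assms(2), of x y] by (simp add: vzero_def)
next
  fix c x assume "x \<in> {x \<in> A. T x = vzero}"
  then show "(\<lambda>i. c * x i) \<in> {x \<in> A. T x = vzero}"
    using vsubspace_scale[OF assms(1)] lin_on_scale[OF assms(2), of x] by (simp add: vzero_def)
qed

lemma vsubspace_eigenspace:
  assumes "vsubspace A" "lin_on A T"
  shows "vsubspace {x \<in> A. T x = (\<lambda>i. k * x i)}"
  unfolding vsubspace_def
proof (intro conjI allI ballI)
  show "vzero \<in> {x \<in> A. T x = (\<lambda>i. k * x i)}"
    using vsubspace_zero[OF assms(1)] lin_on_zero[OF assms(2,1)] by (simp add: vzero_def)
next
  fix x y assume "x \<in> {x \<in> A. T x = (\<lambda>i. k * x i)}" "y \<in> {x \<in> A. T x = (\<lambda>i. k * x i)}"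
  then show "(\<lambda>i. x i + y i) \<in> {x \<in> A. T x = (\<lambda>i. k * x i)}"
    using vsubspace_add[OF assms(1)] lin_on_add[OF assms(2), of x y] by (simp add: distrib_left)
next
  fix c x assume "x \<in> {x \<in> A. T x = (\<lambda>i. k * x i)}"
  then show "(\<lambda>i. c * x i) \<in> {x \<in> A. T x = (\<lambda>i. k * x i)}"
    using vsubspace_scale[OF assms(1)] lin_on_scale[OF assms(2), of x] by (simp add: mult.left_commute)
qed

lemma lin_on_inj:
  assumes "lin_on A T" "vsubspace A" "\<And>x. x \<in> A \<Longrightarrow> T x = vzero \<Longrightarrow> x = vzero"
  shows "inj_on T A"
proof (rule inj_onI)
  fix x y assume xy: "x \<in> A" "y \<in> A" "T x = T y"
  have y: "(\<lambda>i. (-1) * y i) \<in> A" using vsubspace_scale[OF assms(2) xy(2)] .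
  have "T (\<lambda>i. x i + (-1) * y i) = (\<lambda>j. T x j + (-1) * T y j)"
    using lin_on_add[OF assms(1) xy(1) y] lin_on_scale[OF assms(1) xy(2), of "-1"] by simp
  then have "T (\<lambda>i. x i + (-1) * y i) = vzero" using xy(3) by (simp add: vzero_def)
  then have "(\<lambda>i. x i + (-1) * y i) = vzero"
    using assms(3) vsubspace_add[OF assms(2) xy(1) y] by blast
  then have "x i + (-1) * y i = 0" for i by (metis vzero_def)
  then show "x = y" by (simp add: fun_eq_iff)
qed

section \<open>The action of the central idempotent on representations\<close>

context reproducing_rep
begin

text \<open>Two choices of \<open>D\<close> matter. Over \<open>carrier G\<close> this is the
  isotypic projection; over \<open>H\<close> it still commutes with the action but is in general not
  idempotent, and its scalars are the ratios of dimensions sought.\<close>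

definition avg :: "'a set \<Rightarrow> ('a \<Rightarrow> ('i \<Rightarrow> complex) \<Rightarrow> ('i \<Rightarrow> complex)) \<Rightarrow> ('i \<Rightarrow> complex) \<Rightarrow> ('i \<Rightarrow> complex)" where
  "avg D \<alpha> x = (\<lambda>i. \<Sum>g\<in>D. c g * \<alpha> g x i)"

lemma avg_closed:
  assumes "vsubspace W" "\<And>g. g \<in> D \<Longrightarrow> \<alpha> g x \<in> W"
  shows "avg D \<alpha> x \<in> W"
  unfolding avg_def by (rule vsubspace_sum[OF assms])

lemma lin_on_avg:
  assumes "\<And>g. g \<in> D \<Longrightarrow> lin_on A (\<alpha> g)"
  shows "lin_on A (avg D \<alpha>)"
  unfolding lin_on_def
proof (intro conjI allI ballI)
  fix x y assume xy: "x \<in> A" "y \<in> A"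
  show "avg D \<alpha> (\<lambda>i. x i + y i) = (\<lambda>j. avg D \<alpha> x j + avg D \<alpha> y j)"
    unfolding avg_def sum.distrib[symmetric]
    by (intro ext sum.cong refl) (simp add: lin_on_add[OF assms xy] distrib_left)
next
  fix k x assume x: "x \<in> A"
  show "avg D \<alpha> (\<lambda>i. k * x i) = (\<lambda>j. k * avg D \<alpha> x j)"
    unfolding avg_def sum_distrib_left
    by (intro ext sum.cong refl) (simp add: lin_on_scale[OF assms x] mult.left_commute)
qed

text \<open>Since \<open>c\<close> is invariant under conjugation by \<open>G\<close>, its
  restriction to any subgroup is a class function there.\<close>

lemma avg_commute:
  assumes D: "subgroup D G" and rep: "is_rep (G\<lparr>carrier := D\<rparr>) A \<alpha>" and h: "h \<in> D" and x: "x \<in> A"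
  shows "\<alpha> h (avg D \<alpha> x) = avg D \<alpha> (\<alpha> h x)"
proof -
  note rep = is_repD[OF rep, simplified]
  note DG = subgroup.mem_carrier[OF D] and Dm = subgroup.m_closed[OF D] and Di = subgroup.m_inv_closed[OF D]
  have "\<alpha> h (avg D \<alpha> x) = (\<lambda>i. \<Sum>g\<in>D. c g * \<alpha> h (\<alpha> g x) i)"
    unfolding avg_def using rep(4) x by (intro lin_on_sum[OF rep(3)[OF h] rep(1)])
  also have "\<dots> = (\<lambda>i. \<Sum>g\<in>D. c g * \<alpha> (h \<otimes> g) x i)"
    using h x by (intro ext sum.cong refl) (simp add: rep(6))
  also have "\<dots> = (\<lambda>i. \<Sum>g\<in>D. c (inv h \<otimes> g) * \<alpha> (h \<otimes> (inv h \<otimes> g)) x i)"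
    using sum_mult_left[OF D Di[OF h], of "\<lambda>g. c g * \<alpha> (h \<otimes> g) x i" for i] by simp
  also have "\<dots> = (\<lambda>i. \<Sum>g\<in>D. c (inv h \<otimes> g) * \<alpha> g x i)"
    using DG h by (intro ext sum.cong refl) (simp add: m_assoc[symmetric])
  also have "\<dots> = (\<lambda>i. \<Sum>g\<in>D. c (inv h \<otimes> (g \<otimes> h)) * \<alpha> (g \<otimes> h) x i)"
    using sum_mult_right[OF D h, of "\<lambda>g. c (inv h \<otimes> g) * \<alpha> g x i" for i] by simp
  also have "\<dots> = avg D \<alpha> (\<alpha> h x)"
    unfolding avg_def
  proof (intro ext sum.cong refl)
    fix i g assume g: "g \<in> D"
    have "c (inv h \<otimes> (g \<otimes> h)) = c (g \<otimes> h \<otimes> inv h)"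
      using g h DG by (intro c_commute) auto
    also have "g \<otimes> h \<otimes> inv h = g" using g h DG by (simp add: m_assoc)
    finally show "c (inv h \<otimes> (g \<otimes> h)) * \<alpha> (g \<otimes> h) x i = c g * \<alpha> g (\<alpha> h x) i"
      using g h x by (simp add: rep(6))
  qed
  finally show ?thesis .
qed

text \<open>Averaging twice is averaging with the convolution of \<open>c\<close> with itself, which
  is \<open>c\<close> by \<open>conv_coeff\<close>.\<close>

lemma avg_idem:
  assumes rep: "is_rep G A \<alpha>" and x: "x \<in> A"
  shows "avg (carrier G) \<alpha> (avg (carrier G) \<alpha> x) = avg (carrier G) \<alpha> x"
proof
  fix i
  note rep = is_repD[OF rep]
  have "avg (carrier G) \<alpha> (avg (carrier G) \<alpha> x) i = (\<Sum>g\<in>carrier G. \<Sum>h\<in>carrier G. c g * (c h * \<alpha> (g \<otimes> h) x i))"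
    unfolding avg_def
  proof (rule sum.cong[OF refl])
    fix g assume g: "g \<in> carrier G"
    have "\<alpha> g (\<lambda>i. \<Sum>h\<in>carrier G. c h * \<alpha> h x i) = (\<lambda>i. \<Sum>h\<in>carrier G. c h * \<alpha> g (\<alpha> h x) i)"
      using rep(4) x by (intro lin_on_sum[OF rep(3)[OF g] rep(1)])
    then show "c g * \<alpha> g (\<lambda>i. \<Sum>h\<in>carrier G. c h * \<alpha> h x i) i = (\<Sum>h\<in>carrier G. c g * (c h * \<alpha> (g \<otimes> h) x i))"
      using g x by (simp add: rep(6) sum_distrib_left)
  qed
  also have "\<dots> = (\<Sum>g\<in>carrier G. \<Sum>y\<in>carrier G. c g * (c (inv g \<otimes> y) * \<alpha> y x i))"
  proof (rule sum.cong[OF refl])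
    fix g assume g: "g \<in> carrier G"
    have "(\<Sum>h\<in>carrier G. c g * (c h * \<alpha> (g \<otimes> h) x i))
      = (\<Sum>y\<in>carrier G. c g * (c (inv g \<otimes> y) * \<alpha> (g \<otimes> (inv g \<otimes> y)) x i))"
      using sum_left[of "inv g" "\<lambda>h. c g * (c h * \<alpha> (g \<otimes> h) x i)"] g by simp
    then show "(\<Sum>h\<in>carrier G. c g * (c h * \<alpha> (g \<otimes> h) x i))
      = (\<Sum>y\<in>carrier G. c g * (c (inv g \<otimes> y) * \<alpha> y x i))"
      using g by (simp add: m_assoc[symmetric])
  qed
  also have "\<dots> = (\<Sum>y\<in>carrier G. (\<Sum>g\<in>carrier G. c g * c (inv g \<otimes> y)) * \<alpha> y x i)"
    by (subst sum.swap) (simp add: sum_distrib_right mult.assoc)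
  also have "\<dots> = avg (carrier G) \<alpha> x i"
    unfolding avg_def by (intro sum.cong refl) (simp add: conv_coeff[OF c_coeff])
  finally show "avg (carrier G) \<alpha> (avg (carrier G) \<alpha> x) i = avg (carrier G) \<alpha> x i" .
qed

text \<open>An embedding is sought among the intertwiners \<open>u \<mapsto> \<Sum>\<^sub>g (\<alpha>(g\<^sup>-\<^sup>1) u)\<^sub>j \<pi>(g) e\<^sub>k\<close>. If all of them
  vanished, so would the action of \<open>c\<close>, which is a combination of matrix coefficients.\<close>

lemma embeds_of_fixed:
  assumes p: "\<And>g i j. g \<in> carrier G \<Longrightarrow> p g i j = \<pi> g $$ (i,j)"
    and irr: "irreducible_rep G U \<alpha>"
    and fixed: "\<And>x. x \<in> U \<Longrightarrow> avg (carrier G) \<alpha> x = x"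
  shows "embeds G U \<alpha> (mat_space d) (mat_act d \<pi>)"
proof -
  have U: "is_rep G U \<alpha>" "U \<noteq> {vzero}" "\<And>W. invariant_sub G U \<alpha> W \<Longrightarrow> W = {vzero} \<or> W = U"
    using irr unfolding irreducible_rep_def by auto
  note rep = is_repD[OF U(1)]
  define T where "T j k u i = (if i < d then \<Sum>g\<in>carrier G. \<alpha> (inv g) u j * p g i k else 0)" for j k u and i :: nat
  obtain x where x: "x \<in> U" "x \<noteq> vzero" using U(2) vsubspace_zero[OF rep(1)] by blast
  have "\<exists>j k. k < d \<and> T j k x \<noteq> vzero"
  proof (rule ccontr)
    assume "\<not> ?thesis"
    then have T0: "T j k x i = 0" if "k < d" for i j k using that by (simp add: vzero_def)
    obtain B where B: "\<And>g. g \<in> carrier G \<Longrightarrow> c g = (\<Sum>i<d. \<Sum>k<d. B i k * p (inv g) k i)"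
      using c_coeff unfolding matrix_coeff_def by blast
    have "avg (carrier G) \<alpha> x j = 0" for j
    proof -
      have "avg (carrier G) \<alpha> x j = (\<Sum>g\<in>carrier G. \<Sum>i<d. \<Sum>k<d. B i k * (\<alpha> g x j * p (inv g) k i))"
        unfolding avg_def by (intro sum.cong refl) (simp add: B sum_distrib_left mult_ac)
      also have "\<dots> = (\<Sum>i<d. \<Sum>g\<in>carrier G. \<Sum>k<d. B i k * (\<alpha> g x j * p (inv g) k i))"
        by (rule sum.swap)
      also have "\<dots> = (\<Sum>i<d. \<Sum>k<d. \<Sum>g\<in>carrier G. B i k * (\<alpha> g x j * p (inv g) k i))"
        by (intro sum.cong refl sum.swap)
      also have "\<dots> = (\<Sum>i<d. \<Sum>k<d. B i k * T j i x k)"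
      proof (intro sum.cong refl)
        fix i k assume "k \<in> {..<d}"
        then have "T j i x k = (\<Sum>g\<in>carrier G. \<alpha> (inv g) x j * p g k i)" by (simp add: T_def)
        also have "\<dots> = (\<Sum>g\<in>carrier G. \<alpha> (inv (inv g)) x j * p (inv g) k i)"
          by (rule sum_inverse[symmetric])
        also have "\<dots> = (\<Sum>g\<in>carrier G. \<alpha> g x j * p (inv g) k i)" by (intro sum.cong refl) simp
        finally show "(\<Sum>g\<in>carrier G. B i k * (\<alpha> g x j * p (inv g) k i)) = B i k * T j i x k"
          by (simp add: sum_distrib_left)
      qed
      finally show ?thesis using T0 by simp
    qed
    then have "x = vzero" using fixed[OF x(1)] by (simp add: vzero_def fun_eq_iff)
    then show False using x(2) by blast
  qed
  then obtain j k where k: "k < d" and jk: "T j k x \<noteq> vzero" by blast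
  define \<tau> where "\<tau> = T j k"
  have lin: "lin_on U \<tau>"
    unfolding lin_on_def
  proof (intro conjI allI ballI)
    fix y z assume yz: "y \<in> U" "z \<in> U"
    show "\<tau> (\<lambda>i. y i + z i) = (\<lambda>i. \<tau> y i + \<tau> z i)"
      unfolding \<tau>_def T_def
      by (intro ext) (simp add: lin_on_add[OF rep(3) yz] distrib_right sum.distrib)
  next
    fix a y assume y: "y \<in> U"
    show "\<tau> (\<lambda>i. a * y i) = (\<lambda>i. a * \<tau> y i)"
      unfolding \<tau>_def T_def
      by (intro ext) (simp add: lin_on_scale[OF rep(3) y] sum_distrib_left mult.assoc)
  qed
  have equi: "\<tau> (\<alpha> h y) = mat_act d \<pi> h (\<tau> y)" if h: "h \<in> carrier G" and y: "y \<in> U" for h y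
  proof
    fix i
    show "\<tau> (\<alpha> h y) i = mat_act d \<pi> h (\<tau> y) i"
    proof (cases "i < d")
      case True
      have "\<tau> (\<alpha> h y) i = (\<Sum>g\<in>carrier G. \<alpha> (inv g \<otimes> h) y j * p g i k)"
        unfolding \<tau>_def T_def using True h y by (simp add: rep(6))
      also have "\<dots> = (\<Sum>g\<in>carrier G. \<alpha> (inv (h \<otimes> g) \<otimes> h) y j * p (h \<otimes> g) i k)"
        using sum_left[OF h, of "\<lambda>g. \<alpha> (inv g \<otimes> h) y j * p g i k"] by simp
      also have "\<dots> = (\<Sum>g\<in>carrier G. \<alpha> (inv g) y j * p (h \<otimes> g) i k)"
        using h by (intro sum.cong refl) (simp add: inv_mult_group m_assoc)
      finally have 1: "\<tau> (\<alpha> h y) i = (\<Sum>g\<in>carrier G. \<alpha> (inv g) y j * p (h \<otimes> g) i k)" .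
      have "\<tau> (\<alpha> h y) i = (\<Sum>g\<in>carrier G. \<Sum>m<d. p h i m * (\<alpha> (inv g) y j * p g m k))"
        unfolding 1 using h True k by (intro sum.cong refl) (simp add: p_mult sum_distrib_left mult_ac)
      also have "\<dots> = (\<Sum>m<d. p h i m * \<tau> y m)"
        unfolding \<tau>_def T_def by (subst sum.swap) (simp add: sum_distrib_left)
      finally show ?thesis using True h by (simp add: mat_act_def p)
    qed (simp add: mat_act_def \<tau>_def T_def)
  qed
  let ?N = "{y \<in> U. \<tau> y = vzero}"
  have "invariant_sub G U \<alpha> ?N"
    unfolding invariant_sub_def
  proof (intro conjI ballI)
    show "vsubspace ?N" by (rule vsubspace_kernel[OF rep(1) lin])
    show "\<alpha> g ` ?N \<subseteq> ?N" if g: "g \<in> carrier G" for g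
    proof (rule image_subsetI)
      fix y assume "y \<in> ?N"
      then have y: "y \<in> U" "\<tau> y = vzero" by auto
      have "mat_act d \<pi> g vzero = vzero" by (auto simp: mat_act_def vzero_def)
      then show "\<alpha> g y \<in> ?N" using equi[OF g y(1)] y rep(4)[OF g y(1)] by simp
    qed
  qed auto
  then have "?N = {vzero} \<or> ?N = U" by (rule U(3))
  then have N: "?N = {vzero}" using jk x(1) unfolding \<tau>_def by blast
  have "inj_on \<tau> U" by (rule lin_on_inj[OF lin rep(1)]) (use N in blast)
  moreover have "\<tau> ` U \<subseteq> mat_space d" by (auto simp: mat_space_def \<tau>_def T_def)
  ultimately show ?thesis unfolding embeds_def using lin equi by blast
qed

text \<open>An intertwiner into \<open>V\<close> carries the action of \<open>c\<close> to the
  identity by \<open>c_unit\<close>, and injectivity pulls this back.\<close>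

lemma fixed_of_embeds:
  assumes p: "\<And>g i j. g \<in> carrier G \<Longrightarrow> p g i j = \<pi> g $$ (i,j)"
    and rep: "is_rep G U \<alpha>" and emb: "embeds G U \<alpha> (mat_space d) (mat_act d \<pi>)" and x: "x \<in> U"
  shows "avg (carrier G) \<alpha> x = x"
proof -
  note rep = is_repD[OF rep]
  obtain T where T: "lin_on U T" "inj_on T U" "T ` U \<subseteq> mat_space d"
    "\<And>g w. g \<in> carrier G \<Longrightarrow> w \<in> U \<Longrightarrow> T (\<alpha> g w) = mat_act d \<pi> g (T w)"
    using emb unfolding embeds_def by blast
  have "T (avg (carrier G) \<alpha> x) = T x"
  proof
    fix i
    have "T (avg (carrier G) \<alpha> x) i = (\<Sum>g\<in>carrier G. c g * mat_act d \<pi> g (T x) i)"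
      unfolding avg_def using rep(4)[OF _ x] T(4)[OF _ x]
      by (subst lin_on_sum[OF T(1) rep(1)]) auto
    also have "\<dots> = T x i"
    proof (cases "i < d")
      case True
      have "(\<Sum>g\<in>carrier G. c g * mat_act d \<pi> g (T x) i) = (\<Sum>g\<in>carrier G. \<Sum>j<d. c g * p g i j * T x j)"
        using True by (intro sum.cong refl) (simp add: mat_act_def p sum_distrib_left mult.assoc)
      also have "\<dots> = (\<Sum>j<d. (\<Sum>g\<in>carrier G. c g * p g i j) * T x j)"
        by (subst sum.swap) (simp add: sum_distrib_right)
      also have "\<dots> = (\<Sum>j<d. if i = j then T x j else 0)"
        using True by (intro sum.cong refl) (simp add: c_unit)
      finally show ?thesis using True by simp
    next
      case False
      then show ?thesis using T(3) x by (auto simp: mat_act_def mat_space_def)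
    qed
    finally show "T (avg (carrier G) \<alpha> x) i = T x i" .
  qed
  moreover have "avg (carrier G) \<alpha> x \<in> U" using rep(4)[OF _ x] by (intro avg_closed rep(1))
  ultimately show ?thesis using T(2) x by (auto dest: inj_onD)
qed

text \<open>The image of the projection is admissible by \<open>embeds_of_fixed\<close>, and it
  contains every admissible \<open>W\<close>: a nonzero kernel of \<open>?e\<close> on
  \<open>W\<close> would contain an irreducible occurring in \<open>V\<close>, on which
  \<open>?e\<close> is both zero and the identity. So \<open>?e\<close> is injective on
  \<open>W\<close>, and since it kills \<open>x - ?e x\<close>, it fixes \<open>x\<close>. No
  complement of a subrepresentation is ever chosen.\<close>

lemma part_dim_eq:
  assumes p: "\<And>g i j. g \<in> carrier G \<Longrightarrow> p g i j = \<pi> g $$ (i,j)" and A: "is_rep G A \<alpha>"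
  shows "part_dim G A \<alpha> (mat_space d) (mat_act d \<pi>) = vdim (avg (carrier G) \<alpha> ` A)"
proof -
  note rep = is_repD[OF A]
  let ?e = "avg (carrier G) \<alpha>"
  have lin: "lin_on A ?e" by (intro lin_on_avg rep(3))
  have closed: "?e x \<in> W" if "vsubspace W" "\<And>g. g \<in> carrier G \<Longrightarrow> \<alpha> g x \<in> W" for W x
    using that by (rule avg_closed)
  have eA: "?e ` A \<subseteq> A" using closed[OF rep(1)] rep(4) by blast
  have img: "vsubspace (?e ` A)" by (rule vsubspace_image[OF rep(1) lin])
  have inv_img: "invariant_sub G A \<alpha> (?e ` A)"
    unfolding invariant_sub_def
  proof (intro conjI ballI img eA)
    show "\<alpha> g ` ?e ` A \<subseteq> ?e ` A" if g: "g \<in> carrier G" for g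
      using avg_commute[OF subgroup_self, of A \<alpha> g] A g rep(4) by auto
  qed
  let ?P = "\<lambda>W. invariant_sub G A \<alpha> W \<and> (\<forall>U. invariant_sub G W \<alpha> U \<and> irreducible_rep G U \<alpha> \<longrightarrow>
    embeds G U \<alpha> (mat_space d) (mat_act d \<pi>))"
  have P_img: "?P (?e ` A)"
  proof (intro conjI allI impI inv_img)
    fix U assume U: "invariant_sub G (?e ` A) \<alpha> U \<and> irreducible_rep G U \<alpha>"
    have "?e x = x" if "x \<in> U" for x
    proof -
      have "x \<in> ?e ` A" using U that invariant_subD(2) by blast
      then show ?thesis using avg_idem[OF A] by auto
    qed
    then show "embeds G U \<alpha> (mat_space d) (mat_act d \<pi>)"
      using embeds_of_fixed[OF p] U by blast
  qed
  have sub: "W \<subseteq> ?e ` A" if W: "?P W" for W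
  proof -
    note Wd = invariant_subD[OF conjunct1[OF W]]
    have repW: "is_rep G W \<alpha>" using is_rep_sub[OF A] W by blast
    have linW: "lin_on W ?e" by (rule lin_on_subset[OF lin Wd(2)])
    let ?N = "{x \<in> W. ?e x = vzero}"
    have invN: "invariant_sub G W \<alpha> ?N"
      unfolding invariant_sub_def
    proof (intro conjI ballI)
      show "vsubspace ?N" by (rule vsubspace_kernel[OF Wd(1) linW])
      show "\<alpha> g ` ?N \<subseteq> ?N" if g: "g \<in> carrier G" for g
      proof (rule image_subsetI)
        fix y assume "y \<in> ?N"
        then have y: "y \<in> W" "?e y = vzero" by auto
        have "?e (\<alpha> g y) = \<alpha> g vzero"
          using avg_commute[OF subgroup_self, of A \<alpha> g y] A g y Wd(2) by auto
        also have "\<dots> = vzero" by (rule lin_on_zero[OF rep(3)[OF g] rep(1)])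
        finally show "\<alpha> g y \<in> ?N" using Wd(3)[OF g y(1)] by simp
      qed
    qed auto
    have "?N = {vzero}"
    proof (rule ccontr)
      assume "?N \<noteq> {vzero}"
      then obtain U where U: "invariant_sub G ?N \<alpha> U" "irreducible_rep G U \<alpha>"
        using ex_irreducible_sub[OF is_rep_sub[OF repW invN]] by blast
      have UN: "U \<subseteq> ?N" by (rule invariant_subD(2)[OF U(1)])
      have "invariant_sub G W \<alpha> U"
        using U(1) UN unfolding invariant_sub_def by blast
      then have emb: "embeds G U \<alpha> (mat_space d) (mat_act d \<pi>)" using W U(2) by blast
      have repU: "is_rep G U \<alpha>" "U \<noteq> {vzero}" using U(2) by (auto simp: irreducible_rep_def)
      have "x = vzero" if "x \<in> U" for x
        using fixed_of_embeds[OF p repU(1) emb that] UN that by auto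
      then show False using repU vsubspace_zero[OF is_repD(1)[OF repU(1)]] by blast
    qed
    show ?thesis
    proof
      fix x assume x: "x \<in> W"
      have ex: "?e x \<in> W" using closed[OF Wd(1)] Wd(3) x by blast
      have "?e (\<lambda>i. x i + (-1) * ?e x i) = (\<lambda>i. ?e x i + (-1) * ?e (?e x) i)"
        using lin_on_add[OF linW x vsubspace_scale[OF Wd(1) ex, of "-1"]]
          lin_on_scale[OF linW ex, of "-1"] by simp
      also have "\<dots> = vzero" using avg_idem[OF A] x Wd(2) by (auto simp: vzero_def)
      finally have "(\<lambda>i. x i + (-1) * ?e x i) \<in> ?N"
        using vsubspace_add[OF Wd(1) x vsubspace_scale[OF Wd(1) ex, of "-1"]] by blast
      then have "(\<lambda>i. x i + (-1) * ?e x i) = vzero" using \<open>?N = {vzero}\<close> by blast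
      then have "x i + (-1) * ?e x i = 0" for i by (metis vzero_def)
      then have "x = ?e x" by (simp add: fun_eq_iff)
      then show "x \<in> ?e ` A" using x Wd(2) by blast
    qed
  qed
  have le: "vdim W \<le> vdim (?e ` A)" if W: "?P W" for W
    by (rule vdim_mono(1)[OF invariant_subD(1)[OF conjunct1[OF W]] img sub[OF W] fin_dim_subset[OF img eA rep(2)]])
  show ?thesis
    unfolding part_dim_def
  proof (rule Max_eqI)
    show bound: "y \<le> vdim (?e ` A)" if "y \<in> {vdim W |W. ?P W}" for y
      using that by (elim CollectE exE conjE, hypsubst, intro le conjI)
    have "{vdim W |W. ?P W} \<subseteq> {..vdim (?e ` A)}"
      by (rule subsetI, rule atMost_iff[THEN iffD2], rule bound)
    then show "finite {vdim W |W. ?P W}" by (rule finite_subset) simp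
    show "vdim (?e ` A) \<in> {vdim W |W. ?P W}"
      by (rule CollectI, rule exI[of _ "?e ` A"]) (use P_img in simp)
  qed
qed

end

section \<open>Induced representations\<close>

locale induced_rep = group G for G (structure) +
  fixes H :: "'a set" and S :: "('i \<Rightarrow> complex) set" and \<rho> :: "'a \<Rightarrow> ('i \<Rightarrow> complex) \<Rightarrow> ('i \<Rightarrow> complex)"
  assumes finG: "finite (carrier G)" and subH: "subgroup H G" and rep: "is_rep (G\<lparr>carrier := H\<rparr>) S \<rho>"
begin

lemmas repD = is_repD[OF rep, simplified]
lemmas HinG = subgroup.mem_carrier[OF subH] and Hmult = subgroup.m_closed[OF subH]
  and Hinv = subgroup.m_inv_closed[OF subH]

abbreviation ind where "ind \<equiv> ind_space G H S \<rho>"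

text \<open>The function supported on the coset of \<open>g\<^sub>0\<close> with value
  \<open>s\<close> at \<open>g\<^sub>0\<close>. Letting \<open>g\<^sub>0\<close> run over all of
  \<open>G\<close> avoids a choice of coset representatives; the price is a redundant family and the
  weight \<open>1 / card H\<close> in expansions.\<close>

definition frame :: "'a \<Rightarrow> ('i \<Rightarrow> complex) \<Rightarrow> 'a \<times> 'i \<Rightarrow> complex" where
  "frame g\<^sub>0 s = (\<lambda>(g,i). if g \<in> carrier G \<and> inv g\<^sub>0 \<otimes> g \<in> H then \<rho> (inv g \<otimes> g\<^sub>0) s i else 0)"

lemma indD:
  assumes "F \<in> ind"
  shows "\<And>g i. g \<notin> carrier G \<Longrightarrow> F (g,i) = 0" "\<And>g. g \<in> carrier G \<Longrightarrow> (\<lambda>i. F (g,i)) \<in> S"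
    "\<And>g h. g \<in> carrier G \<Longrightarrow> h \<in> H \<Longrightarrow> (\<lambda>i. F (g \<otimes> h, i)) = \<rho> (inv h) (\<lambda>i. F (g,i))"
  using assms unfolding ind_space_def by auto

lemma indI:
  assumes "\<And>g i. g \<notin> carrier G \<Longrightarrow> F (g,i) = 0" "\<And>g. g \<in> carrier G \<Longrightarrow> (\<lambda>i. F (g,i)) \<in> S"
    "\<And>g h. g \<in> carrier G \<Longrightarrow> h \<in> H \<Longrightarrow> (\<lambda>i. F (g \<otimes> h, i)) = \<rho> (inv h) (\<lambda>i. F (g,i))"
  shows "F \<in> ind"
  using assms unfolding ind_space_def by auto

lemma vsubspace_ind: "vsubspace ind"
  unfolding vsubspace_def
proof (intro conjI allI ballI)
  show "vzero \<in> ind"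
  proof (rule indI)
    fix g h assume "h \<in> H"
    then show "(\<lambda>i. vzero (g \<otimes> h, i)) = \<rho> (inv h) (\<lambda>i. vzero (g,i))"
      using lin_on_zero[OF repD(3)[OF Hinv] repD(1)] by (simp add: vzero_def)
  qed (use vsubspace_zero[OF repD(1)] in \<open>auto simp: vzero_def\<close>)
next
  fix E F assume E: "E \<in> ind" and F: "F \<in> ind"
  show "(\<lambda>i. E i + F i) \<in> ind"
  proof (rule indI)
    fix g h assume gh: "g \<in> carrier G" "h \<in> H"
    have "(\<lambda>i. E (g \<otimes> h, i) + F (g \<otimes> h, i)) = (\<lambda>i. \<rho> (inv h) (\<lambda>i. E (g,i)) i + \<rho> (inv h) (\<lambda>i. F (g,i)) i)"
      using fun_cong[OF indD(3)[OF E gh]] fun_cong[OF indD(3)[OF F gh]] by simp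
    also have "\<dots> = \<rho> (inv h) (\<lambda>i. E (g,i) + F (g,i))"
      by (rule lin_on_add[OF repD(3)[OF Hinv[OF gh(2)]] indD(2)[OF E gh(1)] indD(2)[OF F gh(1)], symmetric])
    finally show "(\<lambda>i. E (g \<otimes> h, i) + F (g \<otimes> h, i)) = \<rho> (inv h) (\<lambda>i. E (g,i) + F (g,i))" .
  next
    fix g assume g: "g \<in> carrier G"
    show "(\<lambda>i. E (g,i) + F (g,i)) \<in> S"
      by (rule vsubspace_add[OF repD(1) indD(2)[OF E g] indD(2)[OF F g]])
  qed (simp add: indD(1)[OF E] indD(1)[OF F])
next
  fix c F assume F: "F \<in> ind"
  show "(\<lambda>i. c * F i) \<in> ind"
  proof (rule indI)
    fix g h assume gh: "g \<in> carrier G" "h \<in> H"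
    have "(\<lambda>i. c * F (g \<otimes> h, i)) = (\<lambda>i. c * \<rho> (inv h) (\<lambda>i. F (g,i)) i)"
      using fun_cong[OF indD(3)[OF F gh]] by simp
    also have "\<dots> = \<rho> (inv h) (\<lambda>i. c * F (g,i))"
      by (rule lin_on_scale[OF repD(3)[OF Hinv[OF gh(2)]] indD(2)[OF F gh(1)], symmetric])
    finally show "(\<lambda>i. c * F (g \<otimes> h, i)) = \<rho> (inv h) (\<lambda>i. c * F (g,i))" .
  next
    fix g assume g: "g \<in> carrier G"
    show "(\<lambda>i. c * F (g,i)) \<in> S"
      by (rule vsubspace_scale[OF repD(1) indD(2)[OF F g]])
  qed (simp add: indD(1)[OF F])
qed

lemma coset_mem_inv:
  assumes "x \<in> carrier G" "g \<in> carrier G"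
  shows "inv x \<otimes> g \<in> H \<Longrightarrow> inv g \<otimes> x \<in> H"
  using Hinv[of "inv x \<otimes> g"] assms by (simp add: inv_mult_group)

lemma frame_mem:
  assumes g0: "g\<^sub>0 \<in> carrier G" and s: "s \<in> S"
  shows "frame g\<^sub>0 s \<in> ind"
proof (rule indI)
  fix g assume g: "g \<in> carrier G"
  show "(\<lambda>i. frame g\<^sub>0 s (g,i)) \<in> S"
  proof (cases "inv g\<^sub>0 \<otimes> g \<in> H")
    case True
    then have "\<rho> (inv g \<otimes> g\<^sub>0) s \<in> S" using repD(4) coset_mem_inv[OF g0 g] s by simp
    then show ?thesis using True g by (simp add: frame_def)
  next
    case False
    then show ?thesis using vsubspace_zero[OF repD(1)] by (simp add: frame_def vzero_def)
  qed
next
  fix g h assume g: "g \<in> carrier G" and h: "h \<in> H"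
  note hG = HinG[OF h]
  show "(\<lambda>i. frame g\<^sub>0 s (g \<otimes> h, i)) = \<rho> (inv h) (\<lambda>i. frame g\<^sub>0 s (g,i))"
  proof (cases "inv g\<^sub>0 \<otimes> g \<in> H")
    case True
    have "inv g\<^sub>0 \<otimes> (g \<otimes> h) \<in> H"
      using Hmult[OF True h] g0 g hG by (simp add: m_assoc)
    moreover have "inv (g \<otimes> h) \<otimes> g\<^sub>0 = inv h \<otimes> (inv g \<otimes> g\<^sub>0)"
      using g0 g hG by (simp add: inv_mult_group m_assoc)
    ultimately show ?thesis
      using True g hG coset_mem_inv[OF g0 g True] Hinv[OF h] s by (simp add: frame_def repD(6))
  next
    case False
    have "inv g\<^sub>0 \<otimes> (g \<otimes> h) \<notin> H"
    proof
      assume "inv g\<^sub>0 \<otimes> (g \<otimes> h) \<in> H"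
      from Hmult[OF this Hinv[OF h]] show False
        using False g0 g hG by (simp add: m_assoc)
    qed
    then show ?thesis
      using False lin_on_zero[OF repD(3)[OF Hinv[OF h]] repD(1)] by (simp add: frame_def vzero_def)
  qed
qed (simp add: frame_def)

lemma sum_coset:
  assumes g: "g \<in> carrier G"
  shows "(\<Sum>x\<in>carrier G. if inv x \<otimes> g \<in> H then \<Phi> x else (0::complex)) = (\<Sum>k\<in>H. \<Phi> (g \<otimes> k))"
proof -
  have "(\<Sum>x\<in>carrier G. if inv x \<otimes> g \<in> H then \<Phi> x else 0) = (\<Sum>x\<in>{x\<in>carrier G. inv x \<otimes> g \<in> H}. \<Phi> x)"
    using finG by (simp add: sum.inter_filter)
  also have "\<dots> = (\<Sum>k\<in>H. \<Phi> (g \<otimes> k))"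
  proof (rule sum.reindex_bij_witness[of _ "\<lambda>k. g \<otimes> k" "\<lambda>x. inv g \<otimes> x"])
    fix x assume "x \<in> {x\<in>carrier G. inv x \<otimes> g \<in> H}"
    then have x: "x \<in> carrier G" "inv x \<otimes> g \<in> H" by auto
    show "inv g \<otimes> x \<in> H" using coset_mem_inv[OF x(1) g x(2)] .
    show "g \<otimes> (inv g \<otimes> x) = x" "\<Phi> (g \<otimes> (inv g \<otimes> x)) = \<Phi> x"
      using x g by (simp_all add: m_assoc[symmetric])
  next
    fix k assume k: "k \<in> H"
    show "inv g \<otimes> (g \<otimes> k) = k" using g HinG[OF k] by (simp add: m_assoc[symmetric])
    have "inv (g \<otimes> k) \<otimes> g = inv k" using g HinG[OF k] by (simp add: inv_mult_group m_assoc)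
    then show "g \<otimes> k \<in> {x\<in>carrier G. inv x \<otimes> g \<in> H}" using g HinG[OF k] Hinv[OF k] by simp
  qed
  finally show ?thesis .
qed

lemma card_H: "card H > 0"
  using finite_subset[OF subgroup.subset[OF subH] finG] subgroup.one_closed[OF subH]
  by (auto simp: card_gt_0_iff)

lemma frame_expansion:
  assumes U: "U \<subseteq> S" "\<And>x. x \<in> S \<Longrightarrow> (\<lambda>i. \<Sum>u\<in>U. \<beta> u x * u i) = x"
    and F: "F \<in> ind"
  shows "(\<lambda>y. \<Sum>(g\<^sub>0,s)\<in>carrier G \<times> U. (\<beta> s (\<lambda>i. F (g\<^sub>0,i)) / card H) * frame g\<^sub>0 s y) = F"
proof
  fix y :: "'a \<times> 'i"
  obtain g i where y: "y = (g,i)" by fastforce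
  show "(\<Sum>(g\<^sub>0,s)\<in>carrier G \<times> U. (\<beta> s (\<lambda>i. F (g\<^sub>0,i)) / card H) * frame g\<^sub>0 s y) = F y"
  proof (cases "g \<in> carrier G")
    case False
    then show ?thesis unfolding y using indD(1)[OF F] by (simp add: frame_def)
  next
    case g: True
    have "(\<Sum>(g\<^sub>0,s)\<in>carrier G \<times> U. (\<beta> s (\<lambda>i. F (g\<^sub>0,i)) / card H) * frame g\<^sub>0 s y)
      = (\<Sum>g\<^sub>0\<in>carrier G. \<Sum>s\<in>U. (\<beta> s (\<lambda>i. F (g\<^sub>0,i)) / card H) * frame g\<^sub>0 s y)"
      by (rule sum.cartesian_product[symmetric])
    also have "\<dots> = (\<Sum>g\<^sub>0\<in>carrier G. if inv g\<^sub>0 \<otimes> g \<in> H then \<rho> (inv g \<otimes> g\<^sub>0) (\<lambda>i. F (g\<^sub>0,i)) i / card H else 0)"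
    proof (rule sum.cong[OF refl])
      fix g\<^sub>0 assume g0: "g\<^sub>0 \<in> carrier G"
      show "(\<Sum>s\<in>U. (\<beta> s (\<lambda>i. F (g\<^sub>0,i)) / card H) * frame g\<^sub>0 s y)
        = (if inv g\<^sub>0 \<otimes> g \<in> H then \<rho> (inv g \<otimes> g\<^sub>0) (\<lambda>i. F (g\<^sub>0,i)) i / card H else 0)"
      proof (cases "inv g\<^sub>0 \<otimes> g \<in> H")
        case True
        have "\<rho> (inv g \<otimes> g\<^sub>0) (\<lambda>i. F (g\<^sub>0,i))
          = \<rho> (inv g \<otimes> g\<^sub>0) (\<lambda>i. \<Sum>s\<in>U. \<beta> s (\<lambda>i. F (g\<^sub>0,i)) * s i)"
          using U(2)[OF indD(2)[OF F g0]] by simp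
        also have "\<dots> = (\<lambda>i. \<Sum>s\<in>U. \<beta> s (\<lambda>i. F (g\<^sub>0,i)) * \<rho> (inv g \<otimes> g\<^sub>0) s i)"
          using U(1) by (intro lin_on_sum[OF repD(3)[OF coset_mem_inv[OF g0 g True]] repD(1)]) auto
        finally show ?thesis
          using True g by (simp add: y frame_def sum_divide_distrib)
      qed (simp add: y frame_def)
    qed
    also have "\<dots> = (\<Sum>k\<in>H. \<rho> (inv g \<otimes> (g \<otimes> k)) (\<lambda>i. F (g \<otimes> k, i)) i / card H)"
      by (rule sum_coset[OF g])
    \<comment> \<open>Each of the \<open>card H\<close> points of the coset of \<open>g\<close>
      returns the same value, by the equivariance of \<open>F\<close>; this accounts for the
      weight.\<close>
    also have "\<dots> = (\<Sum>k\<in>H. F (g,i) / card H)"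
    proof (rule sum.cong[OF refl])
      fix k assume k: "k \<in> H"
      have "inv g \<otimes> (g \<otimes> k) = k" using g HinG[OF k] by (simp add: m_assoc[symmetric])
      moreover have "\<rho> k (\<rho> (inv k) (\<lambda>i. F (g,i))) = (\<lambda>i. F (g,i))"
        using repD(6)[OF k Hinv[OF k] indD(2)[OF F g]] repD(5)[OF indD(2)[OF F g]] HinG[OF k] by simp
      ultimately show "\<rho> (inv g \<otimes> (g \<otimes> k)) (\<lambda>i. F (g \<otimes> k, i)) i / card H = F (g,i) / card H"
        by (simp add: indD(3)[OF F g k])
    qed
    also have "\<dots> = F y" using card_H by (simp add: y)
    finally show ?thesis .
  qed
qed

lemma fin_dim_ind: "fin_dim ind"
proof -
  obtain U \<beta> where U: "finite U" "U \<subseteq> S" "vdim S = card U" "\<And>u. lfun S (\<beta> u)"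
    "\<And>x. x \<in> S \<Longrightarrow> (\<lambda>i. \<Sum>u\<in>U. \<beta> u x * u i) = x"
    "\<And>u v. u \<in> U \<Longrightarrow> v \<in> U \<Longrightarrow> \<beta> u v = of_bool (u = v)"
    using ex_dual_basis[OF repD(1,2)] by blast
  let ?B = "(\<lambda>(g,s). frame g s) ` (carrier G \<times> U)"
  have fB: "finite ?B" using U(1) finG by simp
  have "F \<in> vspan ?B" if F: "F \<in> ind" for F
  proof -
    have "vsubspace (fv.span ?B)" by (simp add: vsubspace_iff)
    then have "(\<lambda>y. \<Sum>j\<in>carrier G \<times> U. (\<beta> (snd j) (\<lambda>i. F (fst j,i)) / card H) * frame (fst j) (snd j) y) \<in> fv.span ?B"
      by (rule vsubspace_sum) (auto intro!: fv.span_base image_eqI)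
    then show ?thesis
      unfolding vspan_eq[OF fB] using frame_expansion[OF U(2,5) F] by (simp add: case_prod_beta)
  qed
  moreover have "?B \<subseteq> ind" using U(2) frame_mem by auto
  ultimately show ?thesis unfolding fin_dim_def using fB by blast
qed

lemma is_rep_ind: "is_rep G ind (ind_act G)"
  unfolding is_rep_def
proof (intro conjI ballI)
  show "vsubspace ind" by (rule vsubspace_ind)
  show "fin_dim ind" by (rule fin_dim_ind)
  show "lin_on ind (ind_act G g)" for g
    unfolding lin_on_def ind_act_def by (auto simp: fun_eq_iff)
  show "ind_act G x ` ind \<subseteq> ind" if x: "x \<in> carrier G" for x
  proof (rule image_subsetI)
    fix F assume F: "F \<in> ind"
    show "ind_act G x F \<in> ind"
    proof (rule indI)
      fix g h assume g: "g \<in> carrier G" and h: "h \<in> H"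
      have "(\<lambda>i. ind_act G x F (g \<otimes> h, i)) = (\<lambda>i. F (inv x \<otimes> g \<otimes> h, i))"
        using x g HinG[OF h] by (simp add: ind_act_def m_assoc)
      also have "\<dots> = \<rho> (inv h) (\<lambda>i. F (inv x \<otimes> g, i))"
        using x g by (intro indD(3)[OF F _ h]) simp
      finally show "(\<lambda>i. ind_act G x F (g \<otimes> h, i)) = \<rho> (inv h) (\<lambda>i. ind_act G x F (g,i))"
        using g by (simp add: ind_act_def)
    next
      fix g assume g: "g \<in> carrier G"
      then show "(\<lambda>i. ind_act G x F (g,i)) \<in> S"
        using indD(2)[OF F, of "inv x \<otimes> g"] x by (simp add: ind_act_def)
    qed (simp add: ind_act_def)
  qed
  show "ind_act G \<one> F = F" if F: "F \<in> ind" for F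
    using indD(1)[OF F] by (auto simp: ind_act_def fun_eq_iff)
  show "ind_act G (x \<otimes> y) F = ind_act G x (ind_act G y F)" if "x \<in> carrier G" "y \<in> carrier G" for x y F
    using that by (auto simp: ind_act_def fun_eq_iff inv_mult_group m_assoc)
qed

text \<open>Guards the quotient of dimensions against division by zero.\<close>

lemma vdim_ind_pos:
  assumes "S \<noteq> {vzero}"
  shows "vdim ind > 0"
proof (rule vdim_pos[OF vsubspace_ind fin_dim_ind])
  obtain s where s: "s \<in> S" "s \<noteq> vzero" using assms vsubspace_zero[OF repD(1)] by blast
  then obtain i where i: "s i \<noteq> 0" by (auto simp: vzero_def fun_eq_iff)
  have "frame \<one> s (\<one>, i) = s i"
    using repD(5)[OF s(1)] subgroup.one_closed[OF subH] by (simp add: frame_def)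
  then have "frame \<one> s \<noteq> vzero" using i by (auto simp: vzero_def)
  then show "ind \<noteq> {vzero}" using frame_mem[OF one_closed s(1)] by blast
qed

end

context reproducing_rep
begin

text \<open>Schur's lemma for a single operator: an eigenspace of an operator commuting with the
  action is invariant and nonzero, hence the whole space.\<close>

lemma schur_avg:
  assumes D: "subgroup D G" and irr: "irreducible_rep (G\<lparr>carrier := D\<rparr>) S \<rho>"
  obtains \<mu> where "\<And>s. s \<in> S \<Longrightarrow> avg D \<rho> s = (\<lambda>i. \<mu> * s i)"
proof -
  have S: "is_rep (G\<lparr>carrier := D\<rparr>) S \<rho>" "S \<noteq> {vzero}"
    "\<And>W. invariant_sub (G\<lparr>carrier := D\<rparr>) S \<rho> W \<Longrightarrow> W = {vzero} \<or> W = S"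
    using irr unfolding irreducible_rep_def by auto
  note rep = is_repD[OF S(1), simplified]
  have lin: "lin_on S (avg D \<rho>)" by (intro lin_on_avg rep(3))
  have "avg D \<rho> ` S \<subseteq> S"
    by (rule image_subsetI) (rule avg_closed[OF rep(1)], rule rep(4))
  from ex_eigenvector[OF rep(1,2) S(2) lin this]
  obtain \<mu> x where x: "x \<in> S" "x \<noteq> vzero" "avg D \<rho> x = (\<lambda>i. \<mu> * x i)" by blast
  let ?E = "{s \<in> S. avg D \<rho> s = (\<lambda>i. \<mu> * s i)}"
  have "invariant_sub (G\<lparr>carrier := D\<rparr>) S \<rho> ?E"
    unfolding invariant_sub_def
  proof (intro conjI ballI)
    show "vsubspace ?E" by (rule vsubspace_eigenspace[OF rep(1) lin])
    fix g assume "g \<in> carrier (G\<lparr>carrier := D\<rparr>)"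
    then have g: "g \<in> D" by simp
    show "\<rho> g ` ?E \<subseteq> ?E"
    proof (rule image_subsetI)
      fix y assume "y \<in> ?E"
      then have y: "y \<in> S" "avg D \<rho> y = (\<lambda>i. \<mu> * y i)" by auto
      have "avg D \<rho> (\<rho> g y) = \<rho> g (\<lambda>i. \<mu> * y i)"
        using avg_commute[OF D S(1) g y(1)] y(2) by simp
      then show "\<rho> g y \<in> ?E"
        using lin_on_scale[OF rep(3)[OF g] y(1)] rep(4)[OF g y(1)] by simp
    qed
  qed auto
  then have "?E = {vzero} \<or> ?E = S" by (rule S(3))
  then have "?E = S" using x by blast
  then show thesis using that[of \<mu>] by blast
qed

text \<open>The dimension of the image is the trace of the projection, computed over the redundant
  frame. At the point \<open>g\<close>, the projection of \<open>frame g s\<close> is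
  \<open>\<Sum>k c(g k g\<^sup>-\<^sup>1) \<rho>(k) s\<close>. Centrality removes \<open>g\<close>
  and leaves \<open>avg D \<rho> s\<close>, so each diagonal term is \<open>\<mu>\<close> times the
  one for the identity operator.\<close>

lemma vdim_avg_ind:
  assumes D: "subgroup D G" and rep: "is_rep (G\<lparr>carrier := D\<rparr>) S \<rho>"
    and \<mu>: "\<And>s. s \<in> S \<Longrightarrow> avg D \<rho> s = (\<lambda>i. \<mu> * s i)"
  shows "of_nat (vdim (avg (carrier G) (ind_act G) ` ind_space G D S \<rho>)) = \<mu> * of_nat (vdim (ind_space G D S \<rho>))"
proof -
  interpret I: induced_rep G D S \<rho>
    by (intro induced_rep.intro induced_rep_axioms.intro is_group fin D rep)
  let ?e = "avg (carrier G) (ind_act G)"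
  note ind = is_repD[OF I.is_rep_ind]
  obtain U \<beta> where U: "finite U" "U \<subseteq> S" "vdim S = card U" "\<And>u. lfun S (\<beta> u)"
    "\<And>x. x \<in> S \<Longrightarrow> (\<lambda>i. \<Sum>u\<in>U. \<beta> u x * u i) = x"
    "\<And>u v. u \<in> U \<Longrightarrow> v \<in> U \<Longrightarrow> \<beta> u v = of_bool (u = v)"
    using ex_dual_basis[OF I.repD(1,2)] by blast
  let ?J = "carrier G \<times> U"
  define \<gamma> where "\<gamma> j F = \<beta> (snd j) (\<lambda>i. F (fst j :: 'a, i)) / card D" for j F
  define fr where "fr j = I.frame (fst j) (snd j)" for j
  have \<gamma>: "lfun I.ind (\<gamma> j)" if j: "j \<in> ?J" for j
    unfolding lfun_def
  proof (intro conjI allI ballI)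
    fix E F assume "E \<in> I.ind" "F \<in> I.ind"
    then show "\<gamma> j (\<lambda>i. E i + F i) = \<gamma> j E + \<gamma> j F"
      unfolding \<gamma>_def using lfun_add[OF U(4) I.indD(2) I.indD(2), of E "fst j" F "fst j"] j
      by (auto simp: add_divide_distrib)
  next
    fix c F assume "F \<in> I.ind"
    then show "\<gamma> j (\<lambda>i. c * F i) = c * \<gamma> j F"
      unfolding \<gamma>_def using lfun_scale[OF U(4) I.indD(2), of F "fst j"] j by auto
  qed
  have fr: "fr j \<in> I.ind" if "j \<in> ?J" for j
    using that U(2) unfolding fr_def by (auto intro!: I.frame_mem)
  have expand: "(\<lambda>i. \<Sum>j\<in>?J. \<gamma> j F * fr j i) = F" if "F \<in> I.ind" for F
    using I.frame_expansion[OF U(2,5) that] by (simp add: \<gamma>_def fr_def case_prod_beta)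
  have frame_self: "(\<lambda>i. fr j (fst j, i)) = snd j" if "j \<in> ?J" for j
    using that U(2) I.repD(5) subgroup.one_closed[OF D] unfolding fr_def I.frame_def by auto
  have e_self: "(\<lambda>i. ?e (fr j) (fst j, i)) = (\<lambda>i. \<mu> * snd j i)" if j: "j \<in> ?J" for j
  proof
    fix i
    obtain g s where gs: "j = (g,s)" "g \<in> carrier G" "s \<in> U" using j by auto
    note g = gs(2)
    have "?e (fr j) (fst j, i) = (\<Sum>x\<in>carrier G. c x * I.frame g s (inv x \<otimes> g, i))"
      unfolding avg_def ind_act_def fr_def using g gs(1) by simp
    also have "\<dots> = (\<Sum>x\<in>carrier G. c (x \<otimes> inv g) * I.frame g s (inv (x \<otimes> inv g) \<otimes> g, i))"
      using sum_right[of "inv g" "\<lambda>x. c x * I.frame g s (inv x \<otimes> g, i)"] g by simp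
    also have "\<dots> = (\<Sum>x\<in>carrier G. if inv x \<otimes> g \<in> D then c (x \<otimes> inv g) * \<rho> (inv g \<otimes> x) s i else 0)"
    proof (rule sum.cong[OF refl])
      fix x assume x: "x \<in> carrier G"
      have 1: "inv (x \<otimes> inv g) \<otimes> g = g \<otimes> inv x \<otimes> g" using x g by (simp add: inv_mult_group)
      have 2: "inv g \<otimes> (g \<otimes> inv x \<otimes> g) = inv x \<otimes> g" using x g by (simp add: m_assoc[symmetric])
      have 3: "inv (g \<otimes> inv x \<otimes> g) \<otimes> g = inv g \<otimes> x"
        using x g by (simp add: inv_mult_group m_assoc)
      show "c (x \<otimes> inv g) * I.frame g s (inv (x \<otimes> inv g) \<otimes> g, i)
        = (if inv x \<otimes> g \<in> D then c (x \<otimes> inv g) * \<rho> (inv g \<otimes> x) s i else 0)"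
        unfolding 1 I.frame_def using x g by (simp add: 2 3)
    qed
    also have "\<dots> = (\<Sum>k\<in>D. c (g \<otimes> k \<otimes> inv g) * \<rho> (inv g \<otimes> (g \<otimes> k)) s i)"
      by (rule I.sum_coset[OF g])
    also have "\<dots> = (\<Sum>k\<in>D. c k * \<rho> k s i)"
      using g I.HinG by (intro sum.cong refl) (simp add: c_conj m_assoc[symmetric])
    also have "\<dots> = avg D \<rho> s i" by (simp add: avg_def)
    also have "\<dots> = \<mu> * snd j i" using \<mu> gs U(2) by auto
    finally show "?e (fr j) (fst j, i) = \<mu> * snd j i" .
  qed
  have \<beta>_self: "\<beta> u u = 1" if "u \<in> U" for u using U(6)[OF that that] by simp
  have "of_nat (vdim (?e ` I.ind)) = (\<Sum>j\<in>?J. \<gamma> j (?e (fr j)))"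
  proof (rule vdim_idempotent_image[OF ind(1,2) _ _ _ fr \<gamma> expand])
    show "lin_on I.ind ?e" by (intro lin_on_avg ind(3))
    show "?e ` I.ind \<subseteq> I.ind" by (rule image_subsetI) (rule avg_closed[OF ind(1)], rule ind(4))
    show "?e (?e F) = ?e F" if "F \<in> I.ind" for F by (rule avg_idem[OF I.is_rep_ind that])
  qed
  also have "\<dots> = (\<Sum>j\<in>?J. \<mu> * (1 / card D))"
  proof (rule sum.cong[OF refl])
    fix j assume j: "j \<in> ?J"
    then have "snd j \<in> U" by auto
    then show "\<gamma> j (?e (fr j)) = \<mu> * (1 / card D)"
      unfolding \<gamma>_def e_self[OF j] using lfun_scale[OF U(4), of "snd j"] U(2) \<beta>_self by auto
  qed
  also have "\<dots> = \<mu> * (\<Sum>j\<in>?J. \<gamma> j (fr j))"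
    unfolding sum_distrib_left
  proof (rule sum.cong[OF refl])
    fix j assume j: "j \<in> ?J"
    then have "snd j \<in> U" by auto
    then show "\<mu> * (1 / card D) = \<mu> * \<gamma> j (fr j)"
      unfolding \<gamma>_def frame_self[OF j] using \<beta>_self by simp
  qed
  \<comment> \<open>The remaining sum is the trace of the identity over the same frame, and the
    trace formula returns the dimension of the whole space.\<close>
  also have "(\<Sum>j\<in>?J. \<gamma> j (fr j)) = of_nat (vdim ((\<lambda>F. F) ` I.ind))"
    by (rule vdim_idempotent_image[OF ind(1,2) _ _ _ fr \<gamma> expand, symmetric]) (auto simp: lin_on_def)
  finally show ?thesis by simp
qed

end

context reproducing_rep
begin

text \<open>The scalar \<open>\<mu>\<close> arose as a complex eigenvalue. Being a ratio of
  dimensions it is real, which makes the comparison with \<open>l\<close> meaningful.\<close>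

lemma part_dim_ind:
  assumes p: "\<And>g i j. g \<in> carrier G \<Longrightarrow> p g i j = \<pi> g $$ (i,j)"
    and D: "subgroup D G" and irr: "irreducible_rep (G\<lparr>carrier := D\<rparr>) S \<rho>"
    and \<mu>: "\<And>s. s \<in> S \<Longrightarrow> avg D \<rho> s = (\<lambda>i. \<mu> * s i)"
  shows "complex_of_real (real (part_dim G (ind_space G D S \<rho>) (ind_act G) (mat_space d) (mat_act d \<pi>))
    / real (vdim (ind_space G D S \<rho>))) = \<mu>"
proof -
  have rep: "is_rep (G\<lparr>carrier := D\<rparr>) S \<rho>" and ne: "S \<noteq> {vzero}"
    using irr by (auto simp: irreducible_rep_def)
  interpret I: induced_rep G D S \<rho>
    by (intro induced_rep.intro induced_rep_axioms.intro is_group fin D rep)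
  have pd: "part_dim G (ind_space G D S \<rho>) (ind_act G) (mat_space d) (mat_act d \<pi>)
    = vdim (avg (carrier G) (ind_act G) ` ind_space G D S \<rho>)"
    by (rule part_dim_eq[OF _ I.is_rep_ind]) (rule p)
  show ?thesis
    unfolding pd using vdim_avg_ind[OF D rep \<mu>] I.vdim_ind_pos[OF ne]
    by (simp add: field_simps)
qed

lemma ex_coset_rep:
  assumes H: "subgroup H G"
  obtains l u where "coset_rep G d p c b H l u"
proof -
  have fH: "finite H" using subgroup.subset[OF H] fin by (rule finite_subset)
  have HG: "\<And>h. h \<in> H \<Longrightarrow> h \<in> carrier G" using subgroup.mem_carrier[OF H] .
  have ne: "H \<noteq> {}" using subgroup.one_closed[OF H] by blast
  have herm: "K y x = cnj (K x y)" if "x \<in> H" "y \<in> H" for x y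
    by (rule K_hermitian[OF HG[OF that(1)] HG[OF that(2)]])
  show thesis
  proof (rule hermitian_top_eigenvector[OF fH ne herm])
    fix l u
    assume "(\<Sum>a\<in>H. (cmod (u a))\<^sup>2) = 1"
      "\<And>a. a \<in> H \<Longrightarrow> (\<Sum>b\<in>H. K a b * u b) = complex_of_real l * u a"
      "\<And>v. Re (sesq H K v v) \<le> l * (\<Sum>a\<in>H. (cmod (v a))\<^sup>2)"
    then have "coset_rep_axioms G c H l u"
      using H by (intro coset_rep_axioms.intro)
    then have "coset_rep G d p c b H l u"
      by (intro coset_rep.intro reproducing_rep_axioms)
    then show thesis by (rule that)
  qed
qed

end

section \<open>Eigenvalues of the compressed kernel and irreducible representations of the
  subgroup\<close>

context coset_rep
begin

text \<open>On \<open>H\<close> the compressed kernel is convolution by the restriction of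
  \<open>c\<close>; this links the eigenvalue problem to \<open>avg H\<close>.\<close>

lemma K_conv:
  assumes h: "h \<in> H"
  shows "(\<Sum>k\<in>H. K h k * F k) = (\<Sum>m\<in>H. c m * F (inv m \<otimes> h))"
proof -
  note Hm = subgroup.m_closed[OF H] and Hi = subgroup.m_inv_closed[OF H]
  have "(\<Sum>k\<in>H. K h k * F k) = (\<Sum>k\<in>H. K h (k \<otimes> h) * F (k \<otimes> h))"
    using sum_mult_right[OF H h, of "\<lambda>k. K h k * F k"] by simp
  also have "\<dots> = (\<Sum>m\<in>H. K h (inv m \<otimes> h) * F (inv m \<otimes> h))"
    using sum_inv[OF H, of "\<lambda>k. K h (k \<otimes> h) * F (k \<otimes> h)"] by simp
  also have "\<dots> = (\<Sum>m\<in>H. c m * F (inv m \<otimes> h))"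
  proof (rule sum.cong[OF refl])
    fix m assume m: "m \<in> H"
    have "K h (inv m \<otimes> h) = c (inv h \<otimes> m \<otimes> inv (inv h))"
      using HG[OF m] HG[OF h] by (simp add: K_def inv_mult_group)
    also have "\<dots> = c m" using HG[OF m] HG[OF h] by (intro c_conj) auto
    finally show "K h (inv m \<otimes> h) * F (inv m \<otimes> h) = c m * F (inv m \<otimes> h)" by simp
  qed
  finally show ?thesis .
qed

text \<open>The vector \<open>s\<close> is replaced by the function \<open>v\<close> recording one
  coordinate of its orbit. As \<open>avg H \<rho>\<close> acts by \<open>\<mu>\<close>, this
  \<open>v\<close> is an eigenvector of the compressed kernel for \<open>\<mu>\<close>, and it is
  nonzero since \<open>v \<one> = s j\<close>. The Rayleigh bound on functions on \<open>H\<close>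
  then does the work of an invariant inner product on \<open>S\<close>.\<close>

lemma ratio_le:
  assumes p: "\<And>g i j. g \<in> carrier G \<Longrightarrow> p g i j = \<pi> g $$ (i,j)"
    and irr: "irreducible_rep (G\<lparr>carrier := H\<rparr>) S \<rho>"
  shows "real (part_dim G (ind_space G H S \<rho>) (ind_act G) (mat_space d) (mat_act d \<pi>))
    / real (vdim (ind_space G H S \<rho>)) \<le> l" (is "?r \<le> l")
proof -
  obtain \<mu> where \<mu>: "\<And>s. s \<in> S \<Longrightarrow> avg H \<rho> s = (\<lambda>i. \<mu> * s i)"
    using schur_avg[OF H irr] by blast
  have r: "complex_of_real ?r = \<mu>" by (rule part_dim_ind[OF p H irr \<mu>])
  have "is_rep (G\<lparr>carrier := H\<rparr>) S \<rho>" and ne: "S \<noteq> {vzero}"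
    using irr by (auto simp: irreducible_rep_def)
  note rep = is_repD[OF this(1), simplified]
  obtain s where s: "s \<in> S" "s \<noteq> vzero" using ne vsubspace_zero[OF rep(1)] by blast
  then obtain j where j: "s j \<noteq> 0" by (auto simp: vzero_def fun_eq_iff)
  note Hi = subgroup.m_inv_closed[OF H]
  define v where "v h = \<rho> (inv h) s j" for h
  have Kv: "(\<Sum>k\<in>H. K h k * v k) = \<mu> * v h" if h: "h \<in> H" for h
  proof -
    have "(\<Sum>k\<in>H. K h k * v k) = (\<Sum>m\<in>H. c m * v (inv m \<otimes> h))" by (rule K_conv[OF h])
    also have "\<dots> = (\<Sum>m\<in>H. c m * \<rho> (inv h) (\<rho> m s) j)"
    proof (rule sum.cong[OF refl])
      fix m assume m: "m \<in> H"
      have "inv (inv m \<otimes> h) = inv h \<otimes> m" using HG[OF m] HG[OF h] by (simp add: inv_mult_group)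
      then show "c m * v (inv m \<otimes> h) = c m * \<rho> (inv h) (\<rho> m s) j"
        unfolding v_def using rep(6)[OF Hi[OF h] m s(1)] by simp
    qed
    also have "\<dots> = \<rho> (inv h) (avg H \<rho> s) j"
      unfolding avg_def using rep(4) s(1) by (subst lin_on_sum[OF rep(3)[OF Hi[OF h]] rep(1)]) auto
    also have "\<dots> = \<mu> * v h"
      unfolding \<mu>[OF s(1)] lin_on_scale[OF rep(3)[OF Hi[OF h]] s(1)] by (simp add: v_def)
    finally show ?thesis .
  qed
  have "sesq H K v v = (\<Sum>h\<in>H. cnj (v h) * (\<Sum>k\<in>H. K h k * v k))"
    unfolding sesq_def by (simp add: sum_distrib_left mult.assoc)
  also have "\<dots> = (\<Sum>h\<in>H. \<mu> * (cnj (v h) * v h))"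
    by (intro sum.cong refl) (simp add: Kv)
  also have "\<dots> = complex_of_real ?r * complex_of_real (\<Sum>h\<in>H. (cmod (v h))\<^sup>2)"
    unfolding of_real_sum cmod_square r by (simp add: sum_distrib_left)
  finally have "Re (sesq H K v v) = ?r * (\<Sum>h\<in>H. (cmod (v h))\<^sup>2)"
    by (simp only: of_real_mult[symmetric] Re_complex_of_real)
  then have "?r * (\<Sum>h\<in>H. (cmod (v h))\<^sup>2) \<le> l * (\<Sum>h\<in>H. (cmod (v h))\<^sup>2)"
    using rayleigh[of v] by simp
  moreover have "(\<Sum>h\<in>H. (cmod (v h))\<^sup>2) > 0"
  proof (rule sum_pos2[OF finH subgroup.one_closed[OF H]])
    show "0 < (cmod (v \<one>))\<^sup>2" using j rep(5)[OF s(1)] by (simp add: v_def)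
  qed auto
  ultimately show ?thesis by (rule mult_right_le_imp_le)
qed

text \<open>\<open>K\<close> is invariant under left translation, so its \<open>l\<close>-eigenspace
  among the functions on \<open>H\<close> is a representation of \<open>H\<close> on which
  \<open>avg H\<close> acts by \<open>l\<close>. The eigenspace may be reducible, but any
  irreducible part inherits the scalar.\<close>

lemma ex_irreducible_eigenvalue:
  obtains S :: "(nat \<Rightarrow> complex) set" and \<rho>
  where "irreducible_rep (G\<lparr>carrier := H\<rparr>) S \<rho>" "\<forall>s\<in>S. avg H \<rho> s = (\<lambda>i. complex_of_real l * s i)"
proof -
  note Hm = subgroup.m_closed[OF H] and Hi = subgroup.m_inv_closed[OF H]
  define n where "n = card H"
  \<comment> \<open>The representation must live on functions of natural numbers, so functions on
    \<open>H\<close> are transported along an enumeration \<open>e\<close> and extended by 0 from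
    index \<open>n\<close> on.\<close>
  obtain e where e: "bij_betw e {..<n} H"
    using ex_bij_betw_nat_finite[OF finH] unfolding n_def atLeast0LessThan by blast
  define idx where "idx = inv_into {..<n} e"
  have idx: "e (idx h) = h" "idx h < n" if "h \<in> H" for h
    using e that unfolding idx_def
    by (auto simp: bij_betw_inv_into_right) (metis bij_betw_imp_surj_on inv_into_into lessThan_iff)
  have eH: "e i \<in> H" "idx (e i) = i" if "i < n" for i
    using e that unfolding idx_def by (auto simp: bij_betw_inv_into_left bij_betw_apply)
  define \<rho> where "\<rho> k v i = (if i < n then v (idx (inv k \<otimes> e i)) else 0)" for k and v :: "nat \<Rightarrow> complex" and i
  define S where "S = {v :: nat \<Rightarrow> complex. (\<forall>i\<ge>n. v i = 0) \<and> (\<forall>h\<in>H. (\<Sum>k\<in>H. K h k * v (idx k)) = l * v (idx h))}"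
  have vsub: "vsubspace S"
    unfolding vsubspace_def
  proof (intro conjI allI ballI)
    show "vzero \<in> S" by (simp add: S_def vzero_def)
    show "(\<lambda>i. x i + y i) \<in> S" if "x \<in> S" "y \<in> S" for x y
      using that by (simp add: S_def distrib_left sum.distrib)
    show "(\<lambda>i. a * x i) \<in> S" if "x \<in> S" for a x
    proof -
      have "(\<Sum>k\<in>H. K h k * (a * x (idx k))) = a * (\<Sum>k\<in>H. K h k * x (idx k))" for h
        by (simp add: sum_distrib_left mult_ac)
      then show ?thesis using that by (simp add: S_def)
    qed
  qed
  have fdim: "fin_dim S"
  proof -
    define B where "B = (\<lambda>k i. of_bool (i = k) :: complex) ` {..<n}"
    have fB: "finite B" by (simp add: B_def)
    have "vsubspace (mat_space n)" by (auto simp: vsubspace_def mat_space_def vzero_def)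
    moreover have "S \<subseteq> mat_space n" by (auto simp: S_def mat_space_def)
    moreover have "v \<in> vspan B" if v: "v \<in> mat_space n" for v
    proof -
      have "vsubspace (fv.span B)" by (simp add: vsubspace_iff)
      then have "(\<lambda>i. \<Sum>k<n. v k * of_bool (i = k)) \<in> fv.span B"
        by (rule vsubspace_sum) (auto simp: B_def intro: fv.span_base)
      moreover have "(\<lambda>i. \<Sum>k<n. v k * of_bool (i = k)) = v"
      proof
        fix i
        have "(\<Sum>k<n. v k * of_bool (i = k)) = (\<Sum>k<n. if i = k then v k else 0)"
          by (intro sum.cong) auto
        then show "(\<Sum>k<n. v k * of_bool (i = k)) = v i"
          using v by (simp add: mat_space_def)
      qed
      ultimately show ?thesis by (simp add: vspan_eq[OF fB])
    qed
    moreover have "B \<subseteq> mat_space n" by (auto simp: B_def mat_space_def)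
    ultimately have "fin_dim (mat_space n)" unfolding fin_dim_def using fB by blast
    then show ?thesis by (rule fin_dim_subset[OF vsub \<open>S \<subseteq> mat_space n\<close>])
  qed
  have act: "\<rho> k v (idx h) = v (idx (inv k \<otimes> h))" if "h \<in> H" for k h v
    using idx[OF that] by (simp add: \<rho>_def)
  have closed: "\<rho> k v \<in> S" if k: "k \<in> H" and v: "v \<in> S" for k v
  proof -
    have "(\<Sum>m\<in>H. K h m * \<rho> k v (idx m)) = l * \<rho> k v (idx h)" if h: "h \<in> H" for h
    proof -
      have "(\<Sum>m\<in>H. K h m * \<rho> k v (idx m)) = (\<Sum>m\<in>H. K h m * v (idx (inv k \<otimes> m)))"
        by (intro sum.cong refl) (simp add: act)
      also have "\<dots> = (\<Sum>m\<in>H. K h (k \<otimes> m) * v (idx (inv k \<otimes> (k \<otimes> m))))"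
        using sum_mult_left[OF H k, of "\<lambda>m. K h m * v (idx (inv k \<otimes> m))"] by simp
      also have "\<dots> = (\<Sum>m\<in>H. K (inv k \<otimes> h) m * v (idx m))"
      proof (rule sum.cong[OF refl])
        fix m assume m: "m \<in> H"
        have "K (k \<otimes> (inv k \<otimes> h)) (k \<otimes> m) = K (inv k \<otimes> h) m"
          using HG k h m by (intro K_mult_left) auto
        then show "K h (k \<otimes> m) * v (idx (inv k \<otimes> (k \<otimes> m))) = K (inv k \<otimes> h) m * v (idx m)"
          using HG k h m by (simp add: m_assoc[symmetric])
      qed
      also have "\<dots> = l * \<rho> k v (idx h)"
        using v Hm[OF Hi[OF k] h] act[OF h] by (simp add: S_def)
      finally show ?thesis .
    qed
    then show ?thesis by (simp add: S_def \<rho>_def)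
  qed
  have rep: "is_rep (G\<lparr>carrier := H\<rparr>) S \<rho>"
    unfolding is_rep_def
  proof (intro conjI ballI vsub fdim)
    show "lin_on S (\<rho> k)" for k by (auto simp: lin_on_def \<rho>_def fun_eq_iff)
    show "\<rho> k ` S \<subseteq> S" if "k \<in> carrier (G\<lparr>carrier := H\<rparr>)" for k
      using that closed by auto
    show "\<rho> \<one>\<^bsub>G\<lparr>carrier := H\<rparr>\<^esub> v = v" if "v \<in> S" for v
    proof
      fix i
      show "\<rho> \<one>\<^bsub>G\<lparr>carrier := H\<rparr>\<^esub> v i = v i"
        using that eH[of i] HG[of "e i"] by (cases "i < n") (auto simp: \<rho>_def S_def)
    qed
    show "\<rho> (g \<otimes>\<^bsub>G\<lparr>carrier := H\<rparr>\<^esub> h) v = \<rho> g (\<rho> h v)"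
      if "g \<in> carrier (G\<lparr>carrier := H\<rparr>)" "h \<in> carrier (G\<lparr>carrier := H\<rparr>)" for g h v
    proof
      fix i
      have gh: "g \<in> H" "h \<in> H" using that by auto
      show "\<rho> (g \<otimes>\<^bsub>G\<lparr>carrier := H\<rparr>\<^esub> h) v i = \<rho> g (\<rho> h v) i"
      proof (cases "i < n")
        case True
        have "\<rho> g (\<rho> h v) i = \<rho> h v (idx (inv g \<otimes> e i))" using True by (simp add: \<rho>_def[of g])
        also have "\<dots> = v (idx (inv h \<otimes> (inv g \<otimes> e i)))"
          using gh Hm Hi eH(1)[OF True] by (intro act) auto
        also have "inv h \<otimes> (inv g \<otimes> e i) = inv (g \<otimes> h) \<otimes> e i"
          using HG gh eH(1)[OF True] by (simp add: inv_mult_group m_assoc)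
        finally show ?thesis using True by (simp add: \<rho>_def[of "g \<otimes> h"])
      qed (simp add: \<rho>_def)
    qed
  qed
  have "S \<noteq> {vzero}"
  proof
    assume S0: "S = {vzero}"
    \<comment> \<open>The eigenvector \<open>u\<close>, read through the enumeration, is a nonzero
      element of \<open>S\<close>.\<close>
    define v where "v i = (if i < n then u (e i) else 0)" for i
    have vi: "v (idx h) = u h" if "h \<in> H" for h using idx[OF that] by (simp add: v_def)
    have "(\<Sum>k\<in>H. K h k * v (idx k)) = l * v (idx h)" if "h \<in> H" for h
    proof -
      have "(\<Sum>k\<in>H. K h k * v (idx k)) = (\<Sum>k\<in>H. K h k * u k)"
        by (intro sum.cong refl) (simp add: vi)
      then show ?thesis using u_eigen[OF that] vi[OF that] by simp
    qed
    then have "v \<in> S" by (simp add: S_def v_def)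
    then have "v (idx h) = 0" for h using S0 by (simp add: vzero_def)
    then have "u h = 0" if "h \<in> H" for h using vi[OF that] by simp
    then show False using u_norm by simp
  qed
  from ex_irreducible_sub[OF rep this] obtain U
    where U: "invariant_sub (G\<lparr>carrier := H\<rparr>) S \<rho> U" "irreducible_rep (G\<lparr>carrier := H\<rparr>) U \<rho>" by blast
  have "avg H \<rho> v = (\<lambda>i. complex_of_real l * v i)" if "v \<in> U" for v
  proof
    fix i
    have v: "v \<in> S" using invariant_subD(2)[OF U(1)] that by blast
    show "avg H \<rho> v i = complex_of_real l * v i"
    proof (cases "i < n")
      case True
      have "avg H \<rho> v i = (\<Sum>m\<in>H. c m * v (idx (inv m \<otimes> e i)))"
        using True by (simp add: avg_def \<rho>_def)
      also have "\<dots> = (\<Sum>k\<in>H. K (e i) k * v (idx k))"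
        by (rule K_conv[OF eH(1)[OF True], symmetric])
      also have "\<dots> = l * v i" using v eH[OF True] by (simp add: S_def)
      finally show ?thesis .
    qed (use v in \<open>simp add: avg_def \<rho>_def S_def\<close>)
  qed
  then show thesis using that U(2) by blast
qed

end

lemma (in unitary_matrix_rep) ex_reproducing_rep:
  obtains c b where "reproducing_rep G d p c b"
proof -
  obtain c B b where c: "\<And>g. g \<in> carrier G \<Longrightarrow> c g = (\<Sum>i<d. \<Sum>k<d. B i k * p (inv g) k i)"
    "\<And>i j. i < d \<Longrightarrow> j < d \<Longrightarrow> (\<Sum>g\<in>carrier G. c g * p g i j) = of_bool (i = j)"
    "\<And>g. g \<in> carrier G \<Longrightarrow> c (inv g) = (\<Sum>k<d. \<Sum>i<d. \<Sum>j<d. cnj (b k i) * p g i j * b k j)"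
    using ex_kernel by blast
  have "matrix_coeff c" unfolding matrix_coeff_def using c(1) by blast
  then have "reproducing_rep G d p c b"
    using c(2,3) by unfold_locales
  then show thesis by (rule that)
qed

theorem theorem11:
  fixes G :: "('g,'b) monoid_scheme" and d :: nat and \<pi> :: "'g \<Rightarrow> complex mat"
    and X :: "'x set" and act :: "'g \<Rightarrow> 'x \<Rightarrow> 'x" and f :: "'g \<Rightarrow> 'x" and H :: "'g set"
  assumes grp: "group G" and fin: "finite (carrier G)"
    and d_pos: "d > 0"
    and pi_unitary: "\<forall>g\<in>carrier G. unitary_mat d (\<pi> g)"
    and pi_one: "\<pi> \<one>\<^bsub>G\<^esub> = 1\<^sub>m d"
    and pi_mult: "\<forall>g\<in>carrier G. \<forall>h\<in>carrier G. \<pi> (g \<otimes>\<^bsub>G\<^esub> h) = \<pi> g * \<pi> h"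
    and act_closed: "\<forall>g\<in>carrier G. \<forall>x\<in>X. act g x \<in> X"
    and act_one: "\<forall>x\<in>X. act \<one>\<^bsub>G\<^esub> x = x"
    and act_mult: "\<forall>g\<in>carrier G. \<forall>h\<in>carrier G. \<forall>x\<in>X. act (g \<otimes>\<^bsub>G\<^esub> h) x = act g (act h x)"
    and transitive: "\<forall>x\<in>X. \<forall>y\<in>X. \<exists>g\<in>carrier G. act g x = y"
    and f_onto: "f ` carrier G = X"
    and f_equiv: "\<forall>g\<in>carrier G. \<forall>a\<in>carrier G. f (g \<otimes>\<^bsub>G\<^esub> a) = act g (f a)"
    and H_def: "H = {g \<in> carrier G. f g = f \<one>\<^bsub>G\<^esub>}"
  shows "\<exists>P :: real.
     (\<exists>N \<psi> U E. is_algorithm d X N \<psi> U E \<and> success_prob G d \<pi> f N \<psi> U E = P)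
   \<and> (\<forall>N \<psi> U E. is_algorithm d X N \<psi> U E \<longrightarrow> success_prob G d \<pi> f N \<psi> U E \<le> P)
   \<and> (\<exists>(S :: (nat \<Rightarrow> complex) set) \<rho>. irreducible_rep (G\<lparr>carrier := H\<rparr>) S \<rho> \<and>
        P = real (part_dim G (ind_space G H S \<rho>) (ind_act G) (mat_space d) (mat_act d \<pi>))
            / real (vdim (ind_space G H S \<rho>)))
   \<and> (\<forall>(S :: (nat \<Rightarrow> complex) set) \<rho>. irreducible_rep (G\<lparr>carrier := H\<rparr>) S \<rho> \<longrightarrow>
        real (part_dim G (ind_space G H S \<rho>) (ind_act G) (mat_space d) (mat_act d \<pi>))
            / real (vdim (ind_space G H S \<rho>)) \<le> P)"
proof -
  interpret group G by (rule grp)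
  define p where "p g i j = \<pi> g $$ (i,j)" for g i j
  have \<pi>c: "\<pi> g \<in> carrier_mat d d" if "g \<in> carrier G" for g
    using pi_unitary that by (simp add: unitary_mat_def)
  have "unitary_matrix_rep G d p"
  proof
    show "p \<one>\<^bsub>G\<^esub> i j = of_bool (i = j)" if "i < d" "j < d" for i j
      using that by (simp add: p_def pi_one)
    show "p (g \<otimes>\<^bsub>G\<^esub> h) i j = (\<Sum>k<d. p g i k * p h k j)"
      if "g \<in> carrier G" "h \<in> carrier G" "i < d" "j < d" for g h i j
      using that \<pi>c[of g] \<pi>c[of h] pi_mult by (simp add: p_def scalar_prod_def atLeast0LessThan)
    show "p (inv\<^bsub>G\<^esub> g) i j = cnj (p g j i)" if g: "g \<in> carrier G" and ij: "i < d" "j < d" for g i j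
    proof -
      have adj: "adj (\<pi> g) \<in> carrier_mat d d" using \<pi>c[OF g] by (simp add: adj_def)
      have "\<pi> (inv\<^bsub>G\<^esub> g) = \<pi> (inv\<^bsub>G\<^esub> g) * (\<pi> g * adj (\<pi> g))"
        using pi_unitary g right_mult_one_mat[OF \<pi>c[OF inv_closed[OF g]]] by (simp add: unitary_mat_def)
      also have "\<dots> = (\<pi> (inv\<^bsub>G\<^esub> g) * \<pi> g) * adj (\<pi> g)"
        using \<pi>c[OF g] \<pi>c[of "inv\<^bsub>G\<^esub> g"] adj g by (intro assoc_mult_mat[symmetric]) auto
      also have "\<pi> (inv\<^bsub>G\<^esub> g) * \<pi> g = 1\<^sub>m d"
        using pi_mult[rule_format, of "inv\<^bsub>G\<^esub> g" g] g pi_one by simp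
      finally have "\<pi> (inv\<^bsub>G\<^esub> g) = adj (\<pi> g)" using adj by simp
      then show ?thesis using \<pi>c[OF g] ij by (simp add: p_def adj_def)
    qed
  qed (use fin d_pos in auto)
  then interpret R: unitary_matrix_rep G d p .
  obtain c b where "reproducing_rep G d p c b" by (rule R.ex_reproducing_rep)
  then interpret reproducing_rep G d p c b .
  have f_act: "f (g \<otimes>\<^bsub>G\<^esub> h) = act g (f h)" if "g \<in> carrier G" "h \<in> carrier G" for g h
    using f_equiv that by blast
  have f_inv: "act (inv\<^bsub>G\<^esub> g) (f g) = f \<one>\<^bsub>G\<^esub>" if "g \<in> carrier G" for g
    using f_act[of "inv\<^bsub>G\<^esub> g" g] that by simp
  have H: "subgroup H G"
  proof
    show "H \<subseteq> carrier G" "\<one>\<^bsub>G\<^esub> \<in> H" by (auto simp: H_def)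
    show "x \<otimes>\<^bsub>G\<^esub> y \<in> H" if "x \<in> H" "y \<in> H" for x y
      using that f_act[of x y] f_act[of x "\<one>\<^bsub>G\<^esub>"] by (simp add: H_def)
    show "inv\<^bsub>G\<^esub> x \<in> H" if "x \<in> H" for x
      using that f_inv[of x] f_act[of "inv\<^bsub>G\<^esub> x" "\<one>\<^bsub>G\<^esub>"] by (simp add: H_def)
  qed
  \<comment> \<open>By equivariance both values can be translated by the inverse of
    \<open>g\<close>, so the fibres of \<open>f\<close> are the left cosets of
    \<open>H\<close>.\<close>
  have fibre: "f g = f h \<longleftrightarrow> inv\<^bsub>G\<^esub> g \<otimes>\<^bsub>G\<^esub> h \<in> H" if g: "g \<in> carrier G" and h: "h \<in> carrier G" for g h
  proof
    assume "f g = f h"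
    then show "inv\<^bsub>G\<^esub> g \<otimes>\<^bsub>G\<^esub> h \<in> H" using g h f_act[of "inv\<^bsub>G\<^esub> g" h] f_inv[of g] by (simp add: H_def)
  next
    assume "inv\<^bsub>G\<^esub> g \<otimes>\<^bsub>G\<^esub> h \<in> H"
    then have "f (inv\<^bsub>G\<^esub> g \<otimes>\<^bsub>G\<^esub> h) = f \<one>\<^bsub>G\<^esub>" by (simp add: H_def)
    then have "f (g \<otimes>\<^bsub>G\<^esub> (inv\<^bsub>G\<^esub> g \<otimes>\<^bsub>G\<^esub> h)) = f (g \<otimes>\<^bsub>G\<^esub> \<one>\<^bsub>G\<^esub>)" using g h by (simp only: f_act inv_closed m_closed one_closed)
    then show "f g = f h" using g h by (simp add: m_assoc[symmetric])
  qed
  obtain l u where "coset_rep G d p c b H l u" by (rule ex_coset_rep[OF H])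
  then interpret coset_rep G d p c b H l u .
  have p: "p g i j = \<pi> g $$ (i,j)" if "g \<in> carrier G" for g i j by (simp add: p_def)
  have le: "success_prob G d \<pi> f N \<psi> U E \<le> l" if "is_algorithm d X N \<psi> U E" for N \<psi> U E
    by (rule success_prob_le[OF p fibre f_onto that])
  obtain N \<psi> U E where alg: "is_algorithm d X N \<psi> U E" "l \<le> success_prob G d \<pi> f N \<psi> U E"
    using ex_algorithm_ge[OF p fibre f_onto] by blast
  obtain S :: "(nat \<Rightarrow> complex) set" and \<rho> where S: "irreducible_rep (G\<lparr>carrier := H\<rparr>) S \<rho>"
    "\<forall>s\<in>S. avg H \<rho> s = (\<lambda>i. complex_of_real l * s i)"
    by (rule ex_irreducible_eigenvalue)
  show ?thesis
  \<comment> \<open>The top eigenvalue is where both descriptions meet: the best success probability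
    on one side, the largest ratio of dimensions on the other.\<close>
  proof (intro exI[of _ l] conjI allI impI)
    show "\<exists>N \<psi> U E. is_algorithm d X N \<psi> U E \<and> success_prob G d \<pi> f N \<psi> U E = l"
      using alg le[OF alg(1)] by (intro exI[of _ N] exI[of _ \<psi>] exI[of _ U] exI[of _ E]) simp
    show "\<exists>(S :: (nat \<Rightarrow> complex) set) \<rho>. irreducible_rep (G\<lparr>carrier := H\<rparr>) S \<rho> \<and>
        l = real (part_dim G (ind_space G H S \<rho>) (ind_act G) (mat_space d) (mat_act d \<pi>))
            / real (vdim (ind_space G H S \<rho>))"
    proof (intro exI[of _ S] exI[of _ \<rho>] conjI S(1))
      show "l = real (part_dim G (ind_space G H S \<rho>) (ind_act G) (mat_space d) (mat_act d \<pi>))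
            / real (vdim (ind_space G H S \<rho>))"
        using part_dim_ind[OF p H S(1) bspec[OF S(2)]] by (simp only: of_real_eq_iff)
    qed
  qed (rule le ratio_le[OF p], assumption)+
qed

end
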